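(* Let $\Lambda^{(1)},\dots,\Lambda^{(n)}$ be integral dominant $\mathfrak{gl}_N$-weights with $\Lambda^{(s)}_N=0$ for all $s$, let $z_1,\dots,z_n\in\mathbb C$ and $\boldsymbol m=(m_1,\dots,m_N)$. Let $K$ be the zero matrix. For any $i=1,\dots,N$ and any nonzero vector $v_0\in\mathrm{Sing}\,\mathcal M_{\boldsymbol\Lambda}(\boldsymbol z)[m_1,\dots,m_N]$ there exists a $\mathrm{Sing}\,\mathcal M_{\boldsymbol\Lambda}(\boldsymbol z)[\boldsymbol m]$-valued polynomial $$v_0u^{m_i+N-i}+v_1u^{m_i+N-i-1}+\dots+v_{m_i+N-i}$$ which lies in the kernel of $\mathcal D_{K=0,\,\mathrm{Sing}\,\mathcal M_{\boldsymbol\Lambda}(\boldsymbol z)[\boldsymbol m]}(u,\partial_u)$. Moreover, the $\mathbb C$-span of all such polynomials is the kernel of $\mathcal D_{K=0,\,\mathrm{Sing}\,\mathcal M_{\boldsymbol\Lambda}(\boldsymbol z)[\boldsymbol m]}(u,\partial_u)$.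
   Context: $e_{ab}$ are the standard generators of $\mathfrak{gl}_N$. An integral dominant weight is $\Lambda=(\Lambda_1,\dots,\Lambda_N)$ with $\Lambda_a-\Lambda_{a+1}\in\mathbb Z_{\ge0}$; $M_\Lambda$ is the irreducible finite-dimensional $\mathfrak{gl}_N$-module with highest weight $\Lambda$. $\mathcal M_{\boldsymbol\Lambda}(\boldsymbol z)=M_{\Lambda^{(1)}}(z_1)\otimes\dots\otimes M_{\Lambda^{(n)}}(z_n)$ is the tensor product of evaluation $\mathfrak{gl}_N[x]$-modules, i.e. the vector space $M_{\Lambda^{(1)}}\otimes\dots\otimes M_{\Lambda^{(n)}}$ on which $e_{ab}x^s$ acts as $\sum_jz_j^se^{(j)}_{ab}$, where $e^{(j)}_{ab}$ is $e_{ab}$ acting on the $j$-th factor. $\mathfrak{gl}_N$ acts by $e_{ab}\mapsto\sum_je^{(j)}_{ab}$; $\mathcal M_{\boldsymbol\Lambda}(\boldsymbol z)[\boldsymbol m]$ is the subspace of vectors $x$ with $e_{aa}x=m_ax$ for all $a$, and $\mathrm{Sing}\,\mathcal M_{\boldsymbol\Lambda}(\boldsymbol z)[\boldsymbol m]$ is its subspace of singular vectors, i.e. those with $e_{ab}x=0$ for all $a<b$ (assumed nonzero). With $\partial_u=d/du$, the universal differential operator for $K=0$ is $$\sum_{\sigma\in S_N}(-1)^\sigma X_{1\sigma_1}X_{2\sigma_2}\cdots X_{N\sigma_N},\qquad X_{ab}=\delta_{ab}\partial_u-\sum_{j=1}^n\frac{e^{(j)}_{ba}}{u-z_j}.$$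 Its coefficients commute with the $\mathfrak{gl}_N$-action, and $\mathcal D_{K=0,\,\mathrm{Sing}\,\mathcal M_{\boldsymbol\Lambda}(\boldsymbol z)[\boldsymbol m]}(u,\partial_u)$ is its restriction to $\mathrm{Sing}\,\mathcal M_{\boldsymbol\Lambda}(\boldsymbol z)[\boldsymbol m]$-valued functions. The kernel is the space of solutions, holomorphic on a fixed connected simply connected nonempty open set avoiding the $z_j$; it has dimension $N\dim\mathrm{Sing}\,\mathcal M_{\boldsymbol\Lambda}(\boldsymbol z)[\boldsymbol m]$. *)

theory Defs
  imports
    "HOL-Complex_Analysis.Complex_Analysis"
    "HOL-Combinatorics.Permutations"
    "HOL-Library.Function_Algebras"
    "HOL-Library.FuncSet"
    "Jordan_Normal_Form.Matrix"
begin

text \<open>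
  Conventions. The indices of \<open>gl\<^sub>N\<close> range over \<open>{1..N}\<close> and the tensor factors over \<open>{1..n}\<close>.
  A finite-dimensional module is given in coordinates: its space is \<open>carrier_vec d\<close>, and \<open>E a b\<close> is
  the matrix of the generator \<open>e\<^sub>a\<^sub>b\<close>. Every finite-dimensional module has this form up to the choice
  of a basis, so results are to be stated for all matrix realizations \<open>E\<close>.
\<close>

definition integral_dominant :: "nat \<Rightarrow> (nat \<Rightarrow> complex) \<Rightarrow> bool" where
  "integral_dominant N \<Lambda> \<longleftrightarrow> (\<forall>a\<in>{1..<N}. \<Lambda> a - \<Lambda> (a + 1) \<in> \<nat>)"

definition gl_module :: "nat \<Rightarrow> nat \<Rightarrow> (nat \<Rightarrow> nat \<Rightarrow> complex mat) \<Rightarrow> bool" where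
  "gl_module N d E \<longleftrightarrow>
     (\<forall>a\<in>{1..N}. \<forall>b\<in>{1..N}. E a b \<in> carrier_mat d d) \<and>
     (\<forall>a\<in>{1..N}. \<forall>b\<in>{1..N}. \<forall>c\<in>{1..N}. \<forall>f\<in>{1..N}.
        E a b * E c f - E c f * E a b
          = (if b = c then E a f else 0\<^sub>m d d) - (if f = a then E c b else 0\<^sub>m d d))"

definition gl_submodule ::
    "nat \<Rightarrow> nat \<Rightarrow> (nat \<Rightarrow> nat \<Rightarrow> complex mat) \<Rightarrow> complex vec set \<Rightarrow> bool" where
  "gl_submodule N d E W \<longleftrightarrow>
     W \<subseteq> carrier_vec d \<and> 0\<^sub>v d \<in> W \<and>
     (\<forall>x\<in>W. \<forall>y\<in>W. x + y \<in> W) \<and> (\<forall>c. \<forall>x\<in>W. c \<cdot>\<^sub>v x \<in> W) \<and>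
     (\<forall>a\<in>{1..N}. \<forall>b\<in>{1..N}. \<forall>x\<in>W. E a b *\<^sub>v x \<in> W)"

definition gl_irreducible :: "nat \<Rightarrow> nat \<Rightarrow> (nat \<Rightarrow> nat \<Rightarrow> complex mat) \<Rightarrow> bool" where
  "gl_irreducible N d E \<longleftrightarrow>
     gl_module N d E \<and> 0 < d \<and>
     (\<forall>W. gl_submodule N d E W \<longrightarrow> W = {0\<^sub>v d} \<or> W = carrier_vec d)"

definition has_highest_weight ::
    "nat \<Rightarrow> nat \<Rightarrow> (nat \<Rightarrow> nat \<Rightarrow> complex mat) \<Rightarrow> (nat \<Rightarrow> complex) \<Rightarrow> bool" where
  "has_highest_weight N d E \<Lambda> \<longleftrightarrow>
     (\<exists>v\<in>carrier_vec d. v \<noteq> 0\<^sub>v d \<and>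
        (\<forall>a\<in>{1..N}. E a a *\<^sub>v v = \<Lambda> a \<cdot>\<^sub>v v) \<and>
        (\<forall>a\<in>{1..N}. \<forall>b\<in>{1..N}. a < b \<longrightarrow> E a b *\<^sub>v v = 0\<^sub>v d))"

text \<open>Matrix realizations \<open>(d, E)\<close> of \<open>M\<^sub>\<Lambda>\<close>.\<close>

definition is_M :: "nat \<Rightarrow> (nat \<Rightarrow> complex) \<Rightarrow> nat \<Rightarrow> (nat \<Rightarrow> nat \<Rightarrow> complex mat) \<Rightarrow> bool" where
  "is_M N \<Lambda> d E \<longleftrightarrow> gl_irreducible N d E \<and> has_highest_weight N d E \<Lambda>"

text \<open>
  The tensor product of the spaces \<open>carrier_vec (d 1), \<dots>, carrier_vec (d n)\<close> has the basis
  \<open>e\<^bsub>k 1\<^esub> \<otimes> \<dots> \<otimes> e\<^bsub>k n\<^esub>\<close> indexed by the multi-indices \<open>k \<in> tensor_index n d\<close>. A tensor is the family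
  of its coordinates in this basis, extended by \<open>0\<close> to all other \<open>k\<close>.
\<close>

type_synonym tensor = "(nat \<Rightarrow> nat) \<Rightarrow> complex"

definition tensor_index :: "nat \<Rightarrow> (nat \<Rightarrow> nat) \<Rightarrow> (nat \<Rightarrow> nat) set" where
  "tensor_index n d = (\<Pi>\<^sub>E j\<in>{1..n}. {..<d j})"

definition tensor_space :: "nat \<Rightarrow> (nat \<Rightarrow> nat) \<Rightarrow> tensor set" where
  "tensor_space n d = {x. \<forall>k. k \<notin> tensor_index n d \<longrightarrow> x k = 0}"

definition tscale :: "complex \<Rightarrow> tensor \<Rightarrow> tensor" where
  "tscale c x = (\<lambda>k. c * x k)"

text \<open>
  \<open>factor_op n d j A\<close> is \<open>1 \<otimes> \<dots> \<otimes> A \<otimes> \<dots> \<otimes> 1\<close> with \<open>A\<close> at position \<open>j\<close>, so \<open>e\<^sub>a\<^sub>b\<^sup>(\<^sup>j\<^sup>)\<close> is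
  \<open>factor_op n d j (E j a b)\<close>.
\<close>

definition factor_op :: "nat \<Rightarrow> (nat \<Rightarrow> nat) \<Rightarrow> nat \<Rightarrow> complex mat \<Rightarrow> tensor \<Rightarrow> tensor" where
  "factor_op n d j A x =
     (\<lambda>k. if k \<in> tensor_index n d then \<Sum>c<d j. A $$ (k j, c) * x (k(j := c)) else 0)"

text \<open>The action of \<open>e\<^sub>a\<^sub>b x\<^sup>s\<close> on the tensor product of evaluation modules.\<close>

definition ev_action ::
    "nat \<Rightarrow> (nat \<Rightarrow> nat) \<Rightarrow> (nat \<Rightarrow> nat \<Rightarrow> nat \<Rightarrow> complex mat) \<Rightarrow> (nat \<Rightarrow> complex)
      \<Rightarrow> nat \<Rightarrow> nat \<Rightarrow> nat \<Rightarrow> tensor \<Rightarrow> tensor" where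
  "ev_action n d E z s a b x = (\<Sum>j\<in>{1..n}. tscale (z j ^ s) (factor_op n d j (E j a b) x))"

definition gl_action ::
    "nat \<Rightarrow> (nat \<Rightarrow> nat) \<Rightarrow> (nat \<Rightarrow> nat \<Rightarrow> nat \<Rightarrow> complex mat) \<Rightarrow> nat \<Rightarrow> nat \<Rightarrow> tensor \<Rightarrow> tensor" where
  "gl_action n d E a b x = (\<Sum>j\<in>{1..n}. factor_op n d j (E j a b) x)"

lemma ev_action_0: "ev_action n d E z 0 a b = gl_action n d E a b"
  by (simp add: ev_action_def gl_action_def tscale_def fun_eq_iff)

definition weight_space ::
    "nat \<Rightarrow> nat \<Rightarrow> (nat \<Rightarrow> nat) \<Rightarrow> (nat \<Rightarrow> nat \<Rightarrow> nat \<Rightarrow> complex mat) \<Rightarrow> (nat \<Rightarrow> complex) \<Rightarrow> tensor set" where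
  "weight_space N n d E m =
     {x \<in> tensor_space n d. \<forall>a\<in>{1..N}. gl_action n d E a a x = tscale (m a) x}"

definition Sing ::
    "nat \<Rightarrow> nat \<Rightarrow> (nat \<Rightarrow> nat) \<Rightarrow> (nat \<Rightarrow> nat \<Rightarrow> nat \<Rightarrow> complex mat) \<Rightarrow> (nat \<Rightarrow> complex) \<Rightarrow> tensor set" where
  "Sing N n d E m =
     {x \<in> weight_space N n d E m.
        \<forall>a\<in>{1..N}. \<forall>b\<in>{1..N}. a < b \<longrightarrow> gl_action n d E a b x = 0}"

text \<open>
  The operators act on tensor-valued functions of \<open>u\<close>, which are differentiated coordinatewise.
  In \<open>X_op\<close> the generator is \<open>e\<^sub>b\<^sub>a\<close>, with the indices transposed.
\<close>

definition X_op ::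
    "nat \<Rightarrow> (nat \<Rightarrow> nat) \<Rightarrow> (nat \<Rightarrow> nat \<Rightarrow> nat \<Rightarrow> complex mat) \<Rightarrow> (nat \<Rightarrow> complex)
      \<Rightarrow> nat \<Rightarrow> nat \<Rightarrow> (complex \<Rightarrow> tensor) \<Rightarrow> complex \<Rightarrow> tensor" where
  "X_op n d E z a b f = (\<lambda>u.
     (if a = b then (\<lambda>k. deriv (\<lambda>w. f w k) u) else 0)
     - (\<Sum>j\<in>{1..n}. tscale (1 / (u - z j)) (factor_op n d j (E j b a) (f u))))"

text \<open>The \<open>foldr\<close> is the composition \<open>X\<^bsub>1 \<sigma>1\<^esub> (X\<^bsub>2 \<sigma>2\<^esub> (\<dots> (X\<^bsub>N \<sigma>N\<^esub> f)))\<close>.\<close>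

definition univ_diff_op ::
    "nat \<Rightarrow> nat \<Rightarrow> (nat \<Rightarrow> nat) \<Rightarrow> (nat \<Rightarrow> nat \<Rightarrow> nat \<Rightarrow> complex mat) \<Rightarrow> (nat \<Rightarrow> complex)
      \<Rightarrow> (complex \<Rightarrow> tensor) \<Rightarrow> complex \<Rightarrow> tensor" where
  "univ_diff_op N n d E z f = (\<lambda>u.
     \<Sum>\<sigma> | \<sigma> permutes {1..N}.
       tscale (of_int (sign \<sigma>)) (foldr (\<lambda>a. X_op n d E z a (\<sigma> a)) [1..<N+1] f u))"

text \<open>
  Functions on the open set \<open>U\<close> are represented by functions on \<open>\<complex>\<close> that vanish outside \<open>U\<close>, so that
  equality and linear combinations are those of functions on \<open>U\<close>. The restriction of the operator to
  Sing-valued functions is obtained by applying it to such functions.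
\<close>

definition restrict0 :: "complex set \<Rightarrow> (complex \<Rightarrow> tensor) \<Rightarrow> complex \<Rightarrow> tensor" where
  "restrict0 U f = (\<lambda>u. if u \<in> U then f u else 0)"

definition Sing_kernel ::
    "nat \<Rightarrow> nat \<Rightarrow> (nat \<Rightarrow> nat) \<Rightarrow> (nat \<Rightarrow> nat \<Rightarrow> nat \<Rightarrow> complex mat) \<Rightarrow> (nat \<Rightarrow> complex) \<Rightarrow> (nat \<Rightarrow> complex)
      \<Rightarrow> complex set \<Rightarrow> (complex \<Rightarrow> tensor) set" where
  "Sing_kernel N n d E z m U =
     {f. (\<forall>u. u \<notin> U \<longrightarrow> f u = 0) \<and>
         (\<forall>u\<in>U. f u \<in> Sing N n d E m) \<and>
         (\<forall>k. (\<lambda>u. f u k) holomorphic_on U) \<and>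
         (\<forall>u\<in>U. univ_diff_op N n d E z f u = 0)}"

text \<open>The polynomial \<open>v\<^sub>0 u\<^sup>r + v\<^sub>1 u\<^sup>r\<^sup>-\<^sup>1 + \<dots> + v\<^sub>r\<close>.\<close>

definition tensor_poly :: "nat \<Rightarrow> (nat \<Rightarrow> tensor) \<Rightarrow> complex \<Rightarrow> tensor" where
  "tensor_poly r v = (\<lambda>u. \<Sum>k\<le>r. tscale (u ^ (r - k)) (v k))"

text \<open>
  The polynomials of the required form with index \<open>i\<close> and leading coefficient \<open>v0\<close> (as functions
  on \<open>U\<close>) that lie in the kernel. The weight \<open>m\<close> is complex, hence the exponent \<open>m\<^sub>i + N - i\<close> is required to be
  a natural number \<open>r\<close>.
\<close>

definition kernel_polys ::
    "nat \<Rightarrow> nat \<Rightarrow> (nat \<Rightarrow> nat) \<Rightarrow> (nat \<Rightarrow> nat \<Rightarrow> nat \<Rightarrow> complex mat) \<Rightarrow> (nat \<Rightarrow> complex) \<Rightarrow> (nat \<Rightarrow> complex)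
      \<Rightarrow> complex set \<Rightarrow> nat \<Rightarrow> tensor \<Rightarrow> (complex \<Rightarrow> tensor) set" where
  "kernel_polys N n d E z m U i v0 =
     {restrict0 U (tensor_poly r v) | r v.
        of_nat r = m i + of_nat N - of_nat i \<and>
        v 0 = v0 \<and> (\<forall>k\<le>r. v k \<in> Sing N n d E m) \<and>
        restrict0 U (tensor_poly r v) \<in> Sing_kernel N n d E z m U}"

definition fscale :: "complex \<Rightarrow> (complex \<Rightarrow> tensor) \<Rightarrow> complex \<Rightarrow> tensor" where
  "fscale c f = (\<lambda>u. tscale c (f u))"

global_interpretation tensor_fun: vector_space fscale
  by unfold_locales (simp_all add: fscale_def tscale_def fun_eq_iff algebra_simps)

end

theory Submission
  imports Defs
begin

text \<open>
  Every \<open>M\<^sub>\<Lambda>\<close> is a quotient of the submodule generated by a Young antisymmetrized vector in a tensor power of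
  the vector representation. This reduces the existence of solutions to tensor powers of the vector
  representation, with every point repeated. There the operator is
  \<open>\<Sum>\<^sub>J (-1)\<^bsup>card J\<^esup> (\<Prod>\<^bsub>p \<in> J\<^esub> 1 / (u - z\<^sub>p)) A\<^sub>J \<partial>\<^bsup>N - card J\<^esup>\<close>, with \<open>J\<close> running over the sets of positions and
  \<open>A\<^sub>J\<close> the antisymmetrizer of \<open>J\<close>, and it has an explicit polynomial Green function made of symmetrizers.
  Hence every solution of \<open>D f = 0\<close> is a polynomial of bounded degree, determined by arbitrary Cauchy data of
  order \<open>N\<close>, and the kernel on \<open>Sing\<close>-valued functions has dimension \<open>N dim Sing\<close>. The degree \<open>r\<close> of a solution
  satisfies the indicial equation \<open>\<Prod>\<^sub>i (r - m\<^sub>i - N + i) = 0\<close> at infinity, which has at most \<open>N\<close> roots, and the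
  leading coefficients in a given degree form a subspace of \<open>Sing\<close>. Comparing dimensions, there are \<open>N\<close> degrees,
  and every vector of \<open>Sing\<close> is a leading coefficient in each of them.
\<close>

subsection \<open>Sums over sets of positions\<close>

text \<open>The determinant is tractable on the vector representation because the generators there
  are matrix units: after normal ordering, the terms with two generators at one position cancel in
  the alternating sum, so each position is used at most once and only antisymmetrizers remain.
  Nowhere are the points assumed distinct, so the many positions belonging to one factor cost
  nothing. The Green function is made of symmetrizers because an antisymmetrizer kills a symmetrizer
  that shares two positions with it; only pairs of sets meeting in at most one position matter. Its
  poles in the base point are cleared by a scalar factor, after which every coefficient in that
  variable is itself a solution. The descent to submodules and quotients rests on one recursion. As
  the coefficient of the \<open>N\<close>-th derivative is 1, the first \<open>N\<close> Taylor
  coefficients determine the others, modulo any subspace stable under the generators of each factor.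
  For a submodule this keeps solutions inside it; for the zero subspace it is uniqueness, which also
  shows that solutions with singular data of weight \<open>m\<close> stay singular of weight
  \<open>m\<close>.\<close>

instance fps :: (ring_char_0) ring_char_0 ..

text \<open>A function of colourings \<open>\<kappa>\<close> is a tensor in a power of the vector
  representation: \<open>\<kappa> p\<close> is the index of the basis vector at position
  \<open>p\<close>. Permutations of positions act by precomposition, and this is the antisymmetrizer
  without the factor \<open>1 / fact (card J)\<close>. The value ring is general so that power
  series are covered as well.\<close>

definition alternize :: "'p set \<Rightarrow> (('p \<Rightarrow> nat) \<Rightarrow> 'r :: comm_ring_1) \<Rightarrow> ('p \<Rightarrow> nat) \<Rightarrow> 'r" where
  "alternize J y \<kappa> = (\<Sum>\<pi> | \<pi> permutes J. of_int (sign \<pi>) * y (\<kappa> \<circ> \<pi>))"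

definition symmetrize :: "'p set \<Rightarrow> (('p \<Rightarrow> nat) \<Rightarrow> 'r :: comm_ring_1) \<Rightarrow> ('p \<Rightarrow> nat) \<Rightarrow> 'r" where
  "symmetrize I y \<kappa> = (\<Sum>\<pi> | \<pi> permutes I. y (\<kappa> \<circ> \<pi>))"

text \<open>The coset decomposition with the transposition on the other side than in
  \<open>sum_over_permutations_insert\<close>; inverting all permutations exchanges the two.\<close>

lemma sum_permutes_insert_right:
  assumes "finite S" "c \<notin> S"
  shows "(\<Sum>\<pi> | \<pi> permutes insert c S. f \<pi>) = (\<Sum>b\<in>insert c S. \<Sum>\<pi> | \<pi> permutes S. f (\<pi> \<circ> Transposition.transpose c b))"
proof -
  have "(\<Sum>\<pi> | \<pi> permutes insert c S. f \<pi>) = (\<Sum>\<pi> | \<pi> permutes insert c S. f (Hilbert_Choice.inv \<pi>))"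
    by (rule sum_permutations_inverse)
  also have "\<dots> = (\<Sum>b\<in>insert c S. \<Sum>\<pi> | \<pi> permutes S. f (Hilbert_Choice.inv (Transposition.transpose c b \<circ> \<pi>)))"
    by (rule sum_over_permutations_insert) (use assms in auto)
  also have "\<dots> = (\<Sum>b\<in>insert c S. \<Sum>\<pi> | \<pi> permutes S. f (Hilbert_Choice.inv \<pi> \<circ> Transposition.transpose c b))"
    by (intro sum.cong refl) (simp add: o_inv_distrib permutes_bij)
  also have "\<dots> = (\<Sum>b\<in>insert c S. \<Sum>\<pi> | \<pi> permutes S. f (\<pi> \<circ> Transposition.transpose c b))"
    by (intro sum.cong refl sum_permutations_inverse[symmetric])
  finally show ?thesis .
qed

lemma alternize_insert:
  assumes "finite J" "c \<notin> J"
  shows "alternize (insert c J) y \<kappa> = alternize J y \<kappa> - (\<Sum>j\<in>J. alternize J (\<lambda>\<kappa>. y (\<kappa> \<circ> Transposition.transpose c j)) \<kappa>)"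
proof -
  have s: "sign (\<pi> \<circ> Transposition.transpose c j) = - sign \<pi>" if "\<pi> permutes J" "j \<in> J" for \<pi> j
  proof -
    have "permutation \<pi>" using that assms permutation_permutes by blast
    then show ?thesis using that assms by (auto simp: sign_compose permutation_swap_id sign_swap_id)
  qed
  show ?thesis unfolding alternize_def sum_permutes_insert_right[OF assms]
    by (subst sum.insert) (use assms s in \<open>simp_all add: sum_negf[symmetric] o_assoc\<close>)
qed

text \<open>Here the transposition acts outside \<open>symmetrize I y\<close>, whereas in
  \<open>alternize_insert\<close> it acts directly on the argument. With these choices both give the
  same cross terms once an antisymmetrizer is applied to a symmetrizer.\<close>

lemma symmetrize_insert:
  assumes "finite I" "c \<notin> I"
  shows "symmetrize (insert c I) y \<kappa> = symmetrize I y \<kappa> + (\<Sum>i\<in>I. symmetrize I y (\<kappa> \<circ> Transposition.transpose c i))"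
proof -
  have "symmetrize (insert c I) y \<kappa> = (\<Sum>b\<in>insert c I. \<Sum>\<pi> | \<pi> permutes I. y (\<kappa> \<circ> (Transposition.transpose c b \<circ> \<pi>)))"
    unfolding symmetrize_def by (rule sum_over_permutations_insert) (use assms in auto)
  then show ?thesis using assms by (simp add: symmetrize_def o_assoc)
qed

lemma symmetrize_transpose:
  assumes "a \<in> I" "b \<in> I"
  shows "symmetrize I y (\<kappa> \<circ> Transposition.transpose a b) = symmetrize I y \<kappa>"
  unfolding symmetrize_def
  by (rule sum.reindex_bij_witness[of _ "\<lambda>\<pi>. Transposition.transpose a b \<circ> \<pi>" "\<lambda>\<pi>. Transposition.transpose a b \<circ> \<pi>"])
     (use permutes_swap_id[OF assms] in \<open>auto simp: o_assoc intro: permutes_compose\<close>)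

text \<open>Composition with a transposition flips the sign and keeps \<open>h\<close>, so the sum
  is its own negative; characteristic zero makes it vanish.\<close>

lemma sum_sign_transpose_right:
  fixes h :: "('p \<Rightarrow> 'p) \<Rightarrow> 'r :: {idom, ring_char_0}"
  assumes "finite A" "a \<in> A" "i \<in> A" "a \<noteq> i" "\<And>\<sigma>. \<sigma> permutes A \<Longrightarrow> h (\<sigma> \<circ> Transposition.transpose a i) = h \<sigma>"
  shows "(\<Sum>\<sigma> | \<sigma> permutes A. of_int (sign \<sigma>) * h \<sigma>) = 0"
proof -
  let ?t = "Transposition.transpose a i"
  have t: "?t permutes A" using assms by (intro permutes_swap_id)
  have "(\<Sum>\<sigma> | \<sigma> permutes A. of_int (sign \<sigma>) * h \<sigma>) = (\<Sum>\<sigma> | \<sigma> permutes A. of_int (sign (\<sigma> \<circ> ?t)) * h (\<sigma> \<circ> ?t))"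
    by (rule sum.reindex_bij_witness[of _ "\<lambda>\<sigma>. \<sigma> \<circ> ?t" "\<lambda>\<sigma>. \<sigma> \<circ> ?t"])
       (use t in \<open>auto simp: o_assoc[symmetric] intro: permutes_compose\<close>)
  also have "\<dots> = - (\<Sum>\<sigma> | \<sigma> permutes A. of_int (sign \<sigma>) * h \<sigma>)"
    unfolding sum_negf[symmetric]
  proof (intro sum.cong refl, goal_cases)
    case (1 \<sigma>)
    then have "permutation \<sigma>" using assms(1) permutation_permutes by blast
    then show ?case using 1 assms
      by (simp add: sign_compose permutation_swap_id sign_swap_id)
  qed
  finally show ?thesis by (simp add: eq_neg_iff_add_eq_0 flip: mult_2)
qed

lemma sum_sign_transpose_left:
  fixes h :: "('p \<Rightarrow> 'p) \<Rightarrow> 'r :: {idom, ring_char_0}"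
  assumes "finite A" "a \<in> A" "i \<in> A" "a \<noteq> i" "\<And>\<sigma>. \<sigma> permutes A \<Longrightarrow> h (Transposition.transpose a i \<circ> \<sigma>) = h \<sigma>"
  shows "(\<Sum>\<sigma> | \<sigma> permutes A. of_int (sign \<sigma>) * h \<sigma>) = 0"
proof -
  have "(\<Sum>\<sigma> | \<sigma> permutes A. of_int (sign \<sigma>) * h \<sigma>) = (\<Sum>\<sigma> | \<sigma> permutes A. of_int (sign (Hilbert_Choice.inv \<sigma>)) * h (Hilbert_Choice.inv \<sigma>))"
    by (rule sum_permutations_inverse)
  also have "\<dots> = (\<Sum>\<sigma> | \<sigma> permutes A. of_int (sign \<sigma>) * h (Hilbert_Choice.inv \<sigma>))"
    by (intro sum.cong refl) (use assms(1) in \<open>auto simp: sign_inverse permutes_imp_permutation\<close>)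
  also have "\<dots> = 0"
  proof (rule sum_sign_transpose_right[OF assms(1-4)])
    fix \<sigma> assume s: "\<sigma> permutes A"
    then have "Hilbert_Choice.inv \<sigma> permutes A" by (rule permutes_inv)
    then have "h (Transposition.transpose a i \<circ> Hilbert_Choice.inv \<sigma>) = h (Hilbert_Choice.inv \<sigma>)" by (rule assms(5))
    then show "h (Hilbert_Choice.inv (\<sigma> \<circ> Transposition.transpose a i)) = h (Hilbert_Choice.inv \<sigma>)"
      by (simp add: o_inv_distrib permutes_bij[OF s])
  qed
  finally show ?thesis .
qed

lemma alternize_eq_0_not_inj:
  fixes y :: "('p \<Rightarrow> nat) \<Rightarrow> 'r :: {idom, ring_char_0}"
  assumes "finite J" "\<not> inj_on \<kappa> J"
  shows "alternize J y \<kappa> = 0"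
proof -
  from assms(2) obtain a b where ab: "a \<in> J" "b \<in> J" "a \<noteq> b" "\<kappa> a = \<kappa> b" by (auto simp: inj_on_def)
  have "\<kappa> \<circ> Transposition.transpose a b = \<kappa>" using ab(4) by (auto simp: Transposition.transpose_def)
  then show ?thesis unfolding alternize_def
    by (intro sum_sign_transpose_left[OF assms(1) ab(1-3)]) (simp add: o_assoc)
qed

text \<open>The transposition of the two common positions is absorbed by the symmetrizer and changes
  the sign of the antisymmetrizer.\<close>

lemma alternize_symmetrize_eq_0:
  fixes y :: "('p \<Rightarrow> nat) \<Rightarrow> 'r :: {idom, ring_char_0}"
  assumes "finite J" "a \<in> I \<inter> J" "b \<in> I \<inter> J" "a \<noteq> b"
  shows "alternize J (symmetrize I y) \<kappa> = 0"
  unfolding alternize_def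
  by (rule sum_sign_transpose_right[of _ a b]) (use assms in \<open>auto simp: o_assoc symmetrize_transpose\<close>)

lemma alternize_sum: "alternize J (\<lambda>\<kappa>. \<Sum>i\<in>A. y i \<kappa>) \<kappa> = (\<Sum>i\<in>A. alternize J (y i) \<kappa>)"
  by (simp add: alternize_def sum_distrib_left sum.swap[of _ A])

lemma alternize_add: "alternize J (\<lambda>\<kappa>. y \<kappa> + x \<kappa>) \<kappa> = alternize J y \<kappa> + alternize J x \<kappa>"
  by (simp add: alternize_def distrib_left sum.distrib)

lemma alternize_mult: "alternize J (\<lambda>\<kappa>. c * y \<kappa>) \<kappa> = c * alternize J y \<kappa>"
  by (simp add: alternize_def sum_distrib_left mult.left_commute)

text \<open>Expanding along the added element gives \<open>card I + card J\<close> copies of the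
  diagonal term. The remaining terms run over the transpositions between \<open>I\<close> and
  \<open>J\<close> and occur with opposite signs in the two sums.\<close>

lemma alternize_symmetrize_exchange:
  assumes "finite J" "finite I" "I \<inter> J = {}"
  shows "(\<Sum>c\<in>I. alternize (insert c J) (symmetrize I y) \<kappa>) + (\<Sum>c\<in>J. alternize J (symmetrize (insert c I) y) \<kappa>)
    = of_nat (card I + card J) * alternize J (symmetrize I y) \<kappa>"
proof -
  have "(\<Sum>c\<in>I. alternize (insert c J) (symmetrize I y) \<kappa>)
     = of_nat (card I) * alternize J (symmetrize I y) \<kappa> - (\<Sum>c\<in>I. \<Sum>j\<in>J. alternize J (\<lambda>\<kappa>. symmetrize I y (\<kappa> \<circ> Transposition.transpose c j)) \<kappa>)"
    (is "?l = _ - ?s")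
  proof -
    have "alternize (insert c J) (symmetrize I y) \<kappa> = alternize J (symmetrize I y) \<kappa> - (\<Sum>j\<in>J. alternize J (\<lambda>\<kappa>. symmetrize I y (\<kappa> \<circ> Transposition.transpose c j)) \<kappa>)"
      if "c \<in> I" for c
      by (rule alternize_insert) (use that assms in auto)
    then show ?thesis by (simp add: sum_subtractf)
  qed
  moreover have "(\<Sum>c\<in>J. alternize J (symmetrize (insert c I) y) \<kappa>)
     = of_nat (card J) * alternize J (symmetrize I y) \<kappa> + (\<Sum>c\<in>J. \<Sum>i\<in>I. alternize J (\<lambda>\<kappa>. symmetrize I y (\<kappa> \<circ> Transposition.transpose c i)) \<kappa>)"
  proof -
    have "alternize J (symmetrize (insert c I) y) \<kappa> = alternize J (symmetrize I y) \<kappa> + (\<Sum>i\<in>I. alternize J (\<lambda>\<kappa>. symmetrize I y (\<kappa> \<circ> Transposition.transpose c i)) \<kappa>)"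
      if "c \<in> J" for c
    proof -
      have "symmetrize (insert c I) y = (\<lambda>\<kappa>. symmetrize I y \<kappa> + (\<Sum>i\<in>I. symmetrize I y (\<kappa> \<circ> Transposition.transpose c i)))"
        by (rule ext, rule symmetrize_insert) (use that assms in auto)
      then show ?thesis by (simp add: alternize_add alternize_sum)
    qed
    then show ?thesis by (simp add: sum.distrib)
  qed
  moreover have "(\<Sum>c\<in>J. \<Sum>i\<in>I. alternize J (\<lambda>\<kappa>. symmetrize I y (\<kappa> \<circ> Transposition.transpose c i)) \<kappa>) = ?s"
    by (subst sum.swap) (simp add: transpose_commute)
  ultimately show ?thesis by (simp add: algebra_simps)
qed

text \<open>
  The pairs with \<open>J \<inter> I = {c}\<close> are distributed by means of \<open>w \<xi>\<^sub>c = 1 - \<xi>\<^sub>c q\<^sub>c\<close> over the disjoint pairs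
  \<open>(J - {c}, I)\<close> and \<open>(J, I - {c})\<close>, where they cancel the term of the latter by \<open>exch\<close>.
\<close>

lemma sum_pairs_cancel:
  fixes \<xi> q :: "'p \<Rightarrow> complex fps" and \<gamma> :: "nat \<Rightarrow> complex fps" and h :: "'p set \<Rightarrow> 'p set \<Rightarrow> complex fps"
  assumes fin: "finite P"
    and zero: "\<And>J I a b. J \<subseteq> P \<Longrightarrow> I \<subseteq> P \<Longrightarrow> a \<in> I \<inter> J \<Longrightarrow> b \<in> I \<inter> J \<Longrightarrow> a \<noteq> b \<Longrightarrow> h J I = 0"
    and exch: "\<And>J I. J \<subseteq> P \<Longrightarrow> I \<subseteq> P \<Longrightarrow> I \<inter> J = {} \<Longrightarrow>
       (\<Sum>c\<in>I. h (insert c J) I) + (\<Sum>c\<in>J. h J (insert c I)) = of_nat (card I + card J) * h J I"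
    and \<gamma>: "\<And>k. of_nat (Suc k) * \<gamma> (Suc k) = w * \<gamma> k"
    and w: "\<And>p. p \<in> P \<Longrightarrow> w * \<xi> p = 1 - \<xi> p * q p"
  shows "(\<Sum>J\<in>Pow P. \<Sum>I\<in>Pow P. of_bool (J \<noteq> {} \<or> I \<noteq> {}) * ((-1) ^ card J * prod \<xi> J * prod q (P - I)
      * \<gamma> (card I + card J - 1) * h J I)) = 0"
proof -
  have finP: "finite S" if "S \<subseteq> P" for S using that fin finite_subset by blast
  define T where "T = (\<lambda>J I. (-1) ^ card J * prod \<xi> J * prod q (P - I) * \<gamma> (card I + card J - 1) * h J I)"
  define r where "r = (\<lambda>k :: nat. fps_const (1 / of_nat k :: complex))"
  \<comment> \<open>The extra factor divides by \<open>card I + card J\<close>; it will absorb the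
    factor of the same size in \<open>exch\<close>.\<close>
  define S where "S = (\<lambda>J I. (-1) ^ card J * prod \<xi> J * prod q (P - I) * (r (card I + card J) * \<gamma> (card I + card J - 1)))"
  define D0 where "D0 = {(J, I). J \<subseteq> P \<and> I \<subseteq> P \<and> I \<inter> J = {} \<and> (J \<noteq> {} \<or> I \<noteq> {})}"
  define D1 where "D1 = {(J, I). J \<subseteq> P \<and> I \<subseteq> P \<and> (\<exists>c. I \<inter> J = {c})}"
  have r: "r k * of_nat k = 1" if "k > 0" for k
  proof -
    have "r k * of_nat k = fps_const (1 / of_nat k) * fps_const (of_nat k)"
      by (simp add: r_def fps_of_nat)
    also have "\<dots> = 1" using that by (simp flip: fps_const_mult)
    finally show ?thesis .
  qed
  have finD: "finite D0" "finite D1"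
  proof -
    have "D0 \<subseteq> Pow P \<times> Pow P" "D1 \<subseteq> Pow P \<times> Pow P" by (auto simp: D0_def D1_def)
    then show "finite D0" "finite D1" using fin by (meson finite_Pow_iff finite_SigmaI finite_subset)+
  qed
  have mem: "c \<in> I \<and> c \<in> J" if "I \<inter> J = {c}" for I J :: "'p set" and c using that by auto
  have disj: "D0 \<inter> D1 = {}" by (auto simp: D0_def D1_def)
  have "(\<Sum>J\<in>Pow P. \<Sum>I\<in>Pow P. of_bool (J \<noteq> {} \<or> I \<noteq> {}) * T J I)
     = (\<Sum>(J, I)\<in>Pow P \<times> Pow P. of_bool (J \<noteq> {} \<or> I \<noteq> {}) * T J I)"
    by (simp add: sum.cartesian_product)
  also have "\<dots> = (\<Sum>(J, I)\<in>D0 \<union> D1. T J I)"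
  proof (rule sum.mono_neutral_cong_right)
    show "\<forall>i\<in>Pow P \<times> Pow P - (D0 \<union> D1). (case i of (J, I) \<Rightarrow> of_bool (J \<noteq> {} \<or> I \<noteq> {}) * T J I) = 0"
    proof
      fix i assume "i \<in> Pow P \<times> Pow P - (D0 \<union> D1)"
      moreover obtain J I where i: "i = (J, I)" by (cases i)
      ultimately have JI: "J \<subseteq> P" "I \<subseteq> P" "(J, I) \<notin> D0" "(J, I) \<notin> D1" by auto
      have "of_bool (J \<noteq> {} \<or> I \<noteq> {}) * T J I = 0"
      proof (cases "I \<inter> J = {}")
        case True
        then show ?thesis using JI by (auto simp: D0_def)
      next
        case False
        then obtain a where a: "a \<in> I \<inter> J" by auto
        then obtain b where "b \<in> I \<inter> J" "a \<noteq> b" using JI unfolding D1_def by blast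
        with a have "h J I = 0" using zero JI by blast
        then show ?thesis by (simp add: T_def)
      qed
      then show "(case i of (J, I) \<Rightarrow> of_bool (J \<noteq> {} \<or> I \<noteq> {}) * T J I) = 0" by (simp add: i)
    qed
  qed (use fin in \<open>auto simp: D0_def D1_def\<close>)
  also have "\<dots> = (\<Sum>(J, I)\<in>D0. T J I) + (\<Sum>(J, I)\<in>D1. T J I)"
    using finD disj by (rule sum.union_disjoint)
  also have "(\<Sum>(J, I)\<in>D1. T J I) = (\<Sum>(J, I, c)\<in>{(J, I, c). J \<subseteq> P \<and> I \<subseteq> P \<and> I \<inter> J = {c}}. - S (J - {c}) I * h J I - S J (I - {c}) * h J I)"
  proof (rule sum.reindex_bij_witness[of _ "\<lambda>(J, I, c). (J, I)" "\<lambda>(J, I). (J, I, the_elem (I \<inter> J))"], goal_cases)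
    case (5 a)
    then obtain J I c where a: "a = (J, I)" "J \<subseteq> P" "I \<subseteq> P" "I \<inter> J = {c}" by (auto simp: D1_def)
    then have c: "c \<in> I" "c \<in> J" "c \<in> P" by auto
    note f = finP[OF a(2)] finP[OF a(3)]
    have the: "the_elem (I \<inter> J) = c" using a by simp
    let ?k = "card (I - {c}) + card J"
    have ci: "card I = Suc (card (I - {c}))" and cj: "card J = Suc (card (J - {c}))" using c f card_Suc_Diff1 by metis+
    have k: "card I + card J - 1 = ?k" "card I + card (J - {c}) = ?k" "?k = Suc (?k - 1)" using ci cj by auto
    \<comment> \<open>The recursion for \<open>\<gamma>\<close> is read backwards to produce the
      \<open>w\<close> that has to meet \<open>\<xi> c\<close>.\<close>
    have g: "\<gamma> ?k = r ?k * (w * \<gamma> (?k - 1))"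
    proof -
      have "\<gamma> ?k = r ?k * of_nat ?k * \<gamma> ?k" by (subst r) (use cj in auto)
      also have "\<dots> = r ?k * (of_nat ?k * \<gamma> ?k)" by (rule mult.assoc)
      also have "of_nat ?k * \<gamma> ?k = w * \<gamma> (?k - 1)" using \<gamma>[of "?k - 1"] k(3) by metis
      finally show ?thesis .
    qed
    have pj: "prod \<xi> J = \<xi> c * prod \<xi> (J - {c})" by (rule prod.remove) (use c f in auto)
    have "P - (I - {c}) = insert c (P - I)" using c by auto
    then have pq: "prod q (P - (I - {c})) = q c * prod q (P - I)" using fin c by simp
    have sgn: "(-1) ^ card J = - ((-1) ^ card (J - {c}) :: complex fps)" by (simp add: cj)
    have "T J I = (-1) ^ card J * prod \<xi> (J - {c}) * prod q (P - I) * (r ?k * \<gamma> (?k - 1)) * h J I * (w * \<xi> c)"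
      unfolding T_def k(1) g pj by (simp add: mult_ac)
    also have "\<dots> = - S (J - {c}) I * h J I - S J (I - {c}) * h J I"
      unfolding w[OF c(3)] S_def pq pj k(2) sgn by (simp add: algebra_simps)
    finally show ?case by (simp add: a(1) the)
  qed (auto simp: D1_def)
  also have "\<dots> = (\<Sum>(J, I, c)\<in>{(J, I, c). J \<subseteq> P \<and> I \<subseteq> P \<and> I \<inter> J = {c}}. - S (J - {c}) I * h J I)
       + (\<Sum>(J, I, c)\<in>{(J, I, c). J \<subseteq> P \<and> I \<subseteq> P \<and> I \<inter> J = {c}}. - S J (I - {c}) * h J I)"
    by (simp add: sum.distrib[symmetric] case_prod_unfold)
  \<comment> \<open>Removing \<open>c\<close> from one of the two sets makes them disjoint, so the
    triples become disjoint pairs with a marked element of the other set.\<close>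
  also have "(\<Sum>(J, I, c)\<in>{(J, I, c). J \<subseteq> P \<and> I \<subseteq> P \<and> I \<inter> J = {c}}. - S (J - {c}) I * h J I)
     = (\<Sum>((J, I), c)\<in>Sigma D0 (\<lambda>(J, I). I). - S J I * h (insert c J) I)"
    by (rule sum.reindex_bij_witness[of _ "\<lambda>((J, I), c). (insert c J, I, c)" "\<lambda>(J, I, c). ((J - {c}, I), c)"])
       (auto simp: D0_def insert_absorb dest: mem)
  also have "(\<Sum>(J, I, c)\<in>{(J, I, c). J \<subseteq> P \<and> I \<subseteq> P \<and> I \<inter> J = {c}}. - S J (I - {c}) * h J I)
     = (\<Sum>((J, I), c)\<in>Sigma D0 (\<lambda>(J, I). J). - S J I * h J (insert c I))"
    by (rule sum.reindex_bij_witness[of _ "\<lambda>((J, I), c). (J, insert c I, c)" "\<lambda>(J, I, c). ((J, I - {c}), c)"])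
       (auto simp: D0_def insert_absorb dest: mem)
  also have "(\<Sum>((J, I), c)\<in>Sigma D0 (\<lambda>(J, I). I). - S J I * h (insert c J) I) = (\<Sum>(J, I)\<in>D0. - S J I * (\<Sum>c\<in>I. h (insert c J) I))"
    unfolding sum_distrib_left using finD
    by (subst sum.Sigma[symmetric]) (auto simp: D0_def intro: finP intro!: sum.cong)
  also have "(\<Sum>((J, I), c)\<in>Sigma D0 (\<lambda>(J, I). J). - S J I * h J (insert c I)) = (\<Sum>(J, I)\<in>D0. - S J I * (\<Sum>c\<in>J. h J (insert c I)))"
    unfolding sum_distrib_left using finD
    by (subst sum.Sigma[symmetric]) (auto simp: D0_def intro: finP intro!: sum.cong)
  also have "(\<Sum>(J, I)\<in>D0. T J I) + ((\<Sum>(J, I)\<in>D0. - S J I * (\<Sum>c\<in>I. h (insert c J) I)) + (\<Sum>(J, I)\<in>D0. - S J I * (\<Sum>c\<in>J. h J (insert c I)))) = 0"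
    unfolding sum.distrib[symmetric]
  proof (rule sum.neutral, safe)
    fix J I assume JI: "(J, I) \<in> D0"
    then have *: "J \<subseteq> P" "I \<subseteq> P" "I \<inter> J = {}" "card I + card J > 0" using finP by (auto simp: D0_def card_gt_0_iff)
    have "- S J I * (\<Sum>c\<in>I. h (insert c J) I) + - S J I * (\<Sum>c\<in>J. h J (insert c I))
        = - S J I * (of_nat (card I + card J) * h J I)"
      unfolding exch[OF *(1-3), symmetric] by (simp add: algebra_simps)
    also have "\<dots> = - ((-1) ^ card J * prod \<xi> J * prod q (P - I) * \<gamma> (card I + card J - 1) * h J I * (r (card I + card J) * of_nat (card I + card J)))"
      by (simp add: S_def mult_ac)
    also have "\<dots> = - T J I" unfolding r[OF *(4)] T_def by simp
    finally show "T J I + (- S J I * (\<Sum>c\<in>I. h (insert c J) I) + - S J I * (\<Sum>c\<in>J. h J (insert c I))) = 0" by simp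
  qed
  finally show ?thesis by (simp add: T_def)
qed

subsection \<open>The operator on tensor products of vector representations\<close>

text \<open>The entry of the matrix \<open>X\<close> on a tensor power, with \<open>\<xi> p\<close>
  for the expansion of \<open>1 / (u - z)\<close> at position \<open>p\<close>. As the generator
  with indices \<open>b a\<close> maps basis vector \<open>a\<close> to basis vector
  \<open>b\<close>, its coordinate at \<open>\<kappa>\<close> is nonzero only for
  \<open>\<kappa> p = b\<close> and is read at \<open>\<kappa>(p := a)\<close>.\<close>

definition pos_X ::
    "'p set \<Rightarrow> ('p \<Rightarrow> complex fps) \<Rightarrow> nat \<Rightarrow> nat \<Rightarrow> (('p \<Rightarrow> nat) \<Rightarrow> complex fps) \<Rightarrow> ('p \<Rightarrow> nat) \<Rightarrow> complex fps"
  where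
  "pos_X P \<xi> a b F \<kappa> =
     of_bool (a = b) * fps_deriv (F \<kappa>) - (\<Sum>p\<in>P. of_bool (\<kappa> p = b) * \<xi> p * F (\<kappa>(p := a)))"

text \<open>The product of the entries in rows \<open>as\<close> and columns
  \<open>\<sigma> a\<close> with all derivatives moved onto \<open>F\<close>, so that no
  \<open>\<xi> p\<close> is differentiated, and with no position used twice; \<open>S\<close> holds
  the positions used by rows further left.\<close>

fun normal_prod ::
    "'p set \<Rightarrow> ('p \<Rightarrow> complex fps) \<Rightarrow> (nat \<Rightarrow> nat) \<Rightarrow> nat list \<Rightarrow> 'p set
      \<Rightarrow> (('p \<Rightarrow> nat) \<Rightarrow> complex fps) \<Rightarrow> ('p \<Rightarrow> nat) \<Rightarrow> complex fps" where
  "normal_prod P \<xi> \<sigma> [] S F \<kappa> = F \<kappa>"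
| "normal_prod P \<xi> \<sigma> (a # as) S F \<kappa> =
     of_bool (\<sigma> a = a) * normal_prod P \<xi> \<sigma> as S (\<lambda>\<kappa>. fps_deriv (F \<kappa>)) \<kappa>
     - (\<Sum>p\<in>P - S. of_bool (\<kappa> p = \<sigma> a) * \<xi> p * normal_prod P \<xi> \<sigma> as (insert p S) F (\<kappa>(p := a)))"

lemma fps_deriv_of_bool [simp]: "fps_deriv (of_bool b) = 0"
  by (cases b) auto

lemma normal_prod_cong:
  "(\<And>i. i \<in> set as \<Longrightarrow> \<sigma> i = \<tau> i) \<Longrightarrow> normal_prod P \<xi> \<sigma> as S F \<kappa> = normal_prod P \<xi> \<tau> as S F \<kappa>"
  by (induction as arbitrary: S F \<kappa>) auto

text \<open>A position is used at most once, so the terms using \<open>p\<close> can be sorted by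
  the row \<open>i\<close> that does; this row leaves the list. Recolourings at different positions
  commute, which allows \<open>p\<close> to be recoloured first.\<close>

lemma normal_prod_skip:
  assumes "finite P" "distinct as" "p \<in> P" "p \<notin> S"
  shows "normal_prod P \<xi> \<sigma> as S F \<kappa> = normal_prod P \<xi> \<sigma> as (insert p S) F \<kappa>
     - (\<Sum>i\<in>set as. of_bool (\<kappa> p = \<sigma> i) * \<xi> p * normal_prod P \<xi> \<sigma> (remove1 i as) (insert p S) F (\<kappa>(p := i)))"
  using assms
proof (induction as arbitrary: S F \<kappa>)
  case Nil
  then show ?case by simp
next
  case (Cons a as)
  let ?NO = "normal_prod P \<xi> \<sigma>"
  let ?d = "\<lambda>\<kappa>. fps_deriv (F \<kappa>)"
  let ?I = "set as"
  define s c e where "s = (of_bool (\<sigma> a = a) :: complex fps)" and "c = (\<lambda>q. of_bool (\<kappa> q = \<sigma> a) * \<xi> q)"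
    and "e = (\<lambda>i. of_bool (\<kappa> p = \<sigma> i) * \<xi> p)"
  have a: "a \<notin> set as" and fin: "finite (P - insert p S)" and d: "distinct as" using Cons.prems by auto
  have split: "(\<Sum>q\<in>P - S. c q * ?NO as (insert q S) F (\<kappa>(q := a)))
      = c p * ?NO as (insert p S) F (\<kappa>(p := a)) + (\<Sum>q\<in>P - insert p S. c q * ?NO as (insert q S) F (\<kappa>(q := a)))"
  proof -
    have eq: "P - S = insert p (P - insert p S)" using Cons.prems by auto
    show ?thesis by (subst eq, subst sum.insert) (use fin in auto)
  qed
  have ih: "?NO as (insert q S) F (\<kappa>(q := a)) = ?NO as (insert q (insert p S)) F (\<kappa>(q := a))
      - (\<Sum>i\<in>?I. e i * ?NO (remove1 i as) (insert q (insert p S)) F (\<kappa>(p := i, q := a)))"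
    if "q \<in> P - insert p S" for q
  proof -
    have "p \<notin> insert q S" "q \<noteq> p" using that Cons.prems by auto
    have "?NO as (insert q S) F (\<kappa>(q := a)) = ?NO as (insert p (insert q S)) F (\<kappa>(q := a))
      - (\<Sum>i\<in>?I. of_bool ((\<kappa>(q := a)) p = \<sigma> i) * \<xi> p * ?NO (remove1 i as) (insert p (insert q S)) F (\<kappa>(q := a, p := i)))"
      by (rule Cons.IH) (use Cons.prems d \<open>p \<notin> insert q S\<close> in auto)
    with \<open>q \<noteq> p\<close> show ?thesis by (simp add: insert_commute fun_upd_twist e_def)
  qed
  have ih0: "?NO as S ?d \<kappa> = ?NO as (insert p S) ?d \<kappa>
      - (\<Sum>i\<in>?I. e i * ?NO (remove1 i as) (insert p S) ?d (\<kappa>(p := i)))"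
    using Cons.IH[of S ?d \<kappa>] Cons.prems d unfolding e_def by blast
  have lhs: "?NO (a # as) S F \<kappa> = s * ?NO as S ?d \<kappa>
      - (\<Sum>q\<in>P - S. c q * ?NO as (insert q S) F (\<kappa>(q := a)))"
    by (simp add: s_def c_def)
  have rhs1: "?NO (a # as) (insert p S) F \<kappa> = s * ?NO as (insert p S) ?d \<kappa>
      - (\<Sum>q\<in>P - insert p S. c q * ?NO as (insert q (insert p S)) F (\<kappa>(q := a)))"
    by (simp add: s_def c_def)
  have rhs2: "?NO (a # remove1 i as) (insert p S) F (\<kappa>(p := i))
      = s * ?NO (remove1 i as) (insert p S) ?d (\<kappa>(p := i))
      - (\<Sum>q\<in>P - insert p S. c q * ?NO (remove1 i as) (insert q (insert p S)) F (\<kappa>(p := i, q := a)))" for i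
    by (auto simp: s_def c_def intro!: sum.cong)
  have rhs: "(\<Sum>i\<in>set (a # as). e i * ?NO (remove1 i (a # as)) (insert p S) F (\<kappa>(p := i)))
     = c p * ?NO as (insert p S) F (\<kappa>(p := a)) + (\<Sum>i\<in>?I. e i * ?NO (a # remove1 i as) (insert p S) F (\<kappa>(p := i)))"
    using a by (auto simp: e_def c_def intro!: sum.cong)
  have sw: "(\<Sum>q\<in>P - insert p S. c q * (\<Sum>i\<in>?I. e i * ?NO (remove1 i as) (insert q (insert p S)) F (\<kappa>(p := i, q := a))))
     = (\<Sum>i\<in>?I. e i * (\<Sum>q\<in>P - insert p S. c q * ?NO (remove1 i as) (insert q (insert p S)) F (\<kappa>(p := i, q := a))))"
    unfolding sum_distrib_left by (subst sum.swap) (simp add: mult.left_commute)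
  have ihs: "(\<Sum>q\<in>P - insert p S. c q * ?NO as (insert q S) F (\<kappa>(q := a)))
     = (\<Sum>q\<in>P - insert p S. c q * ?NO as (insert q (insert p S)) F (\<kappa>(q := a)))
     - (\<Sum>q\<in>P - insert p S. c q * (\<Sum>i\<in>?I. e i * ?NO (remove1 i as) (insert q (insert p S)) F (\<kappa>(p := i, q := a))))"
    unfolding sum_subtractf[symmetric] right_diff_distrib[symmetric]
    by (intro sum.cong refl) (simp only: ih)
  have "(\<Sum>i\<in>?I. e i * ?NO (a # remove1 i as) (insert p S) F (\<kappa>(p := i)))
     = s * (\<Sum>i\<in>?I. e i * ?NO (remove1 i as) (insert p S) ?d (\<kappa>(p := i)))
      - (\<Sum>i\<in>?I. e i * (\<Sum>q\<in>P - insert p S. c q * ?NO (remove1 i as) (insert q (insert p S)) F (\<kappa>(p := i, q := a))))"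
    unfolding rhs2 by (simp only: right_diff_distrib sum_subtractf sum_distrib_left mult.left_commute)
  then have "?NO (a # as) S F \<kappa> = ?NO (a # as) (insert p S) F \<kappa>
      - (\<Sum>i\<in>set (a # as). e i * ?NO (remove1 i (a # as)) (insert p S) F (\<kappa>(p := i)))"
    unfolding rhs lhs split ihs ih0 rhs1 sw by (simp only: right_diff_distrib) (simp del: normal_prod.simps)
  then show ?case by (simp only: e_def)
qed

text \<open>The derivative passes through to \<open>F\<close> or hits one of the factors
  \<open>- \<xi> p\<close>, which then becomes \<open>+ (\<xi> p)\<^sup>2\<close>.\<close>

lemma normal_prod_deriv:
  assumes "finite P" "distinct as" "\<And>p. p \<in> P \<Longrightarrow> fps_deriv (\<xi> p) = - (\<xi> p)\<^sup>2"
  shows "fps_deriv (normal_prod P \<xi> \<sigma> as S F \<kappa>) = normal_prod P \<xi> \<sigma> as S (\<lambda>\<kappa>. fps_deriv (F \<kappa>)) \<kappa>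
     + (\<Sum>p\<in>P - S. \<Sum>i\<in>set as. of_bool (\<kappa> p = \<sigma> i) *
          (\<xi> p)\<^sup>2 * normal_prod P \<xi> \<sigma> (remove1 i as) (insert p S) F (\<kappa>(p := i)))"
  using assms(2)
proof (induction as arbitrary: S F \<kappa>)
  case Nil
  then show ?case by simp
next
  case (Cons a as)
  let ?NO = "normal_prod P \<xi> \<sigma>"
  let ?d = "\<lambda>\<kappa>. fps_deriv (F \<kappa>)"
  let ?dd = "\<lambda>\<kappa>. fps_deriv (fps_deriv (F \<kappa>))"
  let ?I = "set as"
  define s c where "s = (of_bool (\<sigma> a = a) :: complex fps)" and "c = (\<lambda>q a. of_bool (\<kappa> q = \<sigma> a) :: complex fps)"
  have a: "a \<notin> set as" and d: "distinct as" and fin: "finite (P - S)" using Cons.prems assms(1) by auto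
  have ds: "fps_deriv s = 0" and dc: "fps_deriv (c q a) = 0" for q a by (auto simp: s_def c_def)
  have ih0: "fps_deriv (?NO as S ?d \<kappa>) = ?NO as S ?dd \<kappa>
     + (\<Sum>p\<in>P - S. \<Sum>i\<in>?I. c p i * (\<xi> p)\<^sup>2 * ?NO (remove1 i as) (insert p S) ?d (\<kappa>(p := i)))"
    using Cons.IH[OF d, of S ?d \<kappa>] unfolding c_def .
  have ih: "fps_deriv (?NO as (insert q S) F (\<kappa>(q := a))) = ?NO as (insert q S) ?d (\<kappa>(q := a))
     + (\<Sum>p\<in>P - insert q S. \<Sum>i\<in>?I. c p i * (\<xi> p)\<^sup>2 * ?NO (remove1 i as) (insert p (insert q S)) F (\<kappa>(q := a, p := i)))" for q
  proof -
    have "fps_deriv (?NO as (insert q S) F (\<kappa>(q := a))) = ?NO as (insert q S) ?d (\<kappa>(q := a))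
     + (\<Sum>p\<in>P - insert q S. \<Sum>i\<in>?I. of_bool ((\<kappa>(q := a)) p = \<sigma> i) * (\<xi> p)\<^sup>2 * ?NO (remove1 i as) (insert p (insert q S)) F (\<kappa>(q := a, p := i)))"
      by (rule Cons.IH[OF d])
    then show ?thesis by (auto simp: c_def intro!: sum.cong)
  qed
  have lhs: "?NO (a # as) S G \<kappa> = s * ?NO as S (\<lambda>\<kappa>. fps_deriv (G \<kappa>)) \<kappa>
      - (\<Sum>q\<in>P - S. c q a * \<xi> q * ?NO as (insert q S) G (\<kappa>(q := a)))" for G
    by (simp add: s_def c_def)
  have rhs2: "?NO (a # remove1 i as) (insert p S) F (\<kappa>(p := i))
      = s * ?NO (remove1 i as) (insert p S) ?d (\<kappa>(p := i))
      - (\<Sum>q\<in>P - insert p S. c q a * \<xi> q * ?NO (remove1 i as) (insert q (insert p S)) F (\<kappa>(p := i, q := a)))" for i p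
    by (auto simp: s_def c_def intro!: sum.cong)
  have rhs: "(\<Sum>p\<in>P - S. \<Sum>i\<in>set (a # as). c p i * (\<xi> p)\<^sup>2 * ?NO (remove1 i (a # as)) (insert p S) F (\<kappa>(p := i)))
     = (\<Sum>p\<in>P - S. c p a * (\<xi> p)\<^sup>2 * ?NO as (insert p S) F (\<kappa>(p := a)))
     + (\<Sum>p\<in>P - S. \<Sum>i\<in>?I. c p i * (\<xi> p)\<^sup>2 * ?NO (a # remove1 i as) (insert p S) F (\<kappa>(p := i)))"
    unfolding sum.distrib[symmetric] using a by (auto intro!: sum.cong)
  have sw: "(\<Sum>p\<in>P - S. \<Sum>q\<in>P - insert p S. h p q) = (\<Sum>q\<in>P - S. \<Sum>p\<in>P - insert q S. h p q)" for h :: "'a \<Rightarrow> 'a \<Rightarrow> complex fps"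
  proof -
    have *: "(\<Sum>p\<in>P - S. \<Sum>q\<in>P - insert p S. h p q) = (\<Sum>p\<in>P - S. \<Sum>q\<in>P - S. if p = q then 0 else h p q)" for h :: "'a \<Rightarrow> 'a \<Rightarrow> complex fps"
      using fin by (intro sum.cong refl sum.mono_neutral_cong_left) auto
    show ?thesis unfolding *[of h] *[of "\<lambda>q p. h p q"] by (subst sum.swap) (simp add: eq_commute)
  qed
  have dsum: "fps_deriv (?NO (a # as) S F \<kappa>) = s * fps_deriv (?NO as S ?d \<kappa>)
      - (\<Sum>q\<in>P - S. c q a * (- (\<xi> q)\<^sup>2 * ?NO as (insert q S) F (\<kappa>(q := a))
            + \<xi> q * fps_deriv (?NO as (insert q S) F (\<kappa>(q := a)))))"
  proof -
    have "fps_deriv (c q a * \<xi> q * G) = c q a * (- (\<xi> q)\<^sup>2 * G + \<xi> q * fps_deriv G)" if "q \<in> P - S" for q G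
      using that by (simp add: dc assms(3) algebra_simps)
    then have "fps_deriv (\<Sum>q\<in>P - S. c q a * \<xi> q * ?NO as (insert q S) F (\<kappa>(q := a))) =
       (\<Sum>q\<in>P - S. c q a * (- (\<xi> q)\<^sup>2 * ?NO as (insert q S) F (\<kappa>(q := a))
            + \<xi> q * fps_deriv (?NO as (insert q S) F (\<kappa>(q := a)))))"
      unfolding fps_deriv_sum by (intro sum.cong refl) blast
    then show ?thesis unfolding lhs by (simp add: ds)
  qed
  \<comment> \<open>Two different positions can be recoloured in either order, so the one hit by the
    derivative may come before or after the one used by row \<open>a\<close>.\<close>
  have main: "(\<Sum>p\<in>P - S. \<Sum>i\<in>?I. c p i * (\<xi> p)\<^sup>2 * (\<Sum>q\<in>P - insert p S. c q a * \<xi> q * ?NO (remove1 i as) (insert q (insert p S)) F (\<kappa>(p := i, q := a))))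
      = (\<Sum>q\<in>P - S. c q a * \<xi> q * (\<Sum>p\<in>P - insert q S. \<Sum>i\<in>?I. c p i * (\<xi> p)\<^sup>2 * ?NO (remove1 i as) (insert p (insert q S)) F (\<kappa>(q := a, p := i))))"
    (is "?L = ?R")
  proof -
    let ?h = "\<lambda>p q. \<Sum>i\<in>?I. c p i * (\<xi> p)\<^sup>2 * (c q a * \<xi> q * ?NO (remove1 i as) (insert q (insert p S)) F (\<kappa>(p := i, q := a)))"
    have "?L = (\<Sum>p\<in>P - S. \<Sum>q\<in>P - insert p S. ?h p q)"
      unfolding sum_distrib_left by (intro sum.cong refl, subst sum.swap) simp
    also have "\<dots> = (\<Sum>q\<in>P - S. \<Sum>p\<in>P - insert q S. ?h p q)" by (rule sw)
    also have "\<dots> = ?R"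
      unfolding sum_distrib_left
    proof (intro sum.cong refl, goal_cases)
      case (1 q p i)
      then have "q \<noteq> p" by auto
      then show ?case by (simp add: fun_upd_twist insert_commute)
    qed
    finally show ?thesis .
  qed
  have r: "(\<Sum>p\<in>P - S. \<Sum>i\<in>?I. c p i * (\<xi> p)\<^sup>2 * ?NO (a # remove1 i as) (insert p S) F (\<kappa>(p := i)))
    = s * (\<Sum>p\<in>P - S. \<Sum>i\<in>?I. c p i * (\<xi> p)\<^sup>2 * ?NO (remove1 i as) (insert p S) ?d (\<kappa>(p := i)))
     - (\<Sum>p\<in>P - S. \<Sum>i\<in>?I. c p i * (\<xi> p)\<^sup>2 * (\<Sum>q\<in>P - insert p S. c q a * \<xi> q * ?NO (remove1 i as) (insert q (insert p S)) F (\<kappa>(p := i, q := a))))"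
    unfolding rhs2 by (simp only: right_diff_distrib sum_subtractf sum_distrib_left mult.left_commute)
  have l: "(\<Sum>q\<in>P - S. c q a * (- (\<xi> q)\<^sup>2 * N q + \<xi> q * (M q + L q)))
     = - (\<Sum>q\<in>P - S. c q a * (\<xi> q)\<^sup>2 * N q) + (\<Sum>q\<in>P - S. c q a * \<xi> q * M q) + (\<Sum>q\<in>P - S. c q a * \<xi> q * L q)" for N M L
    by (simp add: algebra_simps sum.distrib sum_negf sum_subtractf)
  have "fps_deriv (?NO (a # as) S F \<kappa>) = ?NO (a # as) S ?d \<kappa>
     + (\<Sum>p\<in>P - S. \<Sum>i\<in>set (a # as). c p i * (\<xi> p)\<^sup>2 * ?NO (remove1 i (a # as)) (insert p S) F (\<kappa>(p := i)))"
    unfolding rhs dsum unfolding ih0 ih lhs r main l by (simp only: algebra_simps) (simp del: normal_prod.simps)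
  then show ?case by (simp only: c_def)
qed

section \<open>Normal ordering of the row determinant\<close>

definition row_det ::
    "nat list \<Rightarrow> (nat \<Rightarrow> nat \<Rightarrow> ('k \<Rightarrow> complex fps) \<Rightarrow> 'k \<Rightarrow> complex fps)
      \<Rightarrow> ('k \<Rightarrow> complex fps) \<Rightarrow> 'k \<Rightarrow> complex fps" where
  "row_det as X F = (\<lambda>k. \<Sum>\<sigma> | \<sigma> permutes set as. of_int (sign \<sigma>) * foldr (\<lambda>a. X a (\<sigma> a)) as F k)"

lemma pos_X_sum:
  "pos_X P \<xi> a b (\<lambda>\<kappa>. \<Sum>i\<in>I. f i \<kappa>) = (\<lambda>\<kappa>. \<Sum>i\<in>I. pos_X P \<xi> a b (f i) \<kappa>)"
  by (rule ext, cases "finite I")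
     (simp_all add: pos_X_def fps_deriv_sum sum_distrib_left sum_subtractf sum.swap[of _ I])

lemma pos_X_add:
  "pos_X P \<xi> a b (\<lambda>\<kappa>. f \<kappa> + g \<kappa>) = (\<lambda>\<kappa>. pos_X P \<xi> a b f \<kappa> + pos_X P \<xi> a b g \<kappa>)"
  by (rule ext) (simp add: pos_X_def sum.distrib algebra_simps)

lemma foldr_pos_X_sum:
  "foldr (\<lambda>a. pos_X P \<xi> a (\<sigma> a)) as (\<lambda>\<kappa>. \<Sum>i\<in>I. f i \<kappa>) = (\<lambda>\<kappa>. \<Sum>i\<in>I. foldr (\<lambda>a. pos_X P \<xi> a (\<sigma> a)) as (f i) \<kappa>)"
  by (induction as) (simp_all add: pos_X_sum)

lemma foldr_pos_X_add:
  "foldr (\<lambda>a. pos_X P \<xi> a (\<sigma> a)) as (\<lambda>\<kappa>. f \<kappa> + g \<kappa>)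
     = (\<lambda>\<kappa>. foldr (\<lambda>a. pos_X P \<xi> a (\<sigma> a)) as f \<kappa> + foldr (\<lambda>a. pos_X P \<xi> a (\<sigma> a)) as g \<kappa>)"
  by (induction as) (simp_all add: pos_X_add)

text \<open>The first indicator stems from the Leibniz rule. The second comes from row
  \<open>a\<close> acting at a position that a row \<open>i\<close> uses as well: the product of the
  two matrix units is nonzero only if \<open>\<sigma> i = a\<close>, and then takes \<open>i\<close>
  to \<open>\<sigma> a\<close>. Both carry \<open>(\<xi> p)\<^sup>2\<close> and the same remaining
  product.\<close>

lemma pos_X_normal_prod:
  assumes "finite P" "distinct as" "\<And>p. p \<in> P \<Longrightarrow> fps_deriv (\<xi> p) = - (\<xi> p)\<^sup>2"
  shows "pos_X P \<xi> a (\<sigma> a) (normal_prod P \<xi> \<sigma> as {} F) \<kappa>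
    = normal_prod P \<xi> \<sigma> (a # as) {} F \<kappa>
      + (\<Sum>i\<in>set as. \<Sum>p\<in>P. (of_bool (\<sigma> a = a \<and> \<kappa> p = \<sigma> i) + of_bool (\<kappa> p = \<sigma> a \<and> \<sigma> i = a))
          * (\<xi> p)\<^sup>2 * normal_prod P \<xi> \<sigma> (remove1 i as) {p} F (\<kappa>(p := i)))"
proof -
  let ?NO = "normal_prod P \<xi> \<sigma>"
  have skip: "?NO as {} F (\<kappa>(p := a)) = ?NO as {p} F (\<kappa>(p := a))
     - (\<Sum>i\<in>set as. of_bool (\<sigma> i = a) * \<xi> p * ?NO (remove1 i as) {p} F (\<kappa>(p := i)))" if "p \<in> P" for p
  proof -
    have "?NO as {} F (\<kappa>(p := a)) = ?NO as {p} F (\<kappa>(p := a))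
     - (\<Sum>i\<in>set as. of_bool ((\<kappa>(p := a)) p = \<sigma> i) * \<xi> p * ?NO (remove1 i as) {p} F (\<kappa>(p := a, p := i)))"
      by (rule normal_prod_skip) (use assms that in auto)
    then show ?thesis by (simp add: eq_commute cong: sum.cong)
  qed
  have "(\<Sum>p\<in>P. of_bool (\<kappa> p = \<sigma> a) * \<xi> p * ?NO as {} F (\<kappa>(p := a)))
    = (\<Sum>p\<in>P. of_bool (\<kappa> p = \<sigma> a) * \<xi> p * ?NO as {p} F (\<kappa>(p := a)))
      - (\<Sum>p\<in>P. \<Sum>i\<in>set as. of_bool (\<kappa> p = \<sigma> a \<and> \<sigma> i = a) * (\<xi> p)\<^sup>2 * ?NO (remove1 i as) {p} F (\<kappa>(p := i)))"
    unfolding sum_subtractf[symmetric]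
  proof (intro sum.cong refl, goal_cases)
    case (1 p)
    show ?case unfolding skip[OF 1] right_diff_distrib sum_distrib_left
      by (simp add: power2_eq_square algebra_simps of_bool_conj)
  qed
  moreover have "of_bool (a = \<sigma> a) * fps_deriv (?NO as {} F \<kappa>) = of_bool (\<sigma> a = a) * ?NO as {} (\<lambda>\<kappa>. fps_deriv (F \<kappa>)) \<kappa>
      + (\<Sum>p\<in>P. \<Sum>i\<in>set as. of_bool (\<sigma> a = a \<and> \<kappa> p = \<sigma> i) * (\<xi> p)\<^sup>2 * ?NO (remove1 i as) {p} F (\<kappa>(p := i)))"
  proof -
    have "fps_deriv (?NO as {} F \<kappa>) = ?NO as {} (\<lambda>\<kappa>. fps_deriv (F \<kappa>)) \<kappa>
      + (\<Sum>p\<in>P - {}. \<Sum>i\<in>set as. of_bool (\<kappa> p = \<sigma> i) * (\<xi> p)\<^sup>2 * ?NO (remove1 i as) {p} F (\<kappa>(p := i)))"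
      by (rule normal_prod_deriv) (use assms in auto)
    then show ?thesis
      unfolding Diff_empty of_bool_conj
      by (simp only: eq_commute[of a] mult.assoc distrib_left sum_distrib_left)
  qed
  ultimately show ?thesis
    unfolding pos_X_def normal_prod.simps Diff_empty distrib_right sum.distrib
    by (simp only: sum.swap[of _ "set as" P]) simp
qed

text \<open>
  In the difference between \<open>pos_X P \<xi> a (\<sigma> a)\<close> applied to a normally ordered product and the longer
  normally ordered product, the terms where \<open>\<partial>\<close> hits some \<open>\<xi> p\<close> and those where two generators
  meet at the same position \<open>p\<close> are exchanged by \<open>\<sigma> \<mapsto> \<sigma> \<circ> (a i)\<close>, so they cancel in the
  alternating sum.
\<close>

lemma row_det_pos_X:
  assumes "finite P" "distinct as" "\<And>p. p \<in> P \<Longrightarrow> fps_deriv (\<xi> p) = - (\<xi> p)\<^sup>2"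
  shows "row_det as (pos_X P \<xi>) F \<kappa>
    = (\<Sum>\<sigma> | \<sigma> permutes set as. of_int (sign \<sigma>) * normal_prod P \<xi> \<sigma> as {} F \<kappa>)"
proof -
  \<comment> \<open>The rows of \<open>zs\<close> are already normally ordered, those of
    \<open>ys\<close> still act as operators; the induction moves the last row of \<open>ys\<close>
    into \<open>zs\<close>.\<close>
  have "row_det as (pos_X P \<xi>) F \<kappa> = (\<Sum>\<sigma> | \<sigma> permutes set as.
          of_int (sign \<sigma>) * foldr (\<lambda>a. pos_X P \<xi> a (\<sigma> a)) ys (normal_prod P \<xi> \<sigma> zs {} F) \<kappa>)"
    if "as = ys @ zs" for ys zs
    using that
  proof (induction zs arbitrary: ys)
    case Nil
    have "normal_prod P \<xi> \<sigma> [] {} F = F" for \<sigma> by (rule ext) simp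
    then show ?case using Nil by (simp add: row_det_def)
  next
    case (Cons a zs)
    let ?A = "set as"
    let ?f = "\<lambda>\<sigma>. foldr (\<lambda>a. pos_X P \<xi> a (\<sigma> a)) ys"
    define e where "e = (\<lambda>\<sigma> i \<kappa>. \<Sum>p\<in>P. (of_bool (\<sigma> a = a \<and> \<kappa> p = \<sigma> i) + of_bool (\<kappa> p = \<sigma> a \<and> \<sigma> i = a))
          * (\<xi> p)\<^sup>2 * normal_prod P \<xi> \<sigma> (remove1 i zs) {p} F (\<kappa>(p := i)))"
    have d: "distinct zs" "a \<notin> set zs" "a \<notin> set ys" "set zs \<inter> set ys = {}" using Cons.prems assms(2) by auto
    have zero: "(\<Sum>\<sigma> | \<sigma> permutes ?A. of_int (sign \<sigma>) * ?f \<sigma> (e \<sigma> i) \<kappa>) = 0" if i: "i \<in> set zs" for i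
    proof (rule sum_sign_transpose_right[of _ a i])
      fix \<sigma> assume "\<sigma> permutes ?A"
      let ?\<tau> = "\<sigma> \<circ> Transposition.transpose a i"
      have "?f ?\<tau> = ?f \<sigma>"
      proof -
        have "pos_X P \<xi> b (?\<tau> b) = pos_X P \<xi> b (\<sigma> b)" if "b \<in> set ys" for b
        proof -
          have "b \<noteq> a" "b \<noteq> i" using d i that by auto
          then show ?thesis by simp
        qed
        then show ?thesis by (intro ext foldr_cong refl) simp
      qed
      moreover have "e ?\<tau> i = e \<sigma> i"
      proof -
        have "normal_prod P \<xi> ?\<tau> (remove1 i zs) {p} F \<kappa>' = normal_prod P \<xi> \<sigma> (remove1 i zs) {p} F \<kappa>'" for p \<kappa>'
          by (rule normal_prod_cong) (use d i in \<open>auto simp: Transposition.transpose_def\<close>)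
        then show ?thesis unfolding e_def by (auto simp: conj_commute intro!: ext sum.cong)
      qed
      ultimately show "?f ?\<tau> (e ?\<tau> i) \<kappa> = ?f \<sigma> (e \<sigma> i) \<kappa>" by simp
    qed (use Cons.prems i d in auto)
    have "row_det as (pos_X P \<xi>) F \<kappa> = (\<Sum>\<sigma> | \<sigma> permutes ?A.
        of_int (sign \<sigma>) * ?f \<sigma> (pos_X P \<xi> a (\<sigma> a) (normal_prod P \<xi> \<sigma> zs {} F)) \<kappa>)"
      using Cons.IH[of "ys @ [a]"] Cons.prems by simp
    also have "\<dots> = (\<Sum>\<sigma> | \<sigma> permutes ?A. of_int (sign \<sigma>) * ?f \<sigma> (normal_prod P \<xi> \<sigma> (a # zs) {} F) \<kappa>
         + (\<Sum>i\<in>set zs. of_int (sign \<sigma>) * ?f \<sigma> (e \<sigma> i) \<kappa>))"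
    proof (intro sum.cong refl, goal_cases)
      case (1 \<sigma>)
      have "pos_X P \<xi> a (\<sigma> a) (normal_prod P \<xi> \<sigma> zs {} F)
          = (\<lambda>\<kappa>. normal_prod P \<xi> \<sigma> (a # zs) {} F \<kappa> + (\<Sum>i\<in>set zs. e \<sigma> i \<kappa>))"
        unfolding e_def by (rule ext, rule pos_X_normal_prod) (use assms d in auto)
      then show ?case
        by (simp only: foldr_pos_X_add foldr_pos_X_sum distrib_left sum_distrib_left)
    qed
    also have "\<dots> = (\<Sum>\<sigma> | \<sigma> permutes ?A. of_int (sign \<sigma>) * ?f \<sigma> (normal_prod P \<xi> \<sigma> (a # zs) {} F) \<kappa>)"
      unfolding sum.distrib by (subst sum.swap) (simp add: zero)
    finally show ?case .
  qed
  from this[of "[]" as] show ?thesis by simp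
qed

section \<open>Expansion into antisymmetrizers\<close>

abbreviation inj_maps :: "'p set \<Rightarrow> nat set \<Rightarrow> ('p \<Rightarrow> nat) set" where
  "inj_maps J A \<equiv> {g \<in> J \<rightarrow>\<^sub>E A. inj_on g J}"

lemma finite_inj_maps: "finite J \<Longrightarrow> finite A \<Longrightarrow> finite (inj_maps J A)"
  by (rule finite_subset[of _ "J \<rightarrow>\<^sub>E A"]) (auto intro: finite_PiE)

text \<open>Here \<open>J\<close> is the set of positions that are used and \<open>g p\<close> is
  the row that uses \<open>p\<close>. A row that uses no position contributes a derivative, which
  requires it to be fixed by \<open>\<sigma>\<close>; for the others the column must be the colour
  of the position.\<close>

lemma normal_prod_expand:
  assumes "finite P" "distinct as"
  shows "normal_prod P \<xi> \<sigma> as S F \<kappa> = (\<Sum>(J, g)\<in>Sigma (Pow (P - S)) (\<lambda>J. inj_maps J (set as)).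
     of_bool ((\<forall>p\<in>J. \<kappa> p = \<sigma> (g p)) \<and> (\<forall>i\<in>set as - g ` J. \<sigma> i = i))
     * ((-1) ^ card J * prod \<xi> J * (fps_deriv ^^ (length as - card J)) (F (override_on \<kappa> g J))))"
  using assms(2)
proof (induction as arbitrary: S F \<kappa>)
  case Nil
  have *: "Sigma (Pow (P - S)) (\<lambda>J. inj_maps J (set [])) = {({}, \<lambda>_. undefined)}"
    by (auto simp: PiE_eq_empty_iff)
  show ?case unfolding * by simp
next
  case (Cons a as)
  define D where "D = (\<lambda>as S. Sigma (Pow (P - S)) (\<lambda>J. inj_maps J (set as)))"
  define t where "t = (\<lambda>as F \<kappa> J g. of_bool ((\<forall>p\<in>J. \<kappa> p = \<sigma> (g p)) \<and> (\<forall>i\<in>set as - g ` J. \<sigma> i = i))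
     * ((-1) ^ card J * prod \<xi> J * (fps_deriv ^^ (length as - card J)) (F (override_on \<kappa> g J))))"
  have d: "a \<notin> set as" "distinct as" using Cons.prems by auto
  have finD: "finite (D as S)" for as S
    unfolding D_def using assms(1) by (intro finite_SigmaI) (auto intro!: finite_inj_maps intro: finite_subset)
  have ih: "normal_prod P \<xi> \<sigma> as S F \<kappa> = (\<Sum>(J, g)\<in>D as S. t as F \<kappa> J g)" for S F \<kappa>
    using Cons.IH[OF d(2)] by (simp only: D_def t_def)
  have part1: "(\<Sum>(J, g)\<in>{(J, g) \<in> D (a # as) S. a \<notin> g ` J}. t (a # as) F \<kappa> J g)
     = of_bool (\<sigma> a = a) * normal_prod P \<xi> \<sigma> as S (\<lambda>\<kappa>. fps_deriv (F \<kappa>)) \<kappa>"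
  proof -
    have D: "{(J, g) \<in> D (a # as) S. a \<notin> g ` J} = D as S"
      using d(1) by (fastforce simp: D_def PiE_def Pi_def)
    show ?thesis unfolding D ih sum_distrib_left
    proof (intro sum.cong refl, safe)
      fix J g assume Jg: "(J, g) \<in> D as S"
      then have J: "finite J" "inj_on g J" "g ` J \<subseteq> set as" using assms(1) by (auto simp: D_def intro: finite_subset)
      then have "card J \<le> length as" using card_inj_on_le[of g J "set as"] d by (simp add: distinct_card)
      then have l: "length (a # as) - card J = Suc (length as - card J)" by simp
      have "a \<notin> g ` J" using J d by auto
      then show "t (a # as) F \<kappa> J g = of_bool (\<sigma> a = a) * t as (\<lambda>\<kappa>. fps_deriv (F \<kappa>)) \<kappa> J g"
        unfolding t_def l funpow_Suc_right o_def by (auto simp: of_bool_def)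
    qed
  qed
  have part2: "(\<Sum>(J, g)\<in>{(J, g) \<in> D (a # as) S. a \<in> g ` J}. t (a # as) F \<kappa> J g)
     = - (\<Sum>p\<in>P - S. of_bool (\<kappa> p = \<sigma> a) * \<xi> p * normal_prod P \<xi> \<sigma> as (insert p S) F (\<kappa>(p := a)))"
  proof -
    have "(\<Sum>(J, g)\<in>{(J, g) \<in> D (a # as) S. a \<in> g ` J}. t (a # as) F \<kappa> J g)
      = (\<Sum>(p, J, g)\<in>Sigma (P - S) (\<lambda>p. D as (insert p S)). - (of_bool (\<kappa> p = \<sigma> a) * \<xi> p * t as F (\<kappa>(p := a)) J g))"
    \<comment> \<open>The position \<open>p\<close> used by row \<open>a\<close> is split off;
      resetting \<open>g\<close> to \<open>undefined\<close> there keeps it extensional on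
      \<open>J - {p}\<close>.\<close>
    proof (rule sum.reindex_bij_witness[symmetric, of _ "\<lambda>(J, g). let p = the_inv_into J g a in (p, J - {p}, g(p := undefined))"
          "\<lambda>(p, J, g). (insert p J, g(p := a))"], goal_cases)
      case (1 x)
      then obtain p J g where x: "x = (p, J, g)" "p \<in> P - S" "J \<subseteq> P - insert p S" "g \<in> J \<rightarrow>\<^sub>E set as" "inj_on g J"
        by (auto simp: D_def)
      have pJ: "p \<notin> J" using x by auto
      have a: "a \<notin> g ` J" using x d by auto
      have "inj_on (g(p := a)) (insert p J)" using x(5) a pJ by (auto simp: inj_on_def)
      then have "the_inv_into (insert p J) (g(p := a)) a = p"
        by (rule the_inv_into_f_eq) auto
      moreover have "g p = undefined" using x pJ by (auto simp: PiE_def extensional_def)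
      ultimately show ?case using pJ by (auto simp: x(1) fun_upd_idem)
    next
      case (2 x)
      then obtain p J g where x: "x = (p, J, g)" "p \<in> P - S" "J \<subseteq> P - insert p S" "g \<in> J \<rightarrow>\<^sub>E set as" "inj_on g J"
        by (auto simp: D_def)
      have pJ: "p \<notin> J" using x by auto
      have a: "a \<notin> g ` J" using x d by auto
      have "inj_on (g(p := a)) (insert p J)" using x(5) a pJ by (auto simp: inj_on_def)
      then show ?case using x pJ by (auto simp: D_def PiE_def Pi_def extensional_def)
    next
      case (3 y)
      then obtain J g p where y: "y = (J, g)" "J \<subseteq> P - S" "g \<in> J \<rightarrow>\<^sub>E set (a # as)" "inj_on g J" "p \<in> J" "g p = a"
        by (auto simp: D_def)
      have "the_inv_into J g a = p" by (rule the_inv_into_f_eq) (use y in auto)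
      then show ?case using y by (auto simp: Let_def)
    next
      case (4 y)
      then obtain J g p where y: "y = (J, g)" "J \<subseteq> P - S" "g \<in> J \<rightarrow>\<^sub>E set (a # as)" "inj_on g J" "p \<in> J" "g p = a"
        by (auto simp: D_def)
      have "the_inv_into J g a = p" by (rule the_inv_into_f_eq) (use y in auto)
      moreover have "g q \<in> set as" if "q \<in> J - {p}" for q
      proof -
        have "g q \<in> set (a # as)" using y that by auto
        moreover have "g q \<noteq> a" using y that by (auto simp: inj_on_def)
        ultimately show ?thesis by simp
      qed
      ultimately show ?case using y by (auto simp: Let_def D_def PiE_def Pi_def extensional_def inj_on_def)
    next
      case (5 x)
      then obtain p J g where x: "x = (p, J, g)" "p \<in> P - S" "J \<subseteq> P - insert p S" "g \<in> J \<rightarrow>\<^sub>E set as" "inj_on g J"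
        by (auto simp: D_def)
      have J: "finite J" "p \<notin> J" using x assms(1) by (auto intro: finite_subset)
      have a: "a \<notin> g ` J" using x d by auto
      have im: "(g(p := a)) ` insert p J = insert a (g ` J)" using J by auto
      have ov: "override_on \<kappa> (g(p := a)) (insert p J) = override_on (\<kappa>(p := a)) g J"
        using J by (auto simp: override_on_def fun_eq_iff)
      have "set (a # as) - insert a (g ` J) = set as - g ` J" using d by auto
      moreover have "(\<forall>q\<in>insert p J. \<kappa> q = \<sigma> ((g(p := a)) q)) \<longleftrightarrow> \<kappa> p = \<sigma> a \<and> (\<forall>q\<in>J. (\<kappa>(p := a)) q = \<sigma> (g q))"
        using J by auto
      ultimately have "t (a # as) F \<kappa> (insert p J) (g(p := a)) = - (of_bool (\<kappa> p = \<sigma> a) * \<xi> p * t as F (\<kappa>(p := a)) J g)"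
        unfolding t_def im ov using J by (auto simp: of_bool_def)
      then show ?case by (simp add: x(1))
    qed
    also have "\<dots> = (\<Sum>p\<in>P - S. \<Sum>(J, g)\<in>D as (insert p S). - (of_bool (\<kappa> p = \<sigma> a) * \<xi> p * t as F (\<kappa>(p := a)) J g))"
      by (subst sum.Sigma) (use assms(1) finD in auto)
    finally show ?thesis unfolding ih
      by (simp add: sum_negf sum_distrib_left case_prod_unfold)
  qed
  have "(\<Sum>(J, g)\<in>D (a # as) S. t (a # as) F \<kappa> J g)
     = (\<Sum>(J, g)\<in>{(J, g) \<in> D (a # as) S. a \<notin> g ` J}. t (a # as) F \<kappa> J g)
     + (\<Sum>(J, g)\<in>{(J, g) \<in> D (a # as) S. a \<in> g ` J}. t (a # as) F \<kappa> J g)"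
    by (subst sum.union_disjoint[symmetric]) (auto intro: finite_subset[OF _ finD] intro!: sum.cong)
  then show ?case unfolding part1 part2 by (simp add: D_def t_def)
qed

text \<open>For a fixed set \<open>J\<close> the surviving pairs of \<open>\<sigma>\<close> and
  \<open>g\<close> correspond to the permutations \<open>\<pi>\<close> of \<open>J\<close>: on
  \<open>J\<close> the map \<open>g\<close> is \<open>\<kappa> \<circ> \<pi>\<close>, while
  \<open>\<sigma>\<close> sends \<open>\<kappa> (\<pi> p)\<close> to \<open>\<kappa> p\<close> and
  fixes the colours that do not occur on \<open>J\<close>. So \<open>\<sigma>\<close> is the inverse
  of \<open>\<pi>\<close> transported by \<open>\<kappa>\<close>, and the signs agree. If
  \<open>\<kappa>\<close> repeats a colour on \<open>J\<close>, both sides are zero.\<close>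

lemma row_det_alternize:
  assumes "finite P" "distinct as" "\<And>p. p \<in> P \<Longrightarrow> fps_deriv (\<xi> p) = - (\<xi> p)\<^sup>2" and \<kappa>: "\<kappa> ` P \<subseteq> set as"
  shows "row_det as (pos_X P \<xi>) F \<kappa>
    = (\<Sum>J\<in>Pow P. (-1) ^ card J * prod \<xi> J * alternize J (\<lambda>\<kappa>. (fps_deriv ^^ (length as - card J)) (F \<kappa>)) \<kappa>)"
proof -
  let ?A = "set as"
  let ?w = "\<lambda>\<sigma> J g. (\<forall>p\<in>J. \<kappa> p = \<sigma> (g p)) \<and> (\<forall>i\<in>?A - g ` J. \<sigma> i = i)"
  let ?d = "\<lambda>J. fps_deriv ^^ (length as - card J)"
  have key: "(\<Sum>\<sigma> | \<sigma> permutes ?A. \<Sum>g\<in>inj_maps J ?A. of_int (sign \<sigma>) * (of_bool (?w \<sigma> J g) * ?d J (F (override_on \<kappa> g J))))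
     = alternize J (\<lambda>\<kappa>. ?d J (F \<kappa>)) \<kappa>" if J: "J \<subseteq> P" for J
  proof (cases "inj_on \<kappa> J")
    case False
    \<comment> \<open>On \<open>J\<close> the colouring would equal
      \<open>\<sigma> \<circ> g\<close>, which is injective.\<close>
    have "\<not> ?w \<sigma> J g" if "\<sigma> permutes ?A" "g \<in> inj_maps J ?A" for \<sigma> g
    proof
      assume "?w \<sigma> J g"
      moreover have "inj_on (\<sigma> \<circ> g) J" using that permutes_inj[OF that(1)] by (auto simp: inj_on_def inj_def)
      ultimately show False using False by (auto simp: inj_on_def)
    qed
    then have "(\<Sum>\<sigma> | \<sigma> permutes ?A. \<Sum>g\<in>inj_maps J ?A. of_int (sign \<sigma>) * (of_bool (?w \<sigma> J g) * ?d J (F (override_on \<kappa> g J)))) = 0"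
      by (intro sum.neutral ballI) (auto simp only: mem_Collect_eq of_bool_eq mult_zero_left mult_zero_right)
    then show ?thesis using alternize_eq_0_not_inj[OF finite_subset[OF J assms(1)] False] by simp
  next
    case True
    have finJ: "finite J" using J assms(1) finite_subset by blast
    have \<kappa>J: "\<kappa> ` J \<subseteq> ?A" using J \<kappa> by auto
    let ?B = "{(\<sigma>, g). \<sigma> permutes ?A \<and> g \<in> inj_maps J ?A \<and> ?w \<sigma> J g}"
    have fin: "finite {\<sigma>. \<sigma> permutes ?A}" "finite (inj_maps J ?A)"
      using finJ by (auto intro: finite_permutations finite_inj_maps)
    have perm: "\<kappa> ` J = g ` J" "(\<lambda>p. if p \<in> J then inv_into J \<kappa> (g p) else p) permutes J"
      if y: "\<sigma> permutes ?A" "g \<in> J \<rightarrow>\<^sub>E ?A" "inj_on g J" "?w \<sigma> J g" for \<sigma> g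
    proof -
      have gA: "g ` J \<subseteq> ?A" using y by auto
      \<comment> \<open>As \<open>\<sigma>\<close> fixes all rows outside the image of
        \<open>g\<close>, it permutes that image.\<close>
      have "\<sigma> ` (g ` J) = \<sigma> ` ?A - \<sigma> ` (?A - g ` J)" using gA permutes_inj[OF y(1)] by (auto simp: inj_def)
      also have "\<sigma> ` (?A - g ` J) = ?A - g ` J" using y(4) by (auto simp: image_iff)
      finally have "\<sigma> ` (g ` J) = g ` J" using gA by (auto simp: permutes_image[OF y(1)])
      then show im: "\<kappa> ` J = g ` J" using y(4) by (auto simp: image_image)
      have "bij_betw (inv_into J \<kappa> \<circ> g) J J"
      proof (rule bij_betw_trans)
        show "bij_betw g J (\<kappa> ` J)" using y(3) im by (simp add: bij_betw_def)
        show "bij_betw (inv_into J \<kappa>) (\<kappa> ` J) J" using True by (simp add: bij_betw_inv_into inj_on_imp_bij_betw)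
      qed
      then have "bij_betw (\<lambda>p. if p \<in> J then inv_into J \<kappa> (g p) else p) J J"
        by (rule bij_betw_cong[THEN iffD1, rotated]) simp
      then show "(\<lambda>p. if p \<in> J then inv_into J \<kappa> (g p) else p) permutes J"
        by (rule bij_imp_permutes) simp
    qed
    have "(\<Sum>\<sigma> | \<sigma> permutes ?A. \<Sum>g\<in>inj_maps J ?A. of_int (sign \<sigma>) * (of_bool (?w \<sigma> J g) * ?d J (F (override_on \<kappa> g J))))
       = (\<Sum>(\<sigma>, g)\<in>{\<sigma>. \<sigma> permutes ?A} \<times> inj_maps J ?A. of_int (sign \<sigma>) * (of_bool (?w \<sigma> J g) * ?d J (F (override_on \<kappa> g J))))"
      by (rule sum.cartesian_product)
    also have "\<dots> = (\<Sum>(\<sigma>, g)\<in>?B. of_int (sign \<sigma>) * ?d J (F (override_on \<kappa> g J)))"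
      by (rule sum.mono_neutral_cong_right) (use fin in auto)
    also have "\<dots> = (\<Sum>\<pi> | \<pi> permutes J. of_int (sign \<pi>) * ?d J (F (\<kappa> \<circ> \<pi>)))"
    proof (rule sum.reindex_bij_witness[symmetric, of _ "\<lambda>(\<sigma>, g) p. if p \<in> J then inv_into J \<kappa> (g p) else p"
          "\<lambda>\<pi>. (map_permutation J \<kappa> (Hilbert_Choice.inv \<pi>), restrict (\<kappa> \<circ> \<pi>) J)"], goal_cases)
      case (1 \<pi>)
      then show ?case using True permutes_in_image[of \<pi> J] permutes_not_in[of \<pi> J]
        by (auto simp: fun_eq_iff)
    next
      case (2 \<pi>)
      then have \<pi>: "\<pi> permutes J" by simp
      let ?s = "map_permutation J \<kappa> (Hilbert_Choice.inv \<pi>)"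
      have ip: "Hilbert_Choice.inv \<pi> permutes J" using \<pi> by (rule permutes_inv)
      have s: "?s permutes \<kappa> ` J" using ip True by (intro map_permutation_permutes) (auto simp: inj_on_imp_bij_betw)
      have sA: "?s permutes ?A" using s \<kappa>J by (rule permutes_subset)
      have "?s (\<kappa> (\<pi> p)) = \<kappa> p" if "p \<in> J" for p
        using that True \<pi> permutes_in_image[OF \<pi>]
        by (simp add: map_permutation_apply[OF True] permutes_inverses)
      moreover have "?s i = i" if "i \<notin> \<kappa> ` J" for i using that s permutes_not_in by metis
      moreover have "restrict (\<kappa> \<circ> \<pi>) J ` J = \<kappa> ` J" using permutes_image[OF \<pi>] by (simp only: image_restrict_eq image_comp[symmetric])
      moreover have "inj_on (\<kappa> \<circ> \<pi>) J" using True permutes_inj_on[OF \<pi>] permutes_image[OF \<pi>] by (simp add: comp_inj_on)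
      moreover have "\<forall>p\<in>J. \<kappa> (\<pi> p) \<in> ?A" using \<kappa>J permutes_in_image[OF \<pi>] by blast
      ultimately show ?case using sA by (auto simp: inj_on_restrict_eq simp del: image_restrict_eq)
    next
      case (3 y)
      then obtain \<sigma> g where y: "y = (\<sigma>, g)" "\<sigma> permutes ?A" "g \<in> J \<rightarrow>\<^sub>E ?A" "inj_on g J" "?w \<sigma> J g" by auto
      let ?\<pi> = "\<lambda>p. if p \<in> J then inv_into J \<kappa> (g p) else p"
      note \<pi> = perm[OF y(2-5)]
      have "map_permutation J \<kappa> (Hilbert_Choice.inv ?\<pi>) i = \<sigma> i" for i
      proof (cases "i \<in> g ` J")
        case True
        then obtain p where p: "p \<in> J" "i = g p" by auto
        have "map_permutation J \<kappa> (Hilbert_Choice.inv ?\<pi>) (\<kappa> (?\<pi> p)) = \<kappa> (Hilbert_Choice.inv ?\<pi> (?\<pi> p))"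
          using p permutes_in_image[OF \<pi>(2), of p] by (intro map_permutation_apply \<open>inj_on \<kappa> J\<close>) auto
        also have "Hilbert_Choice.inv ?\<pi> (?\<pi> p) = p" by (rule permutes_inverses[OF \<pi>(2)])
        also have "\<kappa> (?\<pi> p) = g p" using p \<pi>(1) by (simp add: f_inv_into_f)
        finally show ?thesis using y p by auto
      next
        case False
        then have "map_permutation J \<kappa> (Hilbert_Choice.inv ?\<pi>) i = i"
          using \<pi>(1) by (simp add: map_permutation_def restrict_id_def)
        moreover have "\<sigma> i = i" using False y(5) permutes_not_in[OF y(2), of i] by blast
        ultimately show ?thesis by simp
      qed
      moreover have "restrict (\<kappa> \<circ> ?\<pi>) J = g"
        using y(3) \<pi>(1) by (auto simp: fun_eq_iff f_inv_into_f PiE_def extensional_def)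
      ultimately show ?case by (auto simp: y(1))
    next
      case (4 y)
      then obtain \<sigma> g where y: "y = (\<sigma>, g)" "\<sigma> permutes ?A" "g \<in> J \<rightarrow>\<^sub>E ?A" "inj_on g J" "?w \<sigma> J g" by auto
      show ?case using perm(2)[OF y(2-5)] by (simp add: y(1))
    next
      case (5 \<pi>)
      then have \<pi>: "\<pi> permutes J" by simp
      then have ip: "Hilbert_Choice.inv \<pi> permutes J" by (rule permutes_inv)
      have "sign (map_permutation J \<kappa> (Hilbert_Choice.inv \<pi>)) = sign \<pi>"
        using sign_map_permutation[OF True ip finJ] finJ \<pi> by (simp add: sign_inverse permutes_imp_permutation)
      moreover have "override_on \<kappa> (restrict (\<kappa> \<circ> \<pi>) J) J = \<kappa> \<circ> \<pi>"
        using permutes_not_in[OF \<pi>] by (auto simp: override_on_def fun_eq_iff)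
      ultimately show ?case by simp
    qed
    finally show ?thesis by (simp add: alternize_def)
  qed
  have fin: "finite J" if "J \<in> Pow P" for J using that assms(1) finite_subset by blast
  have rd: "row_det as (pos_X P \<xi>) F \<kappa>
      = (\<Sum>\<sigma> | \<sigma> permutes ?A. of_int (sign \<sigma>) * normal_prod P \<xi> \<sigma> as {} F \<kappa>)"
    by (rule row_det_pos_X) (use assms in auto)
  have "row_det as (pos_X P \<xi>) F \<kappa> = (\<Sum>\<sigma> | \<sigma> permutes ?A. \<Sum>J\<in>Pow P. \<Sum>g\<in>inj_maps J ?A.
     of_int (sign \<sigma>) * (of_bool (?w \<sigma> J g) * ((-1) ^ card J * prod \<xi> J * ?d J (F (override_on \<kappa> g J)))))"
    unfolding rd
  proof (intro sum.cong refl, goal_cases)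
    case (1 \<sigma>)
    show ?case
      unfolding normal_prod_expand[OF assms(1,2)] Diff_empty
      by (subst sum.Sigma[symmetric]) (use assms(1) fin in \<open>auto intro!: finite_inj_maps simp: sum_distrib_left\<close>)
  qed
  also have "\<dots> = (\<Sum>J\<in>Pow P. (-1) ^ card J * prod \<xi> J * (\<Sum>\<sigma> | \<sigma> permutes ?A. \<Sum>g\<in>inj_maps J ?A.
     of_int (sign \<sigma>) * (of_bool (?w \<sigma> J g) * ?d J (F (override_on \<kappa> g J)))))"
    by (subst sum.swap) (simp add: sum_distrib_left mult_ac)
  also have "\<dots> = (\<Sum>J\<in>Pow P. (-1) ^ card J * prod \<xi> J * alternize J (\<lambda>\<kappa>. ?d J (F \<kappa>)) \<kappa>)"
    by (intro sum.cong refl, subst key) auto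
  finally show ?thesis .
qed

subsection \<open>A polynomial Green function\<close>

lemma pos_X_const_mult:
  "pos_X P \<xi> a b (\<lambda>\<kappa>. fps_const c * f \<kappa>) = (\<lambda>\<kappa>. fps_const c * pos_X P \<xi> a b f \<kappa>)"
  by (rule ext) (simp add: pos_X_def sum_distrib_left right_diff_distrib mult_ac)

lemma foldr_pos_X_const_mult:
  "foldr (\<lambda>a. pos_X P \<xi> a (\<sigma> a)) as (\<lambda>\<kappa>. fps_const c * f \<kappa>)
     = (\<lambda>\<kappa>. fps_const c * foldr (\<lambda>a. pos_X P \<xi> a (\<sigma> a)) as f \<kappa>)"
  by (induction as) (simp_all add: pos_X_const_mult)

lemma row_det_pos_X_add:
  "row_det as (pos_X P \<xi>) (\<lambda>\<kappa>. f \<kappa> + g \<kappa>) \<kappa> = row_det as (pos_X P \<xi>) f \<kappa> + row_det as (pos_X P \<xi>) g \<kappa>"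
  by (simp add: row_det_def foldr_pos_X_add distrib_left sum.distrib)

lemma row_det_pos_X_lincomb:
  "row_det as (pos_X P \<xi>) (\<lambda>\<kappa>. \<Sum>s\<in>S. fps_const (c s) * f s \<kappa>) \<kappa>
     = (\<Sum>s\<in>S. fps_const (c s) * row_det as (pos_X P \<xi>) (f s) \<kappa>)"
  by (simp add: row_det_def foldr_pos_X_sum foldr_pos_X_const_mult sum_distrib_left mult.left_commute sum.swap[of _ S])

lemma sum_fps_const: "(\<Sum>i\<in>A. fps_const (f i)) = fps_const (\<Sum>i\<in>A. f i)"
  by (induction A rule: infinite_finite_induct) auto

lemma symmetrize_fps_const: "symmetrize I (\<lambda>\<kappa>. fps_const (x \<kappa>)) \<kappa> = fps_const (symmetrize I x \<kappa>)"
  by (simp add: symmetrize_def sum_fps_const)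

lemma funpow_fps_deriv_sum: "(fps_deriv ^^ k) (\<Sum>i\<in>A. f i) = (\<Sum>i\<in>A. (fps_deriv ^^ k) (f i :: complex fps))"
  by (induction k arbitrary: f) (simp_all add: fps_deriv_sum funpow_swap1)

lemma funpow_fps_deriv_mult_const:
  fixes c :: "complex fps"
  assumes "fps_deriv c = 0"
  shows "(fps_deriv ^^ k) (f * c) = (fps_deriv ^^ k) f * c"
  by (induction k arbitrary: f) (simp_all add: funpow_swap1 assms)

lemma fps_deriv_divided_power:
  fixes w :: "complex fps"
  assumes "fps_deriv w = 1"
  shows "fps_deriv (fps_const (1 / fact k) * w ^ k) = (if k = 0 then 0 else fps_const (1 / fact (k - 1)) * w ^ (k - 1))"
proof (cases k)
  case (Suc j)
  have "fps_deriv (fps_const (1 / fact k) * w ^ k) = fps_const (1 / fact k) * (of_nat k * w ^ j)"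
    unfolding Suc using assms by (subst fps_deriv_mult, subst fps_deriv_power') (simp del: of_nat_Suc power_Suc)
  also have "\<dots> = fps_const (1 / fact k * of_nat k) * w ^ j" by (simp add: fps_of_nat[symmetric] mult.assoc[symmetric] del: of_nat_Suc)
  also have "1 / fact k * of_nat k = (1 / fact j :: complex)" by (simp add: Suc del: of_nat_Suc)
  finally show ?thesis by (simp add: Suc)
qed simp

lemma funpow_fps_deriv_divided_power:
  fixes w :: "complex fps"
  assumes "fps_deriv w = 1"
  shows "(fps_deriv ^^ j) (fps_const (1 / fact k) * w ^ k) = (if j \<le> k then fps_const (1 / fact (k - j)) * w ^ (k - j) else 0)"
proof (induction j)
  case (Suc j)
  show ?case
  proof (cases "j \<le> k")
    case True
    then show ?thesis using Suc.IH fps_deriv_divided_power[OF assms, of "k - j"] by auto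
  qed (use Suc.IH in simp)
qed simp

text \<open>The Taylor expansion of \<open>1 / (u - zp p)\<close> at \<open>u = v\<close>, with
  \<open>fps_X\<close> standing for \<open>u - v\<close>.\<close>

definition rxi :: "complex \<Rightarrow> ('p \<Rightarrow> complex) \<Rightarrow> 'p \<Rightarrow> complex fps" where
  "rxi v zp p = inverse (fps_X + fps_const (v - zp p))"

text \<open>The bound on the degree depends neither on \<open>v\<close> nor on the data. The
  equation is required only at colourings by \<open>{1..N}\<close>, where the formula with
  antisymmetrizers is available.\<close>

definition polynomial_solution ::
    "nat \<Rightarrow> 'p set \<Rightarrow> complex \<Rightarrow> ('p \<Rightarrow> complex) \<Rightarrow> (('p \<Rightarrow> nat) \<Rightarrow> complex fps) \<Rightarrow> bool" where
  "polynomial_solution N P v zp F \<longleftrightarrow>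
     (\<forall>\<kappa>. \<kappa> ` P \<subseteq> {1..N} \<longrightarrow> row_det [1..<N+1] (pos_X P (rxi v zp)) F \<kappa> = 0) \<and>
     (\<forall>\<kappa> l. l \<ge> N + card P \<longrightarrow> fps_nth (F \<kappa>) l = 0)"

context
  fixes N :: nat and P :: "'p set" and v :: complex and zp :: "'p \<Rightarrow> complex"
  assumes N: "1 \<le> N" and finP: "finite P" and zp: "\<And>p. p \<in> P \<Longrightarrow> zp p \<noteq> v"
begin

lemma rxi_mult: "p \<in> P \<Longrightarrow> (rxi v zp) p * (fps_X + fps_const (v - zp p)) = 1"
  unfolding rxi_def by (rule inverse_mult_eq_1) (use zp in auto)

lemma rxi_deriv: "p \<in> P \<Longrightarrow> fps_deriv ((rxi v zp) p) = - ((rxi v zp) p)\<^sup>2"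
  unfolding rxi_def by (subst fps_inverse_deriv) (use zp in auto)

abbreviation Dpos :: "(('p \<Rightarrow> nat) \<Rightarrow> complex fps) \<Rightarrow> ('p \<Rightarrow> nat) \<Rightarrow> complex fps" where
  "Dpos \<equiv> row_det [1..<N+1] (pos_X P (rxi v zp))"

lemma Dpos_alternize:
  assumes "\<kappa> ` P \<subseteq> {1..N}"
  shows "Dpos F \<kappa> = (\<Sum>J\<in>Pow P. (-1) ^ card J * prod (rxi v zp) J * alternize J (\<lambda>\<kappa>. (fps_deriv ^^ (N - card J)) (F \<kappa>)) \<kappa>)"
proof -
  have "Dpos F \<kappa> = (\<Sum>J\<in>Pow P. (-1) ^ card J * prod (rxi v zp) J
      * alternize J (\<lambda>\<kappa>. (fps_deriv ^^ (length [1..<N+1] - card J)) (F \<kappa>)) \<kappa>)"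
    by (rule row_det_alternize) (use finP rxi_deriv assms in auto)
  then show ?thesis by simp
qed

text \<open>
  With \<open>u = v + fps_X\<close> this is the solution of \<open>D F = 0\<close> that vanishes to order \<open>N - 1\<close> at \<open>u = v + e\<close>,
  multiplied by \<open>\<Prod>\<^sub>p (v + e - zp p)\<close>, which makes it polynomial in \<open>e\<close>.
\<close>

definition green :: "complex \<Rightarrow> (('p \<Rightarrow> nat) \<Rightarrow> complex) \<Rightarrow> ('p \<Rightarrow> nat) \<Rightarrow> complex fps" where
  "green e x \<kappa> = (\<Sum>I\<in>Pow P. fps_const (1 / fact (N - 1 + card I)) * (fps_X - fps_const e) ^ (N - 1 + card I)
     * ((\<Prod>p\<in>P - I. fps_const (v + e - zp p)) * fps_const (symmetrize I x \<kappa>)))"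

text \<open>Deriving \<open>N - card J\<close> times turns the divided power of exponent
  \<open>N - 1 + card I\<close> into that of exponent \<open>card I + card J - 1\<close>, so the
  equation becomes \<open>sum_pairs_cancel\<close>. The pair of empty sets drops out because
  \<open>N\<close> derivatives kill a power of degree \<open>N - 1\<close>. The relation required of
  \<open>w\<close> holds because \<open>w\<close> and \<open>q p\<close> add up to
  \<open>u - zp p\<close>.\<close>

lemma Dpos_green:
  assumes "\<kappa> ` P \<subseteq> {1..N}"
  shows "Dpos (green e x) \<kappa> = 0"
proof -
  define w where "w = fps_X - fps_const e"
  define q where "q = (\<lambda>p. fps_const (v + e - zp p))"
  define \<gamma> where "\<gamma> = (\<lambda>k. fps_const (1 / fact k) * w ^ k)"
  let ?X = "\<lambda>\<kappa>. fps_const (x \<kappa>)"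
  have dw: "fps_deriv w = 1" by (simp add: w_def)
  have dq: "fps_deriv (prod q A) = 0" for A
  proof (cases "finite A")
    case True
    then show ?thesis by (induction A) (auto simp: q_def)
  qed simp
  have green: "green e x = (\<lambda>\<kappa>. \<Sum>I\<in>Pow P. \<gamma> (N - 1 + card I) * (prod q (P - I) * symmetrize I ?X \<kappa>))"
    unfolding green_def \<gamma>_def w_def q_def symmetrize_fps_const by simp
  have deriv: "(fps_deriv ^^ j) (green e x \<kappa>') = (\<Sum>I\<in>Pow P. (fps_deriv ^^ j) (\<gamma> (N - 1 + card I)) * (prod q (P - I) * symmetrize I ?X \<kappa>'))" for j \<kappa>'
    unfolding green funpow_fps_deriv_sum
    by (intro sum.cong refl funpow_fps_deriv_mult_const) (simp add: symmetrize_fps_const dq)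
  have trm: "alternize J (\<lambda>\<kappa>. (fps_deriv ^^ (N - card J)) (green e x \<kappa>)) \<kappa>
      = (\<Sum>I\<in>Pow P. of_bool (J \<noteq> {} \<or> I \<noteq> {}) * (\<gamma> (card I + card J - 1) * (prod q (P - I) * alternize J (symmetrize I ?X) \<kappa>)))"
    if J: "J \<in> Pow P" for J
  proof -
    have finJ: "finite J" using J finP finite_subset by blast
    show ?thesis
    proof (cases "card J \<le> N")
      \<comment> \<open>Here \<open>N - card J\<close> is truncated, but only \<open>N\<close>
        colours are available and one of them must repeat on \<open>J\<close>.\<close>
      case False
      have "\<not> inj_on \<kappa> J"
      proof
        assume "inj_on \<kappa> J"
        then have "card J \<le> card {1..N}" by (rule card_inj_on_le) (use J assms in auto)
        then show False using False by simp
      qed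
      then show ?thesis by (simp add: alternize_eq_0_not_inj[OF finJ])
    next
      case True
      have "(fps_deriv ^^ (N - card J)) (\<gamma> (N - 1 + card I)) = of_bool (J \<noteq> {} \<or> I \<noteq> {}) * \<gamma> (card I + card J - 1)"
        if "I \<in> Pow P" for I
      proof -
        have finI: "finite I" using that finP finite_subset by blast
        have "card I + card J = 0 \<longleftrightarrow> J = {} \<and> I = {}" using finI finJ by auto
        moreover have "N - 1 + card I - (N - card J) = card I + card J - 1" using True N by auto
        moreover have "N - card J \<le> N - 1 + card I \<longleftrightarrow> card I + card J \<noteq> 0" using True N by auto
        ultimately show ?thesis unfolding \<gamma>_def funpow_fps_deriv_divided_power[OF dw] by auto
      qed
      then show ?thesis unfolding deriv alternize_sum mult.assoc[symmetric]
        by (intro sum.cong refl) (simp add: alternize_mult)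
    qed
  qed
  have "Dpos (green e x) \<kappa> = (\<Sum>J\<in>Pow P. \<Sum>I\<in>Pow P. of_bool (J \<noteq> {} \<or> I \<noteq> {}) * ((-1) ^ card J * prod (rxi v zp) J * prod q (P - I)
      * \<gamma> (card I + card J - 1) * alternize J (symmetrize I ?X) \<kappa>))"
    unfolding Dpos_alternize[OF assms]
  proof (rule sum.cong[OF refl], goal_cases)
    case (1 J)
    show ?case unfolding trm[OF 1] sum_distrib_left by (intro sum.cong refl) (simp add: mult_ac)
  qed
  also have "\<dots> = 0"
  proof (rule sum_pairs_cancel[OF finP])
    fix J I a b assume "J \<subseteq> P" "I \<subseteq> P" "a \<in> I \<inter> J" "b \<in> I \<inter> J" "a \<noteq> b"
    then show "alternize J (symmetrize I ?X) \<kappa> = 0"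
      using finP finite_subset by (intro alternize_symmetrize_eq_0[of J a I b]) auto
  next
    fix J I assume "J \<subseteq> P" "I \<subseteq> P" "I \<inter> J = {}"
    then show "(\<Sum>c\<in>I. alternize (insert c J) (symmetrize I ?X) \<kappa>) + (\<Sum>c\<in>J. alternize J (symmetrize (insert c I) ?X) \<kappa>)
       = of_nat (card I + card J) * alternize J (symmetrize I ?X) \<kappa>"
      using finP finite_subset by (intro alternize_symmetrize_exchange) auto
  next
    fix k
    have "of_nat (Suc k) * \<gamma> (Suc k) = fps_const (of_nat (Suc k) * (1 / fact (Suc k))) * w ^ Suc k"
      unfolding \<gamma>_def by (simp add: fps_of_nat[symmetric] mult.assoc[symmetric] del: of_nat_Suc fact_Suc)
    also have "of_nat (Suc k) * (1 / fact (Suc k)) = (1 / fact k :: complex)" by (simp del: of_nat_Suc)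
    finally show "of_nat (Suc k) * \<gamma> (Suc k) = w * \<gamma> k" unfolding \<gamma>_def by (simp add: mult_ac)
  next
    fix p assume "p \<in> P"
    have "w + q p = fps_X + fps_const (v - zp p)" unfolding w_def q_def by (simp add: fps_eq_iff)
    then have "(rxi v zp) p * (w + q p) = 1" using rxi_mult[OF \<open>p \<in> P\<close>] by simp
    then show "w * (rxi v zp) p = 1 - (rxi v zp) p * q p" by (simp add: algebra_simps)
  qed
  finally show ?thesis .
qed

text \<open>The point \<open>e\<close> becomes the variable of a polynomial over power series, with
  \<open>[:fps_X, -1:]\<close> for \<open>fps_X - e\<close>. This gives access to the separate
  powers of \<open>e\<close>.\<close>

definition green_poly :: "(('p \<Rightarrow> nat) \<Rightarrow> complex) \<Rightarrow> ('p \<Rightarrow> nat) \<Rightarrow> complex fps poly" where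
  "green_poly x \<kappa> = (\<Sum>I\<in>Pow P. Polynomial.smult (fps_const (1 / fact (N - 1 + card I) * symmetrize I x \<kappa>))
     ([:fps_X, -1:] ^ (N - 1 + card I) * (\<Prod>p\<in>P - I. [:fps_const (v - zp p), 1:])))"

lemma poly_green_poly: "poly (green_poly x \<kappa>) (fps_const e) = green e x \<kappa>"
proof -
  have 1: "poly [:fps_X, -1:] (fps_const e) = fps_X - fps_const e"
    by (simp add: fps_eq_iff)
  have 2: "poly [:fps_const (v - zp p), 1:] (fps_const e) = fps_const (v + e - zp p)" for p
    by (simp add: fps_eq_iff)
  show ?thesis
    unfolding green_poly_def green_def poly_sum poly_smult poly_mult poly_power poly_prod 1 2
    by (intro sum.cong refl) (simp only: fps_const_mult[symmetric] mult_ac)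
qed

lemma degree_green_poly: "Polynomial.degree (green_poly x \<kappa>) \<le> N - 1 + card P + card P"
  unfolding green_poly_def
proof (intro degree_sum_le, goal_cases)
  case (2 I)
  have c: "card I \<le> card P" "card (P - I) \<le> card P" using 2 finP by (auto intro: card_mono)
  have "Polynomial.degree ([:fps_X, - 1:] ^ (N - 1 + card I) * (\<Prod>p\<in>P - I. [:fps_const (v - zp p), 1:]))
     \<le> Polynomial.degree ([:fps_X, - 1 :: complex fps:] ^ (N - 1 + card I)) + Polynomial.degree (\<Prod>p\<in>P - I. [:fps_const (v - zp p), 1:])"
    by (rule degree_mult_le)
  also have "Polynomial.degree ([:fps_X, - 1 :: complex fps:] ^ (N - 1 + card I)) \<le> Polynomial.degree [:fps_X, - 1 :: complex fps:] * (N - 1 + card I)"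
    by (rule degree_power_le)
  also have "Polynomial.degree (\<Prod>p\<in>P - I. [:fps_const (v - zp p), 1:]) \<le> sum (Polynomial.degree \<circ> (\<lambda>p. [:fps_const (v - zp p), 1:])) (P - I)"
    using finP by (intro degree_prod_sum_le) auto
  finally show ?case using c by (intro order.trans[OF degree_smult_le]) simp
qed (use finP in auto)

text \<open>The operator is linear over the constants and does not contain \<open>e\<close>. Each
  Taylor coefficient of its value on \<open>green e x\<close> is a polynomial in the number
  \<open>e\<close> that vanishes identically, so all coefficients of that polynomial are
  zero.\<close>

lemma Dpos_coeff_green_poly:
  assumes "\<kappa> ` P \<subseteq> {1..N}"
  shows "Dpos (\<lambda>\<kappa>. Polynomial.coeff (green_poly x \<kappa>) s) \<kappa> = 0"
proof -
  let ?B = "N - 1 + card P + card P"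
  have g: "green e x = (\<lambda>\<kappa>. \<Sum>s\<le>?B. fps_const (e ^ s) * Polynomial.coeff (green_poly x \<kappa>) s)" for e
  proof
    fix \<kappa>
    have "green e x \<kappa> = (\<Sum>s\<le>Polynomial.degree (green_poly x \<kappa>). Polynomial.coeff (green_poly x \<kappa>) s * fps_const e ^ s)"
      by (simp add: poly_green_poly[symmetric] poly_altdef)
    also have "\<dots> = (\<Sum>s\<le>?B. Polynomial.coeff (green_poly x \<kappa>) s * fps_const e ^ s)"
      by (rule sum.mono_neutral_left) (use degree_green_poly[of x \<kappa>] in \<open>auto simp: coeff_eq_0\<close>)
    finally show "green e x \<kappa> = (\<Sum>s\<le>?B. fps_const (e ^ s) * Polynomial.coeff (green_poly x \<kappa>) s)"
      by (simp add: fps_const_power mult.commute)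
  qed
  have "fps_nth (Dpos (\<lambda>\<kappa>. Polynomial.coeff (green_poly x \<kappa>) s) \<kappa>) l = 0" if "s \<le> ?B" for l s
  proof -
    have "(\<Sum>s\<le>?B. fps_nth (Dpos (\<lambda>\<kappa>. Polynomial.coeff (green_poly x \<kappa>) s) \<kappa>) l * e ^ s) = 0" for e
    proof -
      have "0 = fps_nth (Dpos (green e x) \<kappa>) l" using Dpos_green[OF assms] by simp
      also have "\<dots> = (\<Sum>s\<le>?B. fps_nth (Dpos (\<lambda>\<kappa>. Polynomial.coeff (green_poly x \<kappa>) s) \<kappa>) l * e ^ s)"
        unfolding g row_det_pos_X_lincomb by (simp add: fps_sum_nth mult.commute)
      finally show ?thesis ..
    qed
    then have "\<forall>s\<le>?B. fps_nth (Dpos (\<lambda>\<kappa>. Polynomial.coeff (green_poly x \<kappa>) s) \<kappa>) l = 0"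
      by (intro polyfun_eq_0[THEN iffD1] allI)
    then show ?thesis using that by simp
  qed
  moreover have "Dpos (\<lambda>\<kappa>. Polynomial.coeff (green_poly x \<kappa>) s) \<kappa> = 0" if "s > ?B"
  proof -
    have "Polynomial.coeff (green_poly x \<kappa>) s = 0" for \<kappa> using degree_green_poly[of x \<kappa>] that by (intro coeff_eq_0) simp
    then have "(\<lambda>\<kappa>. Polynomial.coeff (green_poly x \<kappa>) s) = (\<lambda>\<kappa>. \<Sum>i\<in>({}::nat set). fps_const 0 * 0)" by auto
    then show ?thesis by (simp only: row_det_pos_X_lincomb) simp
  qed
  ultimately show ?thesis by (cases "s \<le> ?B") (auto simp: fps_eq_iff)
qed

lemma coeff_prod_const_nth:
  "finite A \<Longrightarrow> 0 < l \<Longrightarrow> fps_nth (Polynomial.coeff (\<Prod>p\<in>A. [:fps_const (a p :: complex), 1:]) j) l = 0"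
proof (induction A arbitrary: j rule: finite_induct)
  case (insert p A)
  then show ?case by (cases j) (auto simp: coeff_pCons)
qed (auto simp: coeff_1)

text \<open>Only the powers of \<open>[:fps_X, -1:]\<close> involve \<open>fps_X\<close>; the other
  factors have constant coefficients. From \<open>s < N\<close> follows
  \<open>b \<le> N - 1 + card I\<close>, so the exponent of \<open>fps_X\<close> is a genuine
  difference.\<close>

lemma coeff_green_poly_nth:
  assumes "s < N"
  shows "fps_nth (Polynomial.coeff (green_poly x \<kappa>) s) l =
    (\<Sum>I\<in>Pow P. 1 / fact (N - 1 + card I) * symmetrize I x \<kappa> * (\<Sum>b\<le>s. of_nat (N - 1 + card I choose b) * (-1) ^ b
        * of_bool (l = N - 1 + card I - b) * fps_nth (Polynomial.coeff (\<Prod>p\<in>P - I. [:fps_const (v - zp p), 1:]) (s - b)) 0))"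
proof -
  have "fps_nth (Polynomial.coeff ([:fps_X, -1:] ^ M * R) s) l = (\<Sum>b\<le>s. of_nat (M choose b) * (-1) ^ b * of_bool (l = M - b) * fps_nth (Polynomial.coeff R (s - b)) 0)"
    if M: "s \<le> M" and R: "\<And>j l. l > 0 \<Longrightarrow> fps_nth (Polynomial.coeff R j) l = 0" for M and R :: "complex fps poly"
  proof -
    have c: "Polynomial.coeff R j = fps_const (fps_nth (Polynomial.coeff R j) 0)" for j using R by (auto simp: fps_eq_iff)
    have "fps_nth (Polynomial.coeff ([:fps_X, -1:] ^ M * R) s) l = (\<Sum>b\<le>s. fps_nth (Polynomial.coeff ([:fps_X, -1:] ^ M) b * Polynomial.coeff R (s - b)) l)"
      by (simp add: coeff_mult fps_sum_nth)
    also have "\<dots> = (\<Sum>b\<le>s. of_nat (M choose b) * (-1) ^ b * of_bool (l = M - b) * fps_nth (Polynomial.coeff R (s - b)) 0)"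
    proof (intro sum.cong refl, goal_cases)
      case (1 b)
      then have "Polynomial.coeff ([:fps_X, -1 :: complex fps:] ^ M) b = of_nat (M choose b) * (-1) ^ b * fps_X ^ (M - b)"
        using M by (intro coeff_linear_poly_power) auto
      also have "\<dots> = fps_const (of_nat (M choose b) * (-1) ^ b) * fps_X ^ (M - b)"
      proof -
        have "(-1 :: complex fps) ^ b = fps_const ((-1) ^ b)"
          by (cases "even b") (auto simp: fps_eq_iff)
        then show ?thesis by (simp only: fps_of_nat[symmetric] fps_const_mult)
      qed
      finally show ?case by (subst c) (simp add: fps_X_power_nth)
    qed
    finally show ?thesis .
  qed
  then show ?thesis
    unfolding green_poly_def coeff_sum fps_sum_nth
    by (intro sum.cong refl) (use assms finP in \<open>auto simp: coeff_prod_const_nth\<close>)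
qed

text \<open>A term of \<open>(fps_X - e) ^ (N - 1 + card I)\<close> with \<open>b\<close> factors
  \<open>e\<close> has order \<open>N - 1 + card I - b\<close> in \<open>fps_X\<close>. With
  \<open>b \<le> N - 1 - i\<close> this is at least \<open>i + card I\<close>, and order
  \<open>i\<close> is reached only for \<open>I = {}\<close> and
  \<open>b = N - 1 - i\<close>.\<close>

lemma coeff_green_poly_low:
  assumes "i < N"
  shows "l < i \<Longrightarrow> fps_nth (Polynomial.coeff (green_poly x \<kappa>) (N - 1 - i)) l = 0"
    and "fps_nth (Polynomial.coeff (green_poly x \<kappa>) (N - 1 - i)) i
      = of_nat (N - 1 choose i) * (-1) ^ (N - 1 - i) / fact (N - 1) * (\<Prod>p\<in>P. v - zp p) * x \<kappa>"
proof -
  let ?s = "N - 1 - i"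
  have s: "?s < N" using assms by simp
  show "fps_nth (Polynomial.coeff (green_poly x \<kappa>) ?s) l = 0" if "l < i"
    unfolding coeff_green_poly_nth[OF s]
  proof (intro sum.neutral ballI, goal_cases)
    case (1 I)
    have "\<not> l = N - 1 + card I - b" if "b \<le> ?s" for b using that \<open>l < i\<close> assms by linarith
    then show ?case by (simp add: sum.neutral)
  qed
  let ?h = "\<lambda>I. 1 / fact (N - 1 + card I) * symmetrize I x \<kappa> * (\<Sum>b\<le>?s. of_nat (N - 1 + card I choose b) * (-1) ^ b
        * of_bool (i = N - 1 + card I - b) * fps_nth (Polynomial.coeff (\<Prod>p\<in>P - I. [:fps_const (v - zp p), 1:]) (?s - b)) 0)"
  have "?h I = 0" if "I \<in> Pow P - {{}}" for I
  proof -
    have "card I > 0" using that finP by (auto simp: card_gt_0_iff intro: finite_subset)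
    then have "\<not> i = N - 1 + card I - b" if "b \<le> ?s" for b using that assms by linarith
    then have "(\<Sum>b\<le>?s. of_nat (N - 1 + card I choose b) * (-1) ^ b
        * of_bool (i = N - 1 + card I - b) * fps_nth (Polynomial.coeff (\<Prod>p\<in>P - I. [:fps_const (v - zp p), 1:]) (?s - b)) 0) = 0"
      by (intro sum.neutral ballI) auto
    then show ?thesis by simp
  qed
  then have "fps_nth (Polynomial.coeff (green_poly x \<kappa>) ?s) i = ?h {}"
    unfolding coeff_green_poly_nth[OF s] by (subst sum.mono_neutral_right[of "Pow P" "{{}}"]) (use finP in auto)
  also have "\<dots> = 1 / fact (N - 1) * x \<kappa> * (\<Sum>b\<in>{?s}. of_nat (N - 1 choose b) * (-1) ^ b
        * of_bool (i = N - 1 - b) * fps_nth (Polynomial.coeff (\<Prod>p\<in>P. [:fps_const (v - zp p), 1:]) (?s - b)) 0)"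
  proof -
    have "(\<Sum>b\<le>?s. of_nat (N - 1 choose b) * (-1) ^ b
        * of_bool (i = N - 1 - b) * fps_nth (Polynomial.coeff (\<Prod>p\<in>P. [:fps_const (v - zp p), 1:]) (?s - b)) 0)
      = (\<Sum>b\<in>{?s}. of_nat (N - 1 choose b) * (-1) ^ b
        * of_bool (i = N - 1 - b) * fps_nth (Polynomial.coeff (\<Prod>p\<in>P. [:fps_const (v - zp p), 1:]) (?s - b)) 0)"
      by (rule sum.mono_neutral_right) (use assms in auto)
    then show ?thesis by (simp add: symmetrize_def)
  qed
  also have "Polynomial.coeff (\<Prod>p\<in>P. [:fps_const (v - zp p), 1:]) (?s - ?s) = fps_const (\<Prod>p\<in>P. v - zp p)"
  proof -
    have "poly (\<Prod>p\<in>P. [:fps_const (v - zp p), 1:]) 0 = (\<Prod>p\<in>P. fps_const (v - zp p))"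
      by (simp add: poly_prod)
    also have "\<dots> = fps_const (\<Prod>p\<in>P. v - zp p)"
      using finP by (induction P rule: finite_induct) auto
    finally show ?thesis by (simp add: poly_0_coeff_0)
  qed
  then have "1 / fact (N - 1) * x \<kappa> * (\<Sum>b\<in>{?s}. of_nat (N - 1 choose b) * (-1) ^ b
        * of_bool (i = N - 1 - b) * fps_nth (Polynomial.coeff (\<Prod>p\<in>P. [:fps_const (v - zp p), 1:]) (?s - b)) 0)
     = of_nat (N - 1 choose ?s) * (-1) ^ ?s / fact (N - 1) * (\<Prod>p\<in>P. v - zp p) * x \<kappa>"
    using assms by simp
  also have "N - 1 choose ?s = N - 1 choose i" using assms by (intro binomial_symmetric[symmetric]) simp
  finally show "fps_nth (Polynomial.coeff (green_poly x \<kappa>) ?s) i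
      = of_nat (N - 1 choose i) * (-1) ^ (N - 1 - i) / fact (N - 1) * (\<Prod>p\<in>P. v - zp p) * x \<kappa>" .
qed

lemma coeff_green_poly_high:
  assumes "s < N" "l \<ge> N + card P"
  shows "fps_nth (Polynomial.coeff (green_poly x \<kappa>) s) l = 0"
  unfolding coeff_green_poly_nth[OF assms(1)]
proof (intro sum.neutral ballI, goal_cases)
  case (1 I)
  then have "card I \<le> card P" using finP by (auto intro: card_mono)
  then have "\<not> l = N - 1 + card I - b" for b using assms N by linarith
  then show ?case by simp
qed

text \<open>The scalar in front of \<open>x\<close> is nonzero because the base point
  \<open>v\<close> avoids all \<open>zp p\<close>, so it can be divided out in advance.\<close>

lemma polynomial_solution_leading:
  assumes "i < N"
  obtains F where "polynomial_solution N P v zp F" "\<And>\<kappa> l. l < i \<Longrightarrow> fps_nth (F \<kappa>) l = 0" "\<And>\<kappa>. fps_nth (F \<kappa>) i = x \<kappa>"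
proof -
  define c where "c = of_nat (N - 1 choose i) * (-1) ^ (N - 1 - i) / fact (N - 1) * (\<Prod>p\<in>P. v - zp p)"
  have c: "c \<noteq> 0" using assms zp finP unfolding c_def by auto
  let ?F = "\<lambda>\<kappa>. Polynomial.coeff (green_poly (\<lambda>\<kappa>. x \<kappa> / c) \<kappa>) (N - 1 - i)"
  have "polynomial_solution N P v zp ?F" unfolding polynomial_solution_def
    using Dpos_coeff_green_poly coeff_green_poly_high[of "N - 1 - i"] N by auto
  moreover have "fps_nth (?F \<kappa>) i = x \<kappa>" for \<kappa>
    unfolding coeff_green_poly_low(2)[OF assms] c_def[symmetric] using c by simp
  ultimately show ?thesis using that[of ?F] coeff_green_poly_low(1)[OF assms] by blast
qed

lemma polynomial_solution_add:
  assumes "polynomial_solution N P v zp F" "polynomial_solution N P v zp G"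
  shows "polynomial_solution N P v zp (\<lambda>\<kappa>. F \<kappa> + G \<kappa>)"
  using assms by (simp add: polynomial_solution_def row_det_pos_X_add)

text \<open>The system is triangular: the solution added at stage \<open>m\<close> vanishes to order
  \<open>m\<close> and leaves the earlier coefficients alone.\<close>

lemma polynomial_solution_exists:
  obtains F where "polynomial_solution N P v zp F" "\<And>\<kappa> i. i < N \<Longrightarrow> fps_nth (F \<kappa>) i = x i \<kappa>"
proof -
  have "\<exists>F. polynomial_solution N P v zp F \<and> (\<forall>\<kappa>. \<forall>i<m. fps_nth (F \<kappa>) i = x i \<kappa>)" if "m \<le> N" for m
    using that
  proof (induction m)
    case 0
    then show ?case using polynomial_solution_leading[of 0] N by force
  next
    case (Suc m)
    then obtain F where F: "polynomial_solution N P v zp F" "\<And>\<kappa> i. i < m \<Longrightarrow> fps_nth (F \<kappa>) i = x i \<kappa>" by auto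
    obtain G where G: "polynomial_solution N P v zp G" "\<And>\<kappa> l. l < m \<Longrightarrow> fps_nth (G \<kappa>) l = 0"
        "\<And>\<kappa>. fps_nth (G \<kappa>) m = x m \<kappa> - fps_nth (F \<kappa>) m"
      using polynomial_solution_leading[of m "\<lambda>\<kappa>. x m \<kappa> - fps_nth (F \<kappa>) m"] Suc.prems by auto
    show ?case
      by (rule exI[of _ "\<lambda>\<kappa>. F \<kappa> + G \<kappa>"])
         (use F G polynomial_solution_add in \<open>auto simp: less_Suc_eq\<close>)
  qed
  from this[of N] that show ?thesis by auto
qed

text \<open>In the form with antisymmetrizers the operator consists of scalar series, derivatives
  and permutations of positions, and the diagonal action commutes with all of these.\<close>

lemma Dpos_gl_commute:
  assumes \<kappa>: "\<kappa> ` P \<subseteq> {1..N}" and b: "b \<in> {1..N}"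
  shows "Dpos (\<lambda>\<kappa>. \<Sum>p\<in>P. of_bool (\<kappa> p = a) * F (\<kappa>(p := b))) \<kappa>
    = (\<Sum>p\<in>P. of_bool (\<kappa> p = a) * Dpos F (\<kappa>(p := b)))"
proof -
  let ?d = "\<lambda>J. fps_deriv ^^ (N - card J)"
  have alt: "alternize J (\<lambda>\<kappa>. \<Sum>p\<in>P. of_bool (\<kappa> p = a) * G (\<kappa>(p := b))) \<kappa>
     = (\<Sum>p\<in>P. of_bool (\<kappa> p = a) * alternize J G (\<kappa>(p := b)))" if J: "J \<subseteq> P" for J and G :: "('p \<Rightarrow> nat) \<Rightarrow> complex fps"
  proof -
    have "(\<Sum>p\<in>P. of_bool ((\<kappa> \<circ> \<pi>) p = a) * G ((\<kappa> \<circ> \<pi>)(p := b)))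
      = (\<Sum>p\<in>P. of_bool (\<kappa> p = a) * G (\<kappa>(p := b) \<circ> \<pi>))" if "\<pi> permutes J" for \<pi>
    proof -
      have \<pi>: "\<pi> permutes P" using that J by (rule permutes_subset)
      have "(\<Sum>p\<in>P. of_bool (\<kappa> p = a) * G (\<kappa>(p := b) \<circ> \<pi>)) = (\<Sum>p\<in>P. of_bool (\<kappa> (\<pi> p) = a) * G (\<kappa>(\<pi> p := b) \<circ> \<pi>))"
        by (rule sum.permute[OF \<pi>, unfolded o_def])
      moreover have "\<kappa>(\<pi> p := b) \<circ> \<pi> = (\<kappa> \<circ> \<pi>)(p := b)" for p
        using permutes_inj[OF \<pi>] by (auto simp: fun_eq_iff inj_eq)
      ultimately show ?thesis by simp
    qed
    then have "alternize J (\<lambda>\<kappa>. \<Sum>p\<in>P. of_bool (\<kappa> p = a) * G (\<kappa>(p := b))) \<kappa>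
       = (\<Sum>\<pi> | \<pi> permutes J. of_int (sign \<pi>) * (\<Sum>p\<in>P. of_bool (\<kappa> p = a) * G (\<kappa>(p := b) \<circ> \<pi>)))"
      unfolding alternize_def by (intro sum.cong refl) auto
    also have "\<dots> = (\<Sum>p\<in>P. of_bool (\<kappa> p = a) * alternize J G (\<kappa>(p := b)))"
      unfolding sum_distrib_left alternize_def by (subst sum.swap) (simp only: mult.left_commute)
    finally show ?thesis .
  qed
  have der: "?d J (\<Sum>p\<in>P. of_bool (\<kappa> p = a) * F (\<kappa>(p := b))) = (\<Sum>p\<in>P. of_bool (\<kappa> p = a) * ?d J (F (\<kappa>(p := b))))" for J \<kappa>
    unfolding funpow_fps_deriv_sum by (intro sum.cong refl) (simp add: funpow_fps_deriv_mult_const mult.commute[of "of_bool _"])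
  have good: "\<kappa>(p := b) ` P \<subseteq> {1..N}" for p using \<kappa> b by auto
  have "Dpos (\<lambda>\<kappa>. \<Sum>p\<in>P. of_bool (\<kappa> p = a) * F (\<kappa>(p := b))) \<kappa>
    = (\<Sum>J\<in>Pow P. (-1) ^ card J * prod (rxi v zp) J * (\<Sum>p\<in>P. of_bool (\<kappa> p = a) * alternize J (\<lambda>\<kappa>. ?d J (F \<kappa>)) (\<kappa>(p := b))))"
    unfolding Dpos_alternize[OF \<kappa>] der
  proof (intro sum.cong refl, goal_cases)
    case (1 J)
    show ?case by (subst alt) (use 1 in auto)
  qed
  also have "\<dots> = (\<Sum>p\<in>P. of_bool (\<kappa> p = a) * Dpos F (\<kappa>(p := b)))"
    unfolding Dpos_alternize[OF good] sum_distrib_left by (subst sum.swap) (simp only: mult.left_commute)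
  finally show ?thesis .
qed

end

subsection \<open>Highest weight modules\<close>

definition fsc :: "complex \<Rightarrow> ('k \<Rightarrow> complex) \<Rightarrow> 'k \<Rightarrow> complex" where
  "fsc c x = (\<lambda>k. c * x k)"

global_interpretation fv: vector_space "fsc :: complex \<Rightarrow> ('k \<Rightarrow> complex) \<Rightarrow> 'k \<Rightarrow> complex"
  by unfold_locales (simp_all add: fsc_def fun_eq_iff algebra_simps)

global_interpretation fp: vector_space_pair "fsc :: complex \<Rightarrow> ('k \<Rightarrow> complex) \<Rightarrow> 'k \<Rightarrow> complex"
    "fsc :: complex \<Rightarrow> ('l \<Rightarrow> complex) \<Rightarrow> 'l \<Rightarrow> complex"
  by unfold_locales

abbreviation flinear :: "(('k \<Rightarrow> complex) \<Rightarrow> 'l \<Rightarrow> complex) \<Rightarrow> bool" where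
  "flinear \<equiv> Vector_Spaces.linear fsc fsc"

lemma flinearI:
  "(\<And>x y. f (x + y) = f x + f y) \<Longrightarrow> (\<And>c x. f (fsc c x) = fsc c (f x)) \<Longrightarrow> flinear f"
  by unfold_locales

locale gl_ops =
  fixes N :: nat and e :: "nat \<Rightarrow> nat \<Rightarrow> ('q \<Rightarrow> complex) \<Rightarrow> 'q \<Rightarrow> complex"
  assumes lin: "\<And>a b. a \<in> {1..N} \<Longrightarrow> b \<in> {1..N} \<Longrightarrow> flinear (e a b)"
    and comm: "\<And>a b c f x. a \<in> {1..N} \<Longrightarrow> b \<in> {1..N} \<Longrightarrow> c \<in> {1..N} \<Longrightarrow> f \<in> {1..N} \<Longrightarrow>
      e a b (e c f x) - e c f (e a b x) = (if b = c then e a f x else 0) - (if f = a then e c b x else 0)"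
begin

lemma e_add: "a \<in> {1..N} \<Longrightarrow> b \<in> {1..N} \<Longrightarrow> e a b (x + y) = e a b x + e a b y"
  using fp.linear_add[OF lin] by blast

lemma e_scale: "a \<in> {1..N} \<Longrightarrow> b \<in> {1..N} \<Longrightarrow> e a b (fsc c x) = fsc c (e a b x)"
  using fp.linear_scale[OF lin] by blast

lemma e_swap:
  assumes "a \<in> {1..N}" "b \<in> {1..N}" "c \<in> {1..N}" "f \<in> {1..N}"
  shows "e a b (e c f x) = e c f (e a b x) + (if b = c then e a f x else 0) - (if f = a then e c b x else 0)"
  using comm[OF assms, of x] by (simp add: algebra_simps)

text \<open>Only lowering operators are included, although the set is stable under all generators if
  \<open>\<omega>\<close> is a highest weight vector. In this form an induction shows that
  \<open>rho\<close> drops strictly away from \<open>\<omega>\<close>.\<close>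

inductive_set low :: "('q \<Rightarrow> complex) \<Rightarrow> ('q \<Rightarrow> complex) set" for \<omega> where
  base: "\<omega> \<in> low \<omega>"
| add: "x \<in> low \<omega> \<Longrightarrow> y \<in> low \<omega> \<Longrightarrow> x + y \<in> low \<omega>"
| scale: "x \<in> low \<omega> \<Longrightarrow> fsc c x \<in> low \<omega>"
| lower: "x \<in> low \<omega> \<Longrightarrow> a \<in> {1..N} \<Longrightarrow> b \<in> {1..N} \<Longrightarrow> b < a \<Longrightarrow> e a b x \<in> low \<omega>"

lemma zero_in_low: "0 \<in> low \<omega>"
proof -
  have "fsc 0 \<omega> = 0" by (simp add: fsc_def fun_eq_iff)
  then show ?thesis using low.scale[OF low.base, of 0] by simp
qed

lemma subspace_low: "fv.subspace (low \<omega>)"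
  by (auto simp: fv.subspace_def zero_in_low low.add low.scale)

text \<open>A single operator whose eigenvalue drops by \<open>c - f\<close> under a lowering
  \<open>e c f\<close>; it replaces the bookkeeping of full weights.\<close>

definition rho :: "('q \<Rightarrow> complex) \<Rightarrow> 'q \<Rightarrow> complex" where
  "rho x = (\<Sum>a\<in>{1..N}. fsc (of_nat (N - a)) (e a a x))"

lemma flinear_rho: "flinear rho"
  by (rule flinearI)
     (simp_all add: rho_def e_add e_scale fv.scale_right_distrib sum.distrib fv.scale_sum_right mult.commute)

lemma rho_e:
  assumes c: "c \<in> {1..N}" "f \<in> {1..N}"
  shows "rho (e c f x) = e c f (rho x) + fsc (of_nat f - of_nat c) (e c f x)"
proof -
  have ne: "of_nat (N - a) = (of_nat N - of_nat a :: complex)" if "a \<in> {1..N}" for a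
    using that by (simp add: of_nat_diff)
  have "rho (e c f x) = (\<Sum>a\<in>{1..N}. fsc (of_nat (N - a)) (e c f (e a a x)) + (if a = c then fsc (of_nat (N - a)) (e c f x) else 0)
      - (if a = f then fsc (of_nat (N - a)) (e c f x) else 0))"
    unfolding rho_def
  proof (intro sum.cong refl, goal_cases)
    case (1 a)
    have "e a a (e c f x) = e c f (e a a x) + (if a = c then e a f x else 0) - (if f = a then e c a x else 0)"
      using 1 c by (intro e_swap)
    then show ?case by (auto simp: fv.scale_right_distrib fv.scale_right_diff_distrib)
  qed
  also have "\<dots> = (\<Sum>a\<in>{1..N}. fsc (of_nat (N - a)) (e c f (e a a x))) + fsc (of_nat (N - c)) (e c f x) - fsc (of_nat (N - f)) (e c f x)"
    using c by (simp add: sum.distrib sum_subtractf)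
  also have "(\<Sum>a\<in>{1..N}. fsc (of_nat (N - a)) (e c f (e a a x))) = e c f (rho x)"
    unfolding rho_def by (simp add: fp.linear_sum[OF lin[OF c]] e_scale[OF c])
  finally show ?thesis using c by (simp add: ne fsc_def fun_eq_iff algebra_simps)
qed

definition eig :: "complex \<Rightarrow> ('q \<Rightarrow> complex) set" where
  "eig r = {x. rho x = fsc r x}"

definition lower_span :: "complex \<Rightarrow> ('q \<Rightarrow> complex) set" where
  "lower_span r = fv.span (\<Union>i\<in>{1..}. eig (r - of_nat i))"

text \<open>The product of \<open>rho - (r - j)\<close> over \<open>j\<close> from 1 to
  \<open>m\<close>. For large \<open>m\<close> it kills a given vector of
  \<open>lower_span r\<close>, while on \<open>eig r\<close> it is multiplication by
  \<open>fact m\<close>; so the two spaces meet only in 0.\<close>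

fun kill :: "complex \<Rightarrow> nat \<Rightarrow> ('q \<Rightarrow> complex) \<Rightarrow> 'q \<Rightarrow> complex" where
  "kill r 0 x = x"
| "kill r (Suc m) x = rho (kill r m x) - fsc (r - of_nat (Suc m)) (kill r m x)"

lemma kill_lincomb: "kill r m (fsc c x + y) = fsc c (kill r m x) + kill r m y"
proof (induction m)
  case (Suc m)
  have "rho (fsc c (kill r m x) + kill r m y) = fsc c (rho (kill r m x)) + rho (kill r m y)"
    by (simp only: fp.linear_add[OF flinear_rho] fp.linear_scale[OF flinear_rho])
  then show ?case
    by (simp only: kill.simps Suc.IH) (simp add: fsc_def fun_eq_iff algebra_simps)
qed simp

lemma kill_eig: "rho x = fsc s x \<Longrightarrow> kill r m x = fsc (\<Prod>j\<in>{1..m}. s - r + of_nat j) x"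
proof (induction m)
  case (Suc m)
  then have "kill r (Suc m) x = fsc (\<Prod>j\<in>{1..m}. s - r + of_nat j) (fsc s x) - fsc (r - of_nat (Suc m)) (fsc (\<Prod>j\<in>{1..m}. s - r + of_nat j) x)"
    by (simp add: fp.linear_scale[OF flinear_rho] del: of_nat_Suc)
  then show ?case by (simp add: fsc_def fun_eq_iff algebra_simps)
qed simp

lemma kill_mono: "kill r m x = 0 \<Longrightarrow> m \<le> M \<Longrightarrow> kill r M x = 0"
  by (induction M) (auto simp: le_Suc_eq fp.linear_0[OF flinear_rho])

lemma kill_lower_span: "x \<in> lower_span r \<Longrightarrow> \<exists>m. kill r m x = 0"
  unfolding lower_span_def
proof (induction rule: fv.span_induct_alt)
  case base
  then show ?case by (rule exI[of _ 0]) simp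
next
  case (step c x y)
  then obtain i m where i: "i \<ge> 1" "rho x = fsc (r - of_nat i) x" and m: "kill r m y = 0"
    unfolding eig_def by blast
  have "kill r (max i m) x = 0" unfolding kill_eig[OF i(2)] using i(1) by (auto simp: fsc_def fun_eq_iff)
  then have "kill r (max i m) (fsc c x + y) = 0" unfolding kill_lincomb using kill_mono[OF m, of "max i m"] by simp
  then show ?case by blast
qed

lemma eig_lower_span_eq_0:
  assumes "x \<in> lower_span r" "x \<in> eig r"
  shows "x = 0"
proof -
  obtain m where "kill r m x = 0" using kill_lower_span[OF assms(1)] by blast
  moreover have "kill r m x = fsc (\<Prod>j\<in>{1..m}. of_nat j) x" using kill_eig[of x r r m] assms(2) by (simp add: eig_def)
  ultimately have "fsc (\<Prod>j\<in>{1..m}. of_nat j) x = 0" by simp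
  moreover have "(\<Prod>j\<in>{1..m}. of_nat j :: complex) \<noteq> 0" by simp
  ultimately show ?thesis using fv.scale_eq_0_iff by blast
qed

lemma e_lower_span:
  assumes a: "a \<in> {1..N}" "b \<in> {1..N}" "b < a" and x: "x \<in> lower_span r"
  shows "e a b x \<in> lower_span r"
proof -
  let ?E = "\<Union>i\<in>{1..}. eig (r - of_nat i)"
  have "e a b ` ?E \<subseteq> ?E"
  proof (rule image_subsetI)
    fix x assume "x \<in> ?E"
    then obtain i where i: "i \<in> {1..}" "x \<in> eig (r - of_nat i)" by blast
    then have "rho (e a b x) = fsc (r - of_nat i) (e a b x) + fsc (of_nat b - of_nat a) (e a b x)"
      using rho_e[OF a(1,2)] e_scale[OF a(1,2)] by (simp add: eig_def)
    also have "\<dots> = fsc (r - of_nat (i + (a - b))) (e a b x)"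
      using a(3) by (simp add: fsc_def fun_eq_iff algebra_simps of_nat_diff)
    finally have "e a b x \<in> eig (r - of_nat (i + (a - b)))" unfolding eig_def by blast
    moreover have "i + (a - b) \<in> {1..}" using i by simp
    ultimately show "e a b x \<in> ?E" by blast
  qed
  then have "fv.span (e a b ` ?E) \<subseteq> fv.span ?E" by (rule fv.span_mono)
  moreover have "e a b x \<in> e a b ` fv.span ?E" using x by (auto simp: lower_span_def)
  ultimately show ?thesis unfolding fp.linear_span_image[OF lin[OF a(1,2)], symmetric] lower_span_def by blast
qed

definition highest_weight :: "(nat \<Rightarrow> complex) \<Rightarrow> ('q \<Rightarrow> complex) \<Rightarrow> bool" where
  "highest_weight \<Lambda> \<omega> \<longleftrightarrow> (\<forall>a\<in>{1..N}. e a a \<omega> = fsc (\<Lambda> a) \<omega>) \<and> (\<forall>a\<in>{1..N}. \<forall>b\<in>{1..N}. a < b \<longrightarrow> e a b \<omega> = 0)"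

text \<open>A generator is commuted past the last lowering operator. The commutator consists of
  generators applied to the shorter word, and the induction hypothesis covers all generators at
  once.\<close>

lemma low_stable:
  assumes hw: "highest_weight \<Lambda> \<omega>" and x: "x \<in> low \<omega>" and a: "a \<in> {1..N}" "b \<in> {1..N}"
  shows "e a b x \<in> low \<omega>"
  using x a
proof (induction arbitrary: a b)
  case base
  consider "a = b" | "a < b" | "b < a" by linarith
  then show ?case
  proof cases
    case 1
    then have "e a b \<omega> = fsc (\<Lambda> a) \<omega>" using hw base unfolding highest_weight_def by blast
    then show ?thesis by (simp only: low.base low.scale)
  next
    case 2
    then have "e a b \<omega> = 0" using hw base unfolding highest_weight_def by blast
    then show ?thesis by (simp only: zero_in_low)
  next
    case 3
    then show ?thesis using base by (intro low.lower low.base)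
  qed
next
  case (add x y)
  then show ?case by (simp only: e_add low.add)
next
  case (scale x c)
  then show ?case by (simp only: e_scale low.scale)
next
  case (lower x c f)
  have "e c f (e a b x) \<in> low \<omega>" by (rule low.lower[OF lower.IH[OF lower.prems] lower.hyps(2-4)])
  moreover have "(if b = c then e a f x else 0) \<in> low \<omega>" "(if f = a then e c b x else 0) \<in> low \<omega>"
    using lower.IH[OF lower.prems(1) lower.hyps(3)] lower.IH[OF lower.hyps(2) lower.prems(2)]
    by (simp_all only: zero_in_low simp_thms split: if_split)
  ultimately have "e c f (e a b x) + (if b = c then e a f x else 0) - (if f = a then e c b x else 0) \<in> low \<omega>"
    using subspace_low fv.subspace_add fv.subspace_diff by blast
  then show ?case by (simp only: e_swap[OF lower.prems lower.hyps(2,3)])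
qed

lemma eig_highest_weight:
  "highest_weight \<Lambda> \<omega> \<Longrightarrow> \<omega> \<in> eig (\<Sum>a\<in>{1..N}. of_nat (N - a) * \<Lambda> a)"
  by (simp add: eig_def rho_def highest_weight_def fv.scale_sum_left)

text \<open>Lowering operators map both \<open>\<omega>\<close> and the lower span into the lower
  span, so only scalar multiples of \<open>\<omega>\<close> itself have to be split off.\<close>

lemma low_decomp:
  assumes hw: "highest_weight \<Lambda> \<omega>" and x: "x \<in> low \<omega>"
  shows "\<exists>c. x - fsc c \<omega> \<in> lower_span (\<Sum>a\<in>{1..N}. of_nat (N - a) * \<Lambda> a)"
  using x
proof induction
  case base
  have "\<omega> - fsc 1 \<omega> = 0" by (simp add: fsc_def fun_eq_iff)
  then have "\<omega> - fsc 1 \<omega> \<in> lower_span (\<Sum>a\<in>{1..N}. of_nat (N - a) * \<Lambda> a)"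
    unfolding lower_span_def by (simp only: fv.span_zero)
  then show ?case by blast
next
  case (add x y)
  then obtain c c' where "x - fsc c \<omega> \<in> lower_span (\<Sum>a\<in>{1..N}. of_nat (N - a) * \<Lambda> a)"
     "y - fsc c' \<omega> \<in> lower_span (\<Sum>a\<in>{1..N}. of_nat (N - a) * \<Lambda> a)" by blast
  then have "x - fsc c \<omega> + (y - fsc c' \<omega>) \<in> lower_span (\<Sum>a\<in>{1..N}. of_nat (N - a) * \<Lambda> a)"
    unfolding lower_span_def by (rule fv.span_add)
  moreover have "x - fsc c \<omega> + (y - fsc c' \<omega>) = x + y - fsc (c + c') \<omega>" by (simp add: fsc_def fun_eq_iff algebra_simps)
  ultimately show ?case by metis
next
  case (scale x c)
  then obtain c' where "x - fsc c' \<omega> \<in> lower_span (\<Sum>a\<in>{1..N}. of_nat (N - a) * \<Lambda> a)" by blast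
  then have "fsc c (x - fsc c' \<omega>) \<in> lower_span (\<Sum>a\<in>{1..N}. of_nat (N - a) * \<Lambda> a)"
    unfolding lower_span_def by (rule fv.span_scale)
  moreover have "fsc c (x - fsc c' \<omega>) = fsc c x - fsc (c * c') \<omega>" by (simp add: fsc_def fun_eq_iff algebra_simps)
  ultimately show ?case by metis
next
  case (lower x a b)
  let ?r = "\<Sum>a\<in>{1..N}. of_nat (N - a) * \<Lambda> a"
  obtain c where c: "x - fsc c \<omega> \<in> lower_span ?r" using lower.IH by blast
  have "rho (e a b \<omega>) = fsc (?r - of_nat (a - b)) (e a b \<omega>)"
  proof -
    have "e a b (rho \<omega>) = fsc ?r (e a b \<omega>)"
      using eig_highest_weight[OF hw] e_scale[OF lower.hyps(2,3)] unfolding eig_def by simp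
    then have "rho (e a b \<omega>) = fsc ?r (e a b \<omega>) + fsc (of_nat b - of_nat a) (e a b \<omega>)"
      using rho_e[OF lower.hyps(2,3), of \<omega>] by simp
    also have "\<dots> = fsc (?r - of_nat (a - b)) (e a b \<omega>)"
      using lower.hyps(4) by (simp only: fv.scale_left_distrib[symmetric] of_nat_diff[OF less_imp_le]) simp
    finally show ?thesis .
  qed
  then have "e a b \<omega> \<in> lower_span ?r"
    unfolding lower_span_def using lower.hyps(4)
    by (intro fv.span_base UN_I[of "a - b"]) (simp_all add: eig_def)
  moreover have "e a b (x - fsc c \<omega>) \<in> lower_span ?r" using c lower.hyps by (intro e_lower_span)
  ultimately have "e a b (x - fsc c \<omega>) + fsc c (e a b \<omega>) \<in> lower_span ?r"
    unfolding lower_span_def by (intro fv.span_add fv.span_scale)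
  moreover have "e a b (x - fsc c \<omega>) + fsc c (e a b \<omega>) = e a b x"
    using fp.linear_diff[OF lin[OF lower.hyps(2,3)]] e_scale[OF lower.hyps(2,3)] by simp
  ultimately show ?case by (intro exI[of _ 0]) simp
qed

text \<open>The top eigenspace of \<open>rho\<close> on the submodule is the line through
  \<open>\<omega>\<close>. This excludes a second, independent highest weight vector of the same
  weight in the graph of the quotient map.\<close>

lemma low_eig:
  assumes hw: "highest_weight \<Lambda> \<omega>" and x: "x \<in> low \<omega>" and "x \<in> eig (\<Sum>a\<in>{1..N}. of_nat (N - a) * \<Lambda> a)"
  shows "\<exists>c. x = fsc c \<omega>"
proof -
  let ?r = "\<Sum>a\<in>{1..N}. of_nat (N - a) * \<Lambda> a"
  obtain c where c: "x - fsc c \<omega> \<in> lower_span ?r" using low_decomp[OF hw x] by blast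
  have "rho (x - fsc c \<omega>) = fsc ?r (x - fsc c \<omega>)"
    using assms(3) eig_highest_weight[OF hw] fp.linear_diff[OF flinear_rho] fp.linear_scale[OF flinear_rho]
    by (simp add: eig_def fv.scale_right_diff_distrib mult.commute)
  then have "x - fsc c \<omega> = 0" using eig_lower_span_eq_0[OF c] by (simp add: eig_def)
  then show ?thesis by auto
qed

end

subsection \<open>The module of functions on colourings\<close>

definition color_gl :: "'p set \<Rightarrow> nat \<Rightarrow> nat \<Rightarrow> (('p \<Rightarrow> nat) \<Rightarrow> complex) \<Rightarrow> ('p \<Rightarrow> nat) \<Rightarrow> complex" where
  "color_gl P a b x \<kappa> = (\<Sum>p\<in>P. of_bool (\<kappa> p = a) * x (\<kappa>(p := b)))"

lemma flinear_color_gl: "flinear (color_gl P a b)"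
  by (rule flinearI) (simp_all add: color_gl_def fsc_def fun_eq_iff algebra_simps sum.distrib sum_distrib_left)

text \<open>Generators at different positions commute, so the sums over pairs of distinct positions
  cancel and only products at one position remain.\<close>

lemma color_gl_comm:
  assumes "finite P"
  shows "color_gl P a b (color_gl P c f x) \<kappa> - color_gl P c f (color_gl P a b x) \<kappa>
    = of_bool (b = c) * color_gl P a f x \<kappa> - of_bool (f = a) * color_gl P c b x \<kappa>"
proof -
  have *: "color_gl P a b (color_gl P c f x) \<kappa> = of_bool (b = c) * color_gl P a f x \<kappa>
     + (\<Sum>p\<in>P. \<Sum>q\<in>P - {p}. of_bool (\<kappa> p = a) * of_bool (\<kappa> q = c) * x (\<kappa>(p := b, q := f)))" for a b c f
  proof -
    have "color_gl P a b (color_gl P c f x) \<kappa>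
       = (\<Sum>p\<in>P. of_bool (\<kappa> p = a) * (\<Sum>q\<in>P. of_bool ((\<kappa>(p := b)) q = c) * x (\<kappa>(p := b, q := f))))"
      by (simp only: color_gl_def)
    also have "\<dots> = (\<Sum>p\<in>P. of_bool (\<kappa> p = a) * (of_bool (b = c) * x (\<kappa>(p := f))
         + (\<Sum>q\<in>P - {p}. of_bool (\<kappa> q = c) * x (\<kappa>(p := b, q := f)))))"
    proof (intro sum.cong refl arg_cong2[where f = "(*)"], goal_cases)
      case (1 p)
      show ?case by (subst sum.remove[OF assms 1]) (auto intro!: sum.cong)
    qed
    also have "\<dots> = of_bool (b = c) * color_gl P a f x \<kappa>
     + (\<Sum>p\<in>P. \<Sum>q\<in>P - {p}. of_bool (\<kappa> p = a) * of_bool (\<kappa> q = c) * x (\<kappa>(p := b, q := f)))"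
      by (simp only: color_gl_def distrib_left sum.distrib sum_distrib_left mult_ac)
    finally show ?thesis .
  qed
  have "(\<Sum>p\<in>P. \<Sum>q\<in>P - {p}. of_bool (\<kappa> p = a) * of_bool (\<kappa> q = c) * x (\<kappa>(p := b, q := f)))
     = (\<Sum>p\<in>P. \<Sum>q\<in>P. if p = q then 0 else of_bool (\<kappa> p = a) * of_bool (\<kappa> q = c) * x (\<kappa>(p := b, q := f)))"
    using assms by (intro sum.cong refl sum.mono_neutral_cong_left) auto
  also have "\<dots> = (\<Sum>q\<in>P. \<Sum>p\<in>P. if p = q then 0 else of_bool (\<kappa> p = a) * of_bool (\<kappa> q = c) * x (\<kappa>(p := b, q := f)))"
    by (rule sum.swap)
  also have "\<dots> = (\<Sum>q\<in>P. \<Sum>p\<in>P - {q}. of_bool (\<kappa> q = c) * of_bool (\<kappa> p = a) * x (\<kappa>(q := f, p := b)))"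
    using assms by (intro sum.cong refl sum.mono_neutral_cong_right) (auto simp: fun_upd_twist)
  finally show ?thesis unfolding * by simp
qed

text \<open>
  The cells \<open>(a, c)\<close> of a Young diagram with rows \<open>a\<close> and columns \<open>c\<close>. The vector that assigns
  to each cell its row is antisymmetrized along the columns.
\<close>

definition cells :: "nat \<Rightarrow> (nat \<Rightarrow> nat) \<Rightarrow> (nat \<times> nat) set" where
  "cells N \<mu> = Sigma {1..N} (\<lambda>a. {..<\<mu> a})"

definition row_color :: "nat \<Rightarrow> (nat \<Rightarrow> nat) \<Rightarrow> nat \<times> nat \<Rightarrow> nat" where
  "row_color N \<mu> = restrict fst (cells N \<mu>)"

definition col_perms :: "nat \<Rightarrow> (nat \<Rightarrow> nat) \<Rightarrow> (nat \<times> nat \<Rightarrow> nat \<times> nat) set" where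
  "col_perms N \<mu> = {\<pi>. \<pi> permutes cells N \<mu> \<and> snd \<circ> \<pi> = snd}"

definition col_alt :: "nat \<Rightarrow> (nat \<Rightarrow> nat) \<Rightarrow> (nat \<times> nat \<Rightarrow> nat) \<Rightarrow> complex" where
  "col_alt N \<mu> \<kappa> = (\<Sum>\<pi>\<in>col_perms N \<mu>. of_int (sign \<pi>) * of_bool (\<kappa> \<circ> \<pi> = row_color N \<mu>))"

lemma col_perms_snd: "\<pi> \<in> col_perms N \<mu> \<Longrightarrow> snd (\<pi> p) = snd p"
  by (metis (mono_tags) col_perms_def comp_apply mem_Collect_eq)

lemma finite_cells [simp]: "finite (cells N \<mu>)"
  by (simp add: cells_def)

lemma finite_col_perms: "finite (col_perms N \<mu>)"
  by (rule finite_subset[OF _ finite_permutations[OF finite_cells]]) (auto simp: col_perms_def)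

lemma col_alt_support:
  assumes "col_alt N \<mu> \<kappa> \<noteq> 0"
  shows "\<kappa> \<in> cells N \<mu> \<rightarrow>\<^sub>E {1..N}"
proof -
  obtain \<pi> where \<pi>: "\<pi> permutes cells N \<mu>" "\<kappa> \<circ> \<pi> = row_color N \<mu>"
    using assms unfolding col_alt_def col_perms_def by (auto elim!: sum.not_neutral_contains_not_neutral)
  have k: "\<kappa> p = row_color N \<mu> (Hilbert_Choice.inv \<pi> p)" for p
    by (simp add: permutes_inverses[OF \<pi>(1)] flip: \<pi>(2))
  show ?thesis
  proof (rule PiE_I)
    fix p assume "p \<in> cells N \<mu>"
    then have "Hilbert_Choice.inv \<pi> p \<in> cells N \<mu>" using permutes_in_image[OF permutes_inv[OF \<pi>(1)]] by blast
    then show "\<kappa> p \<in> {1..N}" by (auto simp: k row_color_def cells_def)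
  next
    fix p assume "p \<notin> cells N \<mu>"
    then have "Hilbert_Choice.inv \<pi> p \<notin> cells N \<mu>" using permutes_in_image[OF permutes_inv[OF \<pi>(1)]] by blast
    then show "\<kappa> p = undefined" by (simp add: k row_color_def)
  qed
qed

text \<open>This shows that \<open>col_alt\<close> is nonzero. A permutation that preserves the
  column of every cell and also its row is the identity, so a single term contributes.\<close>

lemma col_alt_row_color: "col_alt N \<mu> (row_color N \<mu>) = 1"
proof -
  have "row_color N \<mu> \<circ> \<pi> = row_color N \<mu> \<longleftrightarrow> \<pi> = id" if "\<pi> \<in> col_perms N \<mu>" for \<pi>
  proof
    assume *: "row_color N \<mu> \<circ> \<pi> = row_color N \<mu>"
    have "\<pi> p = p" for p
    proof (cases "p \<in> cells N \<mu>")
      case True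
      then have "\<pi> p \<in> cells N \<mu>" using that permutes_in_image by (fastforce simp: col_perms_def)
      then have "fst (\<pi> p) = fst p" using True fun_cong[OF *, of p] by (simp add: row_color_def)
      moreover have "snd (\<pi> p) = snd p" using that by (rule col_perms_snd)
      ultimately show ?thesis by (simp add: prod_eq_iff)
    next
      case False
      then show ?thesis using that permutes_not_in by (fastforce simp: col_perms_def)
    qed
    then show "\<pi> = id" by auto
  qed simp
  then have "col_alt N \<mu> (row_color N \<mu>) = (\<Sum>\<pi>\<in>col_perms N \<mu>. if \<pi> = id then 1 else 0)"
    unfolding col_alt_def by (intro sum.cong refl) auto
  also have "\<dots> = 1" using finite_col_perms[of N \<mu>] by (simp add: col_perms_def)
  finally show ?thesis .
qed

text \<open>The diagonal action commutes with permutations of cells, so it can act on the row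
  colouring itself, where it changes the colour of one cell of row \<open>b\<close> to
  \<open>a\<close>.\<close>

lemma color_gl_col_alt:
  "color_gl (cells N \<mu>) a b (col_alt N \<mu>) \<kappa>
    = (\<Sum>p\<in>{p \<in> cells N \<mu>. fst p = b}. \<Sum>\<pi>\<in>col_perms N \<mu>. of_int (sign \<pi>) * of_bool (\<kappa> \<circ> \<pi> = (row_color N \<mu>)(p := a)))"
proof -
  let ?P = "cells N \<mu>" and ?C = "col_perms N \<mu>" and ?r = "row_color N \<mu>"
  have "color_gl ?P a b (col_alt N \<mu>) \<kappa> = (\<Sum>\<pi>\<in>?C. of_int (sign \<pi>) * (\<Sum>p\<in>?P. of_bool (\<kappa> p = a \<and> \<kappa>(p := b) \<circ> \<pi> = ?r)))"
    unfolding color_gl_def col_alt_def sum_distrib_left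
    by (subst sum.swap) (intro sum.cong refl, simp add: of_bool_conj mult.left_commute)
  also have "\<dots> = (\<Sum>\<pi>\<in>?C. of_int (sign \<pi>) * (\<Sum>p\<in>?P. of_bool (fst p = b \<and> \<kappa> \<circ> \<pi> = ?r(p := a))))"
  proof (rule sum.cong[OF refl], rule arg_cong2[where f = "(*)", OF refl], goal_cases)
    case (1 \<pi>)
    then have \<pi>: "\<pi> permutes ?P" by (simp add: col_perms_def)
    have "(\<Sum>p\<in>?P. of_bool (\<kappa> p = a \<and> \<kappa>(p := b) \<circ> \<pi> = ?r)) = (\<Sum>p\<in>?P. of_bool (\<kappa> (\<pi> p) = a \<and> \<kappa>(\<pi> p := b) \<circ> \<pi> = ?r) :: complex)"
      by (rule sum.permute[OF \<pi>, unfolded o_def])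
    also have "\<dots> = (\<Sum>p\<in>?P. of_bool (fst p = b \<and> \<kappa> \<circ> \<pi> = ?r(p := a)))"
    proof (intro sum.cong refl arg_cong[where f = of_bool], goal_cases)
      case (1 p)
      have "\<kappa>(\<pi> p := b) \<circ> \<pi> = (\<kappa> \<circ> \<pi>)(p := b)"
        using permutes_inj[OF \<pi>] by (auto simp: fun_eq_iff inj_eq)
      moreover have "g p = a \<and> g(p := b) = ?r \<longleftrightarrow> fst p = b \<and> g = ?r(p := a)" for g
      proof -
        have "?r p = fst p" using 1 by (simp add: row_color_def)
        then show ?thesis by (metis fun_upd_same fun_upd_triv fun_upd_upd)
      qed
      ultimately show ?case using \<open>p \<in> ?P\<close> by (metis comp_apply)
    qed
    finally show ?case .
  qed
  also have "\<dots> = (\<Sum>p\<in>?P. of_bool (fst p = b) * (\<Sum>\<pi>\<in>?C. of_int (sign \<pi>) * of_bool (\<kappa> \<circ> \<pi> = ?r(p := a))))"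
    unfolding sum_distrib_left by (subst sum.swap) (simp add: of_bool_conj mult.left_commute)
  also have "\<dots> = (\<Sum>p\<in>{p \<in> ?P. fst p = b}. \<Sum>\<pi>\<in>?C. of_int (sign \<pi>) * of_bool (\<kappa> \<circ> \<pi> = ?r(p := a)))"
    by (rule sum.mono_neutral_cong_right) auto
  finally show ?thesis .
qed

lemma color_gl_col_alt_diag:
  assumes "a \<in> {1..N}"
  shows "color_gl (cells N \<mu>) a a (col_alt N \<mu>) \<kappa> = of_nat (\<mu> a) * col_alt N \<mu> \<kappa>"
proof -
  have "(row_color N \<mu>)(p := a) = row_color N \<mu>" if "p \<in> {p \<in> cells N \<mu>. fst p = a}" for p
  proof -
    have "row_color N \<mu> p = a" using that by (simp add: row_color_def)
    then show ?thesis by (metis fun_upd_triv)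
  qed
  then have "color_gl (cells N \<mu>) a a (col_alt N \<mu>) \<kappa> = (\<Sum>p\<in>{p \<in> cells N \<mu>. fst p = a}. col_alt N \<mu> \<kappa>)"
    unfolding color_gl_col_alt col_alt_def by (intro sum.cong refl) auto
  also have "{p \<in> cells N \<mu>. fst p = a} = {a} \<times> {..<\<mu> a}" using assms by (auto simp: cells_def)
  finally show ?thesis by simp
qed

text \<open>After the cell \<open>(b, c)\<close> is recoloured, it has the same colour as
  \<open>(a, c)\<close>, which exists since row \<open>a\<close> is not shorter than row
  \<open>b\<close>. Both lie in one column, so the antisymmetrization vanishes.\<close>

lemma color_gl_col_alt_raise:
  assumes a: "a \<in> {1..N}" "a < b" and mono: "\<mu> b \<le> \<mu> a"
  shows "color_gl (cells N \<mu>) a b (col_alt N \<mu>) \<kappa> = 0"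
  unfolding color_gl_col_alt
proof (rule sum.neutral, rule ballI)
  fix p assume "p \<in> {p \<in> cells N \<mu>. fst p = b}"
  then obtain c where p: "p = (b, c)" "p \<in> cells N \<mu>" by (cases p) auto
  let ?C = "col_perms N \<mu>" and ?r = "(row_color N \<mu>)(p := a)"
  let ?q = "(a, c)" let ?t = "Transposition.transpose p ?q"
  have q: "?q \<in> cells N \<mu>" "p \<noteq> ?q" using p a mono by (auto simp: cells_def)
  have rt: "?r \<circ> ?t = ?r" using p q by (auto simp: fun_eq_iff Transposition.transpose_def row_color_def)
  have t: "?t permutes cells N \<mu>" using p q by (intro permutes_swap_id)
  have st: "snd \<circ> ?t = snd" by (auto simp: Transposition.transpose_def p fun_eq_iff)
  have st': "snd \<circ> (\<pi> \<circ> ?t) = snd" if "snd \<circ> \<pi> = snd" for \<pi>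
    by (simp only: o_assoc that st)
  have iff: "\<kappa> \<circ> (\<pi> \<circ> ?t) = ?r \<longleftrightarrow> \<kappa> \<circ> \<pi> = ?r" for \<pi>
  proof
    assume "\<kappa> \<circ> (\<pi> \<circ> ?t) = ?r"
    then have "\<kappa> \<circ> (\<pi> \<circ> ?t) \<circ> ?t = ?r" using rt by simp
    then show "\<kappa> \<circ> \<pi> = ?r" by (simp add: o_assoc[symmetric])
  next
    assume "\<kappa> \<circ> \<pi> = ?r"
    then show "\<kappa> \<circ> (\<pi> \<circ> ?t) = ?r" using rt by (simp add: o_assoc)
  qed
  have "(\<Sum>\<pi>\<in>?C. of_int (sign \<pi>) * of_bool (\<kappa> \<circ> \<pi> = ?r)) = (\<Sum>\<pi>\<in>?C. of_int (sign (\<pi> \<circ> ?t)) * of_bool (\<kappa> \<circ> (\<pi> \<circ> ?t) = ?r) :: complex)"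
    by (rule sum.reindex_bij_witness[of _ "\<lambda>\<pi>. \<pi> \<circ> ?t" "\<lambda>\<pi>. \<pi> \<circ> ?t"])
       (use t st' in \<open>auto simp: col_perms_def o_assoc[symmetric] simp del: split_paired_All intro: permutes_compose\<close>)
  also have "\<dots> = - (\<Sum>\<pi>\<in>?C. of_int (sign \<pi>) * of_bool (\<kappa> \<circ> \<pi> = ?r))"
    unfolding sum_negf[symmetric] iff
  proof (intro sum.cong refl, goal_cases)
    case (1 \<pi>)
    then have "permutation \<pi>" by (auto simp: col_perms_def intro: permutes_imp_permutation[OF finite_cells])
    then show ?case using q(2) by (simp add: sign_compose permutation_swap_id sign_swap_id)
  qed
  finally show "(\<Sum>\<pi>\<in>?C. of_int (sign \<pi>) * of_bool (\<kappa> \<circ> \<pi> = ?r)) = (0 :: complex)"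
    by (simp add: eq_neg_iff_add_eq_0 flip: mult_2)
qed

section \<open>Matrix modules as spaces of functions, and direct sums\<close>

definition mat_op :: "nat \<Rightarrow> complex mat \<Rightarrow> (nat \<Rightarrow> complex) \<Rightarrow> nat \<Rightarrow> complex" where
  "mat_op d A y i = (if i < d then \<Sum>c<d. A $$ (i, c) * y c else 0)"

lemma flinear_mat_op: "flinear (mat_op d A)"
  by (rule flinearI) (simp_all add: mat_op_def fsc_def fun_eq_iff algebra_simps sum.distrib sum_distrib_left)

lemma mat_op_mult:
  assumes "A \<in> carrier_mat d d" "B \<in> carrier_mat d d"
  shows "mat_op d A (mat_op d B y) = mat_op d (A * B) y"
proof
  fix i
  have "(A * B) $$ (i, l) = (\<Sum>k<d. A $$ (i, k) * B $$ (k, l))" if "i < d" "l < d" for l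
    using assms that by (simp add: scalar_prod_def lessThan_atLeast0)
  then show "mat_op d A (mat_op d B y) i = mat_op d (A * B) y i"
    unfolding mat_op_def
    by (auto simp: sum_distrib_left sum_distrib_right mult.assoc intro: sum.swap)
qed

lemma mat_op_minus:
  assumes "A \<in> carrier_mat d d" "B \<in> carrier_mat d d"
  shows "mat_op d (A - B) y i = mat_op d A y i - mat_op d B y i"
  using assms by (simp add: mat_op_def left_diff_distrib sum_subtractf)

lemma mat_op_zero: "mat_op d (0\<^sub>m d d) y i = 0"
  by (simp add: mat_op_def)

lemma mat_op_comm:
  assumes "gl_module N d E" and abcf: "a \<in> {1..N}" "b \<in> {1..N}" "c \<in> {1..N}" "f \<in> {1..N}"
  shows "mat_op d (E a b) (mat_op d (E c f) y) i - mat_op d (E c f) (mat_op d (E a b) y) i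
    = of_bool (b = c) * mat_op d (E a f) y i - of_bool (f = a) * mat_op d (E c b) y i"
proof -
  have E: "E a b \<in> carrier_mat d d" if "a \<in> {1..N}" "b \<in> {1..N}" for a b
    using assms that by (simp add: gl_module_def)
  have "E a b * E c f - E c f * E a b = (if b = c then E a f else 0\<^sub>m d d) - (if f = a then E c b else 0\<^sub>m d d)"
    using assms unfolding gl_module_def by blast
  then have "mat_op d (E a b * E c f - E c f * E a b) y i
      = mat_op d ((if b = c then E a f else 0\<^sub>m d d) - (if f = a then E c b else 0\<^sub>m d d)) y i" by simp
  moreover have "mat_op d (E a b * E c f - E c f * E a b) y i = mat_op d (E a b * E c f) y i - mat_op d (E c f * E a b) y i"
    by (intro mat_op_minus mult_carrier_mat[of _ d d _ d] E abcf)
  moreover have "mat_op d ((if b = c then E a f else 0\<^sub>m d d) - (if f = a then E c b else 0\<^sub>m d d)) y i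
     = mat_op d (if b = c then E a f else 0\<^sub>m d d) y i - mat_op d (if f = a then E c b else 0\<^sub>m d d) y i"
    by (rule mat_op_minus) (use E abcf in auto)
  ultimately show ?thesis
    using E abcf by (auto simp: mat_op_mult mat_op_zero)
qed

lemma vec_mat_op:
  assumes "A \<in> carrier_mat d d"
  shows "A *\<^sub>v Matrix.vec d y = Matrix.vec d (mat_op d A y)"
  using assms by (intro eq_vecI) (auto simp: mat_op_def scalar_prod_def lessThan_atLeast0)

text \<open>A direct sum of two function spaces is the space of functions on the disjoint union of
  the index sets, so that \<open>gl_ops\<close> applies to it unchanged.\<close>

definition sum_op ::
    "(('k \<Rightarrow> complex) \<Rightarrow> 'k \<Rightarrow> complex) \<Rightarrow> (('l \<Rightarrow> complex) \<Rightarrow> 'l \<Rightarrow> complex) \<Rightarrow> ('k + 'l \<Rightarrow> complex) \<Rightarrow> 'k + 'l \<Rightarrow> complex"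
  where "sum_op f g x = case_sum (f (x \<circ> Inl)) (g (x \<circ> Inr))"

lemma plus_comp: "(x + y) \<circ> h = (x \<circ> h) + (y \<circ> h)" for x y :: "'a \<Rightarrow> complex"
  by (simp add: fun_eq_iff)

lemma fsc_comp: "fsc c x \<circ> h = fsc c (x \<circ> h)"
  by (simp add: fun_eq_iff fsc_def)

lemma sum_op_Inl: "sum_op f g x (Inl k) = f (x \<circ> Inl) k" and sum_op_Inr: "sum_op f g x (Inr l) = g (x \<circ> Inr) l"
  by (simp_all add: sum_op_def)

lemma sum_op_comp: "sum_op f g x \<circ> Inl = f (x \<circ> Inl)" "sum_op f g x \<circ> Inr = g (x \<circ> Inr)"
  by (simp_all add: sum_op_def fun_eq_iff)

lemma sum_fun_eqI: "x \<circ> Inl = y \<circ> Inl \<Longrightarrow> x \<circ> Inr = y \<circ> Inr \<Longrightarrow> x = y"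
proof
  fix k assume "x \<circ> Inl = y \<circ> Inl" "x \<circ> Inr = y \<circ> Inr"
  then show "x k = y k" by (cases k) (simp_all add: fun_eq_iff)
qed

lemma flinear_sum_op: "flinear f \<Longrightarrow> flinear g \<Longrightarrow> flinear (sum_op f g)"
  by (intro flinearI sum_fun_eqI)
     (simp_all only: sum_op_comp plus_comp fsc_comp fp.linear_add fp.linear_scale)

text \<open>With last entry zero, a dominant weight is a partition, the shape of the Young diagram
  to be filled.\<close>

lemma nat_weights:
  assumes "1 \<le> N" "integral_dominant N \<Lambda>" "\<Lambda> N = 0"
  obtains \<mu> :: "nat \<Rightarrow> nat" where "\<And>a. a \<in> {1..N} \<Longrightarrow> \<Lambda> a = of_nat (\<mu> a)"
    "\<And>a b. a \<in> {1..N} \<Longrightarrow> b \<in> {1..N} \<Longrightarrow> a < b \<Longrightarrow> \<mu> b \<le> \<mu> a"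
proof -
  have step: "\<exists>k::nat. \<Lambda> a = \<Lambda> (Suc a) + of_nat k" if "a \<in> {1..<N}" for a
  proof -
    have "\<Lambda> a - \<Lambda> (a + 1) \<in> \<nat>" using assms(2) that by (simp add: integral_dominant_def)
    then show ?thesis by (auto elim!: Nats_cases simp: algebra_simps)
  qed
  have nat: "\<exists>k::nat. \<Lambda> a = of_nat k" if "1 \<le> a" "a \<le> N" for a
    using that(2,1)
  proof (induction rule: inc_induct)
    case base
    then show ?case using assms(3) by (intro exI[of _ 0]) simp
  next
    case (step a)
    then obtain k l where "\<Lambda> (Suc a) = of_nat k" "\<Lambda> a = \<Lambda> (Suc a) + of_nat l"
      using \<open>\<And>a. a \<in> {1..<N} \<Longrightarrow> _ a\<close>[of a] by auto
    then show ?case by (intro exI[of _ "k + l"]) simp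
  qed
  then obtain \<mu> where \<mu>: "\<And>a. a \<in> {1..N} \<Longrightarrow> \<Lambda> a = of_nat (\<mu> a)"
    by (metis atLeastAtMost_iff)
  have "\<mu> b \<le> \<mu> a" if "a < b" "1 \<le> a" "b \<le> N" for a b
    using that
  proof (induction rule: strict_inc_induct)
    case (base i)
    then obtain k where "\<Lambda> i = \<Lambda> (Suc i) + of_nat k" using step[of i] by auto
    then have "(of_nat (\<mu> i) :: complex) = of_nat (\<mu> (Suc i) + k)" using \<mu>[of i] \<mu>[of "Suc i"] base by simp
    then have "\<mu> i = \<mu> (Suc i) + k" by (simp only: of_nat_eq_iff)
    then show ?case using base by simp
  next
    case (step i)
    then obtain k where "\<Lambda> i = \<Lambda> (Suc i) + of_nat k" using \<open>\<And>a. a \<in> {1..<N} \<Longrightarrow> \<exists>k. _ a k\<close>[of i] by auto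
    then have "(of_nat (\<mu> i) :: complex) = of_nat (\<mu> (Suc i) + k)" using \<mu>[of i] \<mu>[of "Suc i"] step by simp
    then have "\<mu> i = \<mu> (Suc i) + k" by (simp only: of_nat_eq_iff)
    then show ?case using step by simp
  qed
  then show ?thesis using that[of \<mu>] \<mu> by auto
qed

text \<open>Irreducibility is carried over from vectors to functions; the vanishing beyond
  \<open>d\<close> makes a function in \<open>Y\<close> determined by its vector.\<close>

lemma irreducible_cases:
  assumes "gl_irreducible N d E" and Y: "fv.subspace Y" "\<And>a b y. a \<in> {1..N} \<Longrightarrow> b \<in> {1..N} \<Longrightarrow> y \<in> Y \<Longrightarrow> mat_op d (E a b) y \<in> Y"
    and supp: "\<And>y i. y \<in> Y \<Longrightarrow> d \<le> i \<Longrightarrow> y i = 0"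
  shows "Y = {0} \<or> (\<forall>y. (\<forall>i\<ge>d. y i = 0) \<longrightarrow> y \<in> Y)"
proof -
  let ?W = "Matrix.vec d ` Y"
  have E: "E a b \<in> carrier_mat d d" if "a \<in> {1..N}" "b \<in> {1..N}" for a b
    using assms that by (simp add: gl_irreducible_def gl_module_def)
  have "gl_submodule N d E ?W"
    unfolding gl_submodule_def
  proof (intro conjI ballI allI)
    show "?W \<subseteq> carrier_vec d" by auto
    have "Matrix.vec d 0 \<in> ?W" using fv.subspace_0[OF Y(1)] by blast
    moreover have "Matrix.vec d 0 = (0\<^sub>v d :: complex vec)" by (intro eq_vecI) simp_all
    ultimately show "0\<^sub>v d \<in> ?W" by simp
  next
    fix x x' assume "x \<in> ?W" "x' \<in> ?W"
    then obtain y y' where y: "x = Matrix.vec d y" "y \<in> Y" "x' = Matrix.vec d y'" "y' \<in> Y" by blast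
    have "Matrix.vec d (y + y') \<in> ?W" using fv.subspace_add[OF Y(1)] y by blast
    moreover have "Matrix.vec d (y + y') = x + x'" by (intro eq_vecI) (simp_all add: y)
    ultimately show "x + x' \<in> ?W" by simp
  next
    fix c x assume "x \<in> ?W"
    then obtain y where y: "x = Matrix.vec d y" "y \<in> Y" by blast
    have "Matrix.vec d (fsc c y) \<in> ?W" using fv.subspace_scale[OF Y(1)] y by blast
    moreover have "Matrix.vec d (fsc c y) = c \<cdot>\<^sub>v x" by (intro eq_vecI) (simp_all add: y fsc_def)
    ultimately show "c \<cdot>\<^sub>v x \<in> ?W" by simp
  next
    fix a b x assume ab: "a \<in> {1..N}" "b \<in> {1..N}" and "x \<in> ?W"
    then obtain y where y: "x = Matrix.vec d y" "y \<in> Y" by blast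
    then show "E a b *\<^sub>v x \<in> ?W" using Y(2)[OF ab] vec_mat_op[OF E[OF ab]] by (metis image_eqI)
  qed
  then consider "?W = {0\<^sub>v d}" | "?W = carrier_vec d"
    using assms(1) unfolding gl_irreducible_def by blast
  then show ?thesis
  proof cases
    case 1
    have "y = 0" if "y \<in> Y" for y
    proof
      fix i
      have "Matrix.vec d y = 0\<^sub>v d" using 1 that by blast
      then have "i < d \<Longrightarrow> y i = 0" by (metis index_vec index_zero_vec(1))
      then show "y i = 0 i" using supp[OF that, of i] by (cases "i < d") simp_all
    qed
    then show ?thesis using fv.subspace_0[OF Y(1)] by blast
  next
    case 2
    have "y \<in> Y" if y: "\<forall>i\<ge>d. y i = 0" for y
    proof -
      have "Matrix.vec d y \<in> ?W" unfolding 2 by simp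
      then obtain y' where y': "y' \<in> Y" "Matrix.vec d y = Matrix.vec d y'" by blast
      have "y i = y' i" for i
      proof (cases "i < d")
        case True
        then show ?thesis using y'(2) by (metis index_vec)
      next
        case False
        then show ?thesis using y supp[OF y'(1), of i] by simp
      qed
      then have "y = y'" by (rule ext)
      then show ?thesis using y'(1) by simp
    qed
    then show ?thesis by blast
  qed
qed

text \<open>
  The graph of the quotient map from the submodule generated by \<open>col_alt\<close> onto \<open>M\<^sub>\<Lambda>\<close> is the
  submodule generated by the pair of the two highest weight vectors. It is a graph because it meets
  \<open>0 \<times> M\<^sub>\<Lambda>\<close> in a submodule of \<open>M\<^sub>\<Lambda>\<close> that does not contain the highest weight vector.
\<close>

lemma factor_model:
  assumes N: "1 \<le> N" and dom: "integral_dominant N \<Lambda>" and \<Lambda>N: "\<Lambda> N = 0" and M: "is_M N \<Lambda> d E"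
  obtains P :: "(nat \<times> nat) set" and T :: "((nat \<times> nat \<Rightarrow> nat) \<Rightarrow> complex) set"
    and \<psi> :: "((nat \<times> nat \<Rightarrow> nat) \<Rightarrow> complex) \<Rightarrow> nat \<Rightarrow> complex"
  where "finite P" "flinear \<psi>"
    "\<And>t a b. t \<in> T \<Longrightarrow> a \<in> {1..N} \<Longrightarrow> b \<in> {1..N} \<Longrightarrow> color_gl P a b t \<in> T"
    "\<And>t \<kappa>. t \<in> T \<Longrightarrow> \<kappa> \<notin> P \<rightarrow>\<^sub>E {1..N} \<Longrightarrow> t \<kappa> = 0"
    "\<And>t a b. t \<in> T \<Longrightarrow> a \<in> {1..N} \<Longrightarrow> b \<in> {1..N} \<Longrightarrow> \<psi> (color_gl P a b t) = mat_op d (E a b) (\<psi> t)"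
    "\<And>i. i < d \<Longrightarrow> \<exists>t\<in>T. \<psi> t = (\<lambda>k. of_bool (k = i))"
proof -
  obtain \<mu> where \<mu>: "\<And>a. a \<in> {1..N} \<Longrightarrow> \<Lambda> a = of_nat (\<mu> a)"
    "\<And>a b. a \<in> {1..N} \<Longrightarrow> b \<in> {1..N} \<Longrightarrow> a < b \<Longrightarrow> \<mu> b \<le> \<mu> a"
    using nat_weights[OF N dom \<Lambda>N] by blast
  define P where "P = cells N \<mu>"
  have finP: "finite P" by (simp add: P_def)
  have irr: "gl_irreducible N d E" and glm: "gl_module N d E" and "has_highest_weight N d E \<Lambda>"
    using M by (auto simp: is_M_def gl_irreducible_def)
  then obtain v where v: "v \<in> carrier_vec d" "v \<noteq> 0\<^sub>v d" "\<And>a. a \<in> {1..N} \<Longrightarrow> E a a *\<^sub>v v = \<Lambda> a \<cdot>\<^sub>v v"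
    "\<And>a b. a \<in> {1..N} \<Longrightarrow> b \<in> {1..N} \<Longrightarrow> a < b \<Longrightarrow> E a b *\<^sub>v v = 0\<^sub>v d"
    unfolding has_highest_weight_def by blast
  have E: "E a b \<in> carrier_mat d d" if "a \<in> {1..N}" "b \<in> {1..N}" for a b
    using glm that by (simp add: gl_module_def)
  define v' where "v' = (\<lambda>i. if i < d then vec_index v i else 0)"
  have vv': "Matrix.vec d v' = v" using v(1) by (intro eq_vecI) (auto simp: v'_def)
  have mv: "mat_op d (E a b) v' i = (if i < d then vec_index (E a b *\<^sub>v v) i else 0)" if "a \<in> {1..N}" "b \<in> {1..N}" for a b i
    using arg_cong[OF vec_mat_op[OF E[OF that], of v'], of "\<lambda>w. vec_index w i"] by (simp add: vv' mat_op_def)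
  define w where "w = col_alt N \<mu>"
  define \<omega> where "\<omega> = case_sum w v'"
  have \<omega>I: "\<omega> \<circ> Inl = w" "\<omega> \<circ> Inr = v'" by (simp_all add: \<omega>_def fun_eq_iff)
  let ?e = "\<lambda>a b. sum_op (color_gl P a b) (mat_op d (E a b))"
  interpret S: gl_ops N ?e
  proof (rule gl_ops.intro)
    show "flinear (?e a b)" if "a \<in> {1..N}" "b \<in> {1..N}" for a b
      by (intro flinear_sum_op flinear_color_gl flinear_mat_op)
  next
    fix a b c f x assume abcf: "a \<in> {1..N}" "b \<in> {1..N}" "c \<in> {1..N}" "f \<in> {1..N}"
    show "?e a b (?e c f x) - ?e c f (?e a b x) = (if b = c then ?e a f x else 0) - (if f = a then ?e c b x else 0)"
    proof
      fix k
      show "(?e a b (?e c f x) - ?e c f (?e a b x)) k = ((if b = c then ?e a f x else 0) - (if f = a then ?e c b x else 0)) k"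
      proof (cases k)
        case (Inl \<kappa>)
        then show ?thesis using color_gl_comm[OF finP, of a b c f "x \<circ> Inl" \<kappa>]
          by (auto simp: sum_op_Inl sum_op_comp)
      next
        case (Inr i)
        then show ?thesis using mat_op_comm[OF glm abcf, of "x \<circ> Inr" i]
          by (auto simp: sum_op_Inr sum_op_comp)
      qed
    qed
  qed
  have hw: "S.highest_weight \<Lambda> \<omega>"
    unfolding S.highest_weight_def
  proof (intro conjI ballI impI)
    fix a assume a: "a \<in> {1..N}"
    show "?e a a \<omega> = fsc (\<Lambda> a) \<omega>"
    proof (rule sum_fun_eqI)
      show "?e a a \<omega> \<circ> Inl = fsc (\<Lambda> a) \<omega> \<circ> Inl"
        unfolding sum_op_comp fsc_comp \<omega>I w_def P_def
        by (rule ext) (simp add: color_gl_col_alt_diag[OF a] \<mu>(1)[OF a] fsc_def)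
      show "?e a a \<omega> \<circ> Inr = fsc (\<Lambda> a) \<omega> \<circ> Inr"
        unfolding sum_op_comp fsc_comp \<omega>I
        by (rule ext, simp only: mv[OF a a] v(3)[OF a] fsc_def) (use v(1) in \<open>simp add: v'_def\<close>)
    qed
  next
    fix a b assume ab: "a \<in> {1..N}" "b \<in> {1..N}" "a < b"
    show "?e a b \<omega> = 0"
    proof (rule sum_fun_eqI)
      show "?e a b \<omega> \<circ> Inl = 0 \<circ> Inl"
        unfolding sum_op_comp \<omega>I w_def P_def
        by (rule ext) (simp add: color_gl_col_alt_raise[OF ab(1,3) \<mu>(2)[OF ab]])
      show "?e a b \<omega> \<circ> Inr = 0 \<circ> Inr"
        unfolding sum_op_comp \<omega>I
        by (rule ext) (simp add: mv[OF ab(1,2)] v(4)[OF ab])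
    qed
  qed
  let ?G = "S.low \<omega>"
  have suppM: "x (Inr i) = 0" if "x \<in> ?G" "d \<le> i" for x i
    using that(1)
  proof induction
    case base
    then show ?case using that(2) by (simp add: \<omega>_def v'_def)
  next
    case (lower x a b)
    then show ?case using that(2) by (simp add: sum_op_Inr mat_op_def)
  qed (simp_all add: fsc_def)
  have suppT: "x (Inl \<kappa>) = 0" if "x \<in> ?G" "\<kappa> \<notin> P \<rightarrow>\<^sub>E {1..N}" for x \<kappa>
    using that
  proof (induction arbitrary: \<kappa>)
    case base
    then show ?case using col_alt_support[of N \<mu> \<kappa>] by (auto simp: \<omega>_def w_def P_def)
  next
    case (lower x a b)
    have "of_bool (\<kappa> p = a) * x (Inl (\<kappa>(p := b))) = 0" if "p \<in> P" for p
    proof (cases "\<kappa> p = a")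
      case True
      \<comment> \<open>If the recoloured function were a colouring, then \<open>\<kappa>\<close>
        would be one too, as its colour at \<open>p\<close> is \<open>a\<close>.\<close>
      then have "\<kappa>(p := b) \<notin> P \<rightarrow>\<^sub>E {1..N}"
        using lower.prems lower.hyps(2) that fun_upd_triv[of \<kappa> p] PiE_fun_upd[of a "\<lambda>_. {1..N}" p "\<kappa>(p := b)" P]
        by (auto simp: insert_absorb)
      then have "x (Inl (\<kappa>(p := b))) = 0" by (rule lower.IH)
      then show ?thesis by (simp only: mult_zero_right)
    qed simp
    then have "(\<Sum>p\<in>P. of_bool (\<kappa> p = a) * x (Inl (\<kappa>(p := b)))) = 0" by (intro sum.neutral ballI)
    then show ?case by (simp only: sum_op_Inl color_gl_def o_apply)
  qed (simp_all add: fsc_def)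
  have w0: "w \<noteq> 0"
    using col_alt_row_color[of N \<mu>] by (auto simp: w_def)
  have v0: "v' \<noteq> 0"
  proof
    assume "v' = 0"
    then have "Matrix.vec d v' = 0\<^sub>v d" by (intro eq_vecI) simp_all
    then show False using v(2) vv' by simp
  qed
  have inj0: "x = 0" if x: "x \<in> ?G" "x \<circ> Inl = 0" for x
  proof -
    let ?Y = "{y. case_sum 0 y \<in> ?G}"
    have cs_add: "case_sum 0 (y + y') = case_sum 0 y + case_sum 0 y'" for y y' :: "nat \<Rightarrow> complex"
      by (rule sum_fun_eqI) (simp_all add: fun_eq_iff)
    have cs_scale: "case_sum 0 (fsc c y) = fsc c (case_sum 0 y)" for c and y :: "nat \<Rightarrow> complex"
      by (rule sum_fun_eqI) (simp_all add: fun_eq_iff fsc_def)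
    have cs_0: "case_sum 0 0 = 0"
      by (rule sum_fun_eqI) (simp_all add: fun_eq_iff)
    have cs_e: "case_sum 0 (mat_op d (E a b) y) = ?e a b (case_sum 0 y)" for a b y
      by (rule sum_fun_eqI) (simp_all only: sum_op_comp case_sum_o_inj fp.linear_0[OF flinear_color_gl])
    have "?Y = {0} \<or> (\<forall>y. (\<forall>i\<ge>d. y i = 0) \<longrightarrow> y \<in> ?Y)"
    proof (rule irreducible_cases[OF irr])
      show "fv.subspace ?Y"
        unfolding fv.subspace_def mem_Collect_eq cs_add cs_scale cs_0
        by (intro conjI ballI allI impI S.low.add S.low.scale S.zero_in_low CollectI) (simp_all only: mem_Collect_eq)
    next
      fix a b y assume ab: "a \<in> {1..N}" "b \<in> {1..N}" "y \<in> ?Y"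
      have "?e a b (case_sum 0 y) \<in> ?G" by (rule S.low_stable[OF hw CollectD[OF ab(3)] ab(1,2)])
      then show "mat_op d (E a b) y \<in> ?Y" by (simp only: mem_Collect_eq cs_e)
    next
      fix y i assume y: "y \<in> ?Y" "d \<le> i"
      show "y i = 0" using suppM[OF CollectD[OF y(1)] y(2)] by simp
    qed
    moreover have "v' \<notin> ?Y"
    proof
      assume "v' \<in> ?Y"
      then have g: "case_sum 0 v' \<in> ?G" by (rule CollectD)
      \<comment> \<open>This vector has the top eigenvalue of \<open>rho\<close>, so it would be a
        multiple of \<open>\<omega>\<close>; but the first component of \<open>\<omega>\<close> is
        nonzero.\<close>
      have "S.rho (case_sum 0 v') = fsc (\<Sum>a\<in>{1..N}. of_nat (N - a) * \<Lambda> a) (case_sum 0 v')"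
      proof -
        have "?e a a (case_sum 0 v') = fsc (\<Lambda> a) (case_sum 0 v')" if "a \<in> {1..N}" for a
          using hw that unfolding S.highest_weight_def cs_e[symmetric] cs_scale[symmetric]
          by (metis \<omega>I(2) fsc_comp sum_op_comp(2))
        then show ?thesis unfolding S.rho_def by (simp add: fv.scale_sum_left)
      qed
      then obtain c where c: "case_sum 0 v' = fsc c \<omega>"
        using S.low_eig[OF hw g] unfolding S.eig_def by blast
      have "fsc c w = 0" using arg_cong[OF c, of "\<lambda>x. x \<circ> Inl"] unfolding fsc_comp \<omega>I by (simp add: fun_eq_iff)
      then have "c = 0" using w0 by simp
      moreover have "v' = fsc c v'" using arg_cong[OF c, of "\<lambda>x. x \<circ> Inr"] unfolding fsc_comp \<omega>I by (simp add: fun_eq_iff)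
      ultimately show False using v0 by (metis fv.scale_zero_left)
    qed
    moreover have "\<forall>i\<ge>d. v' i = 0" by (simp add: v'_def)
    ultimately have Y: "?Y = {0}" by (metis (no_types, lifting))
    have xe: "x = case_sum 0 (x \<circ> Inr)" using x(2) by (intro sum_fun_eqI) (simp_all add: fun_eq_iff)
    then have "case_sum 0 (x \<circ> Inr) \<in> ?G" using x(1) by simp
    then have "x \<circ> Inr \<in> ?Y" by (simp only: mem_Collect_eq)
    then have "x \<circ> Inr = 0" unfolding Y by (rule singletonD)
    then show ?thesis using xe cs_0 by simp
  qed
  have onto: "\<exists>x\<in>?G. x \<circ> Inr = y" if y: "\<forall>i\<ge>d. y i = 0" for y
  proof -
    let ?Y = "(\<lambda>x. x \<circ> Inr) ` ?G"
    have "?Y = {0} \<or> (\<forall>y. (\<forall>i\<ge>d. y i = 0) \<longrightarrow> y \<in> ?Y)"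
    proof (rule irreducible_cases[OF irr])
      have "flinear (\<lambda>x :: (nat \<times> nat \<Rightarrow> nat) + nat \<Rightarrow> complex. x \<circ> Inr)"
        by (rule flinearI) (simp_all only: plus_comp fsc_comp)
      then show "fv.subspace ?Y" by (rule fp.linear_subspace_image[OF _ S.subspace_low])
    next
      fix a b y assume ab: "a \<in> {1..N}" "b \<in> {1..N}" "y \<in> ?Y"
      then obtain x where x: "x \<in> ?G" "y = x \<circ> Inr" by blast
      show "mat_op d (E a b) y \<in> ?Y"
      proof (rule image_eqI)
        show "mat_op d (E a b) y = ?e a b x \<circ> Inr" by (simp only: sum_op_comp x(2))
        show "?e a b x \<in> ?G" by (rule S.low_stable[OF hw x(1) ab(1,2)])
      qed
    next
      fix y i assume "y \<in> ?Y" "d \<le> i"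
      then show "y i = 0" using suppM by force
    qed
    moreover have "v' \<in> ?Y"
    proof (rule image_eqI)
      show "v' = \<omega> \<circ> Inr" by (rule \<omega>I(2)[symmetric])
    qed (rule S.low.base)
    ultimately show ?thesis using y v0 by blast
  qed
  have linL: "flinear (\<lambda>x :: (nat \<times> nat \<Rightarrow> nat) + nat \<Rightarrow> complex. x \<circ> Inl)"
    by (rule flinearI) (simp_all only: plus_comp fsc_comp)
  have "inj_on (\<lambda>x. x \<circ> Inl) ?G"
  proof (rule inj_onI)
    fix x y assume xy: "x \<in> ?G" "y \<in> ?G" "x \<circ> Inl = y \<circ> Inl"
    have "(x - y) \<circ> Inl = 0" using xy(3) by (simp add: fun_eq_iff)
    then have "x - y = 0" using inj0 fv.subspace_diff[OF S.subspace_low xy(1,2)] by blast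
    then show "x = y" by (simp only: right_minus_eq)
  qed
  \<comment> \<open>The map \<open>\<psi>\<close> has to be linear on all functions and not just on
    the submodule, so the left inverse of the projection is taken to be linear everywhere.\<close>
  then obtain g where g: "flinear g" "\<And>x. x \<in> ?G \<Longrightarrow> g (x \<circ> Inl) = x"
    using fp.linear_exists_left_inverse_on[OF linL S.subspace_low] by blast
  define \<psi> where "\<psi> = (\<lambda>t. g t \<circ> Inr)"
  have \<psi>: "\<psi> (x \<circ> Inl) = x \<circ> Inr" if "x \<in> ?G" for x using g(2)[OF that] by (simp only: \<psi>_def)
  let ?T = "(\<lambda>x. x \<circ> Inl) ` ?G"
  show ?thesis
  proof (rule that[of P \<psi> ?T])
    show "finite P" by (rule finP)
    show "flinear \<psi>"
      unfolding \<psi>_def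
      by (rule flinearI) (simp_all only: fp.linear_add[OF g(1)] fp.linear_scale[OF g(1)] plus_comp fsc_comp)
  next
    fix t a b assume t: "t \<in> ?T" and ab: "a \<in> {1..N}" "b \<in> {1..N}"
    then obtain x where x: "x \<in> ?G" "t = x \<circ> Inl" by blast
    have ex: "?e a b x \<in> ?G" by (rule S.low_stable[OF hw x(1) ab])
    have el: "?e a b x \<circ> Inl = color_gl P a b t" by (simp only: sum_op_comp x(2))
    show "color_gl P a b t \<in> ?T"
    proof (rule image_eqI)
      show "color_gl P a b t = ?e a b x \<circ> Inl" by (rule el[symmetric])
    qed (rule ex)
    show "\<psi> (color_gl P a b t) = mat_op d (E a b) (\<psi> t)"
      using \<psi>[OF ex] unfolding el x(2) \<psi>[OF x(1)] sum_op_comp .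
  next
    fix t \<kappa> assume "t \<in> ?T" "\<kappa> \<notin> P \<rightarrow>\<^sub>E {1..N}"
    then show "t \<kappa> = 0" using suppT by force
  next
    fix i assume "i < d"
    then obtain x where "x \<in> ?G" "x \<circ> Inr = (\<lambda>k. of_bool (k = i))" using onto[of "\<lambda>k. of_bool (k = i)"] by auto
    then have "\<psi> (x \<circ> Inl) = (\<lambda>k. of_bool (k = i))" "x \<circ> Inl \<in> ?T" using \<psi>[of x] by simp_all
    then show "\<exists>t\<in>?T. \<psi> t = (\<lambda>k. of_bool (k = i))" by (rule bexI)
  qed
qed

subsection \<open>Operators on power series\<close>

definition coef :: "('k \<Rightarrow> complex fps) \<Rightarrow> nat \<Rightarrow> 'k \<Rightarrow> complex" where
  "coef F i = (\<lambda>k. fps_nth (F k) i)"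

definition lift :: "(('k \<Rightarrow> complex) \<Rightarrow> 'l \<Rightarrow> complex) \<Rightarrow> ('k \<Rightarrow> complex fps) \<Rightarrow> 'l \<Rightarrow> complex fps" where
  "lift h F = (\<lambda>k. Abs_fps (\<lambda>i. h (coef F i) k))"

text \<open>One form for both settings, functions on colourings and the given tensor product, so
  that homomorphisms between them can be applied coefficientwise. The indices of \<open>h\<close>
  are transposed as in \<open>X_op\<close>.\<close>

definition gen_X ::
    "'j set \<Rightarrow> ('j \<Rightarrow> complex fps) \<Rightarrow> ('j \<Rightarrow> nat \<Rightarrow> nat \<Rightarrow> ('k \<Rightarrow> complex) \<Rightarrow> 'k \<Rightarrow> complex)
      \<Rightarrow> nat \<Rightarrow> nat \<Rightarrow> ('k \<Rightarrow> complex fps) \<Rightarrow> 'k \<Rightarrow> complex fps" where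
  "gen_X J \<xi> h a b F = (\<lambda>k. of_bool (a = b) * fps_deriv (F k) - (\<Sum>j\<in>J. \<xi> j * lift (h j b a) F k))"

lemma coef_eqI: "(\<And>i. coef F i = coef G i) \<Longrightarrow> F = G"
  by (rule ext, rule fps_ext) (metis coef_def)

lemma coef_lift [simp]: "coef (lift h F) i = h (coef F i)"
  by (simp add: coef_def lift_def)

lemma sum_fun_apply: "(\<Sum>i\<in>A. f i) k = (\<Sum>i\<in>A. f i k)" for f :: "'a \<Rightarrow> 'k \<Rightarrow> complex"
  by (induction A rule: infinite_finite_induct) auto

lemma coef_gen_X:
  "coef (gen_X J \<xi> h a b F) i = fsc (of_bool (a = b) * of_nat (Suc i)) (coef F (Suc i))
     - (\<Sum>j\<in>J. \<Sum>l\<le>i. fsc (fps_nth (\<xi> j) (i - l)) (h j b a (coef F l)))"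
proof
  fix k
  have d: "fps_nth (of_bool (a = b) * fps_deriv (F k)) i = of_bool (a = b) * of_nat (Suc i) * fps_nth (F k) (Suc i)"
    by (cases "a = b") simp_all
  have m: "fps_nth (\<xi> j * lift (h j b a) F k) i = (\<Sum>l\<le>i. fps_nth (\<xi> j) (i - l) * h j b a (coef F l) k)" for j
  proof -
    have "fps_nth (lift (h j b a) F k * \<xi> j) i = (\<Sum>l=0..i. h j b a (coef F l) k * fps_nth (\<xi> j) (i - l))"
      by (simp add: fps_mult_nth lift_def)
    then show ?thesis by (simp add: mult.commute atLeast0AtMost)
  qed
  have s: "fps_nth (\<Sum>j\<in>J. \<xi> j * lift (h j b a) F k) i = (\<Sum>j\<in>J. \<Sum>l\<le>i. fps_nth (\<xi> j) (i - l) * h j b a (coef F l) k)"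
    by (simp only: fps_sum_nth m)
  show "coef (gen_X J \<xi> h a b F) i k = (fsc (of_bool (a = b) * of_nat (Suc i)) (coef F (Suc i))
     - (\<Sum>j\<in>J. \<Sum>l\<le>i. fsc (fps_nth (\<xi> j) (i - l)) (h j b a (coef F l)))) k"
  proof -
    have "fps_nth (gen_X J \<xi> h a b F k) i = of_bool (a = b) * of_nat (Suc i) * fps_nth (F k) (Suc i)
       - (\<Sum>j\<in>J. \<Sum>l\<le>i. fps_nth (\<xi> j) (i - l) * h j b a (coef F l) k)"
      unfolding gen_X_def fps_sub_nth d s ..
    then have "coef (gen_X J \<xi> h a b F) i k = of_bool (a = b) * of_nat (Suc i) * coef F (Suc i) k
       - (\<Sum>j\<in>J. \<Sum>l\<le>i. fps_nth (\<xi> j) (i - l) * h j b a (coef F l) k)"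
      by (simp only: coef_def[of "gen_X J \<xi> h a b F"] coef_def[of F "Suc i"])
    then show ?thesis by (simp only: minus_apply sum_fun_apply fsc_def)
  qed
qed

lemma coef_row_det:
  "coef (row_det as X F) i = (\<Sum>\<sigma> | \<sigma> permutes set as. fsc (of_int (sign \<sigma>)) (coef (foldr (\<lambda>a. X a (\<sigma> a)) as F) i))"
proof
  fix k
  have "fps_nth (of_int c * G) i = of_int c * fps_nth G i" for c and G :: "complex fps"
    by (simp add: fps_of_int[symmetric])
  then show "coef (row_det as X F) i k = (\<Sum>\<sigma> | \<sigma> permutes set as. fsc (of_int (sign \<sigma>)) (coef (foldr (\<lambda>a. X a (\<sigma> a)) as F) i)) k"
    by (simp add: coef_def row_det_def fps_sum_nth sum_fun_apply fsc_def)
qed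

lemma coef_diff: "coef (\<lambda>k. F k - G k) i = coef F i - coef G i"
  by (simp add: coef_def fun_eq_iff)

lemma gen_X_diff:
  assumes "\<And>j. j \<in> J \<Longrightarrow> flinear (h j b a)"
  shows "gen_X J \<xi> h a b (\<lambda>k. F k - G k) = (\<lambda>k. gen_X J \<xi> h a b F k - gen_X J \<xi> h a b G k)"
proof (rule coef_eqI)
  fix i
  have "(\<Sum>j\<in>J. \<Sum>l\<le>i. fsc (fps_nth (\<xi> j) (i - l)) (h j b a (coef F l - coef G l)))
     = (\<Sum>j\<in>J. \<Sum>l\<le>i. fsc (fps_nth (\<xi> j) (i - l)) (h j b a (coef F l)))
     - (\<Sum>j\<in>J. \<Sum>l\<le>i. fsc (fps_nth (\<xi> j) (i - l)) (h j b a (coef G l)))"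
    unfolding sum_subtractf[symmetric] fv.scale_right_diff_distrib[symmetric]
    by (intro sum.cong refl) (simp only: fp.linear_diff[OF assms])
  then show "coef (gen_X J \<xi> h a b (\<lambda>k. F k - G k)) i = coef (\<lambda>k. gen_X J \<xi> h a b F k - gen_X J \<xi> h a b G k) i"
    unfolding coef_diff coef_gen_X fv.scale_right_diff_distrib
    by (simp only: diff_diff_eq2 diff_diff_eq add_diff_eq diff_add_eq add_ac)
qed

lemma row_det_gen_X_diff:
  assumes "\<And>j a b. j \<in> J \<Longrightarrow> a \<in> set as \<Longrightarrow> b \<in> set as \<Longrightarrow> flinear (h j a b)"
  shows "row_det as (gen_X J \<xi> h) (\<lambda>k. F k - G k) = (\<lambda>k. row_det as (gen_X J \<xi> h) F k - row_det as (gen_X J \<xi> h) G k)"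
proof -
  have "foldr (\<lambda>a. gen_X J \<xi> h a (\<sigma> a)) bs (\<lambda>k. F k - G k)
     = (\<lambda>k. foldr (\<lambda>a. gen_X J \<xi> h a (\<sigma> a)) bs F k - foldr (\<lambda>a. gen_X J \<xi> h a (\<sigma> a)) bs G k)"
    if "set bs \<subseteq> set as" "\<sigma> permutes set as" for bs \<sigma>
    using that(1)
  proof (induction bs)
    case (Cons a bs)
    have "\<sigma> a \<in> set as" using Cons.prems permutes_in_image[OF that(2)] by simp
    then show ?case using Cons assms by (simp add: gen_X_diff)
  qed simp
  then show ?thesis by (simp add: row_det_def right_diff_distrib sum_subtractf)
qed

text \<open>The subspace \<open>W\<close> serves in two ways: as a submodule that solutions cannot
  leave, and as \<open>{0}\<close>, which gives uniqueness.\<close>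

locale gaudin_subspace =
  fixes N :: nat and J :: "'j set" and \<xi> :: "'j \<Rightarrow> complex fps"
    and h :: "'j \<Rightarrow> nat \<Rightarrow> nat \<Rightarrow> ('k \<Rightarrow> complex) \<Rightarrow> 'k \<Rightarrow> complex" and W :: "('k \<Rightarrow> complex) set"
  assumes subspace: "fv.subspace W"
    and stable: "\<And>j a b y. j \<in> J \<Longrightarrow> a \<in> {1..N} \<Longrightarrow> b \<in> {1..N} \<Longrightarrow> y \<in> W \<Longrightarrow> h j a b y \<in> W"
begin

lemma error_in:
  assumes "a \<in> {1..N}" "b \<in> {1..N}" "\<And>l. l \<le> i \<Longrightarrow> coef F l \<in> W"
  shows "(\<Sum>j\<in>J. \<Sum>l\<le>i. fsc (fps_nth (\<xi> j) (i - l)) (h j b a (coef F l))) \<in> W"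
  by (intro fv.subspace_sum[OF subspace] fv.subspace_scale[OF subspace] stable assms) auto

lemma gen_X_leading:
  assumes "a \<in> {1..N}" "b \<in> {1..N}" "\<And>l. l \<le> i \<Longrightarrow> coef F l \<in> W"
  shows "coef (gen_X J \<xi> h a b F) i - fsc (of_bool (a = b) * of_nat (Suc i)) (coef F (Suc i)) \<in> W"
proof -
  have *: "x - y - x = - y" for x y :: "'k \<Rightarrow> complex" by (simp add: fun_eq_iff)
  show ?thesis
    unfolding coef_gen_X * by (intro fv.subspace_neg[OF subspace] error_in assms)
qed

lemma gen_X_in:
  assumes "a \<in> {1..N}" "b \<in> {1..N}" "\<And>l. l \<le> Suc i \<Longrightarrow> coef F l \<in> W"
  shows "coef (gen_X J \<xi> h a b F) i \<in> W"
  unfolding coef_gen_X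
  by (intro fv.subspace_diff[OF subspace] fv.subspace_scale[OF subspace] error_in) (use assms in auto)

text \<open>An operator reads coefficients of order at most one higher than it writes, and the
  higher one only through its derivative. Hence, modulo \<open>W\<close>, the coefficient of order
  \<open>s\<close> is seen at order \<open>s - length as\<close> only if every row contributes its
  derivative.\<close>

lemma foldr_gen_X_leading:
  assumes "set as \<subseteq> {1..N}" "\<And>a. a \<in> {1..N} \<Longrightarrow> \<sigma> a \<in> {1..N}" "\<And>l. l < s \<Longrightarrow> coef F l \<in> W" "length as \<le> s"
  shows "(\<forall>l < s - length as. coef (foldr (\<lambda>a. gen_X J \<xi> h a (\<sigma> a)) as F) l \<in> W)
    \<and> coef (foldr (\<lambda>a. gen_X J \<xi> h a (\<sigma> a)) as F) (s - length as)
      - fsc (of_bool (\<forall>a\<in>set as. \<sigma> a = a) * fact s / fact (s - length as)) (coef F s) \<in> W"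
  using assms(1,4)
proof (induction as)
  case Nil
  have "(\<lambda>k. 0) \<in> W" using fv.subspace_0[OF subspace] by (simp only: zero_fun_def)
  then show ?case using assms(3) by (simp add: fsc_def fun_diff_def)
next
  case (Cons a as)
  define G where "G = foldr (\<lambda>a. gen_X J \<xi> h a (\<sigma> a)) as F"
  define r where "r = s - length (a # as)"
  have r: "s - length as = Suc r" using Cons.prems by (simp add: r_def)
  define c :: complex where "c = of_bool (\<forall>a\<in>set as. \<sigma> a = a) * fact s / fact (Suc r)"
  define e :: complex where "e = of_bool (a = \<sigma> a) * of_nat (Suc r)"
  have "set as \<subseteq> {1..N}" "length as \<le> s" using Cons.prems by auto
  note IH = Cons.IH[OF this, unfolded r, folded G_def c_def]
  have ih: "\<And>l. l < Suc r \<Longrightarrow> coef G l \<in> W" "coef G (Suc r) - fsc c (coef F s) \<in> W"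
    using IH by blast+
  have a: "a \<in> {1..N}" "\<sigma> a \<in> {1..N}" using Cons.prems assms(2) by simp_all
  have "coef (gen_X J \<xi> h a (\<sigma> a) G) r - fsc e (coef G (Suc r)) \<in> W"
    unfolding e_def by (rule gen_X_leading) (use a ih in auto)
  moreover have "fsc e (coef G (Suc r) - fsc c (coef F s)) \<in> W"
    by (rule fv.subspace_scale[OF subspace ih(2)])
  ultimately have "coef (gen_X J \<xi> h a (\<sigma> a) G) r - fsc e (coef G (Suc r)) + fsc e (coef G (Suc r) - fsc c (coef F s)) \<in> W"
    by (rule fv.subspace_add[OF subspace])
  moreover have "coef (gen_X J \<xi> h a (\<sigma> a) G) r - fsc e (coef G (Suc r)) + fsc e (coef G (Suc r) - fsc c (coef F s))
     = coef (gen_X J \<xi> h a (\<sigma> a) G) r - fsc (e * c) (coef F s)"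
    by (simp add: fsc_def fun_eq_iff algebra_simps)
  moreover have "e * c = of_bool (\<forall>a\<in>set (a # as). \<sigma> a = a) * fact s / fact r"
    by (auto simp: e_def c_def simp del: of_nat_Suc)
  ultimately have "coef (gen_X J \<xi> h a (\<sigma> a) G) r - fsc (of_bool (\<forall>a\<in>set (a # as). \<sigma> a = a) * fact s / fact r) (coef F s) \<in> W"
    by simp
  moreover have "coef (gen_X J \<xi> h a (\<sigma> a) G) l \<in> W" if "l < r" for l
    by (rule gen_X_in) (use a ih that in auto)
  ultimately show ?case unfolding r_def[symmetric] foldr.simps o_apply G_def[symmetric] by blast
qed

lemma foldr_gen_X_in:
  assumes "set as \<subseteq> {1..N}" "\<And>a. a \<in> {1..N} \<Longrightarrow> \<sigma> a \<in> {1..N}" "\<And>l. coef F l \<in> W"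
  shows "coef (foldr (\<lambda>a. gen_X J \<xi> h a (\<sigma> a)) as F) l \<in> W"
  using assms(1)
proof (induction as arbitrary: l)
  case (Cons a as)
  then show ?case using assms(2) by (simp add: gen_X_in)
qed (simp add: assms(3))

text \<open>Only \<open>\<sigma> = id\<close> contributes \<open>N\<close> derivatives, so the
  coefficient of order \<open>s - N\<close> of the left side of the equation is
  \<open>fact s / fact (s - N)\<close> times the coefficient of order \<open>s\<close> of
  \<open>F\<close>, up to \<open>W\<close>; this factor is invertible.\<close>

lemma coef_in_of_row_det:
  assumes init: "\<And>i. i < N \<Longrightarrow> coef F i \<in> W" and D: "\<And>i. coef (row_det [1..<N+1] (gen_X J \<xi> h) F) i \<in> W"
  shows "coef F s \<in> W"
proof (induction s rule: less_induct)
  case (less s)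
  show ?case
  proof (cases "s < N")
    case False
    define as where "as = [1..<N+1]"
    have len: "length as = N" and set: "set as = {1..N}" by (auto simp: as_def)
    let ?G = "\<lambda>\<sigma>. coef (foldr (\<lambda>a. gen_X J \<xi> h a (\<sigma> a)) as F) (s - N)"
    let ?c = "\<lambda>\<sigma>. of_bool (\<forall>a\<in>set as. \<sigma> a = a) * fact s / fact (s - N) :: complex"
    have "?G \<sigma> - fsc (?c \<sigma>) (coef F s) \<in> W" if "\<sigma> permutes {1..N}" for \<sigma>
    proof -
      have "\<sigma> a \<in> {1..N}" if "a \<in> {1..N}" for a using \<open>\<sigma> permutes {1..N}\<close> that permutes_in_image by metis
      then have "(\<forall>l < s - length as. coef (foldr (\<lambda>a. gen_X J \<xi> h a (\<sigma> a)) as F) l \<in> W)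
        \<and> coef (foldr (\<lambda>a. gen_X J \<xi> h a (\<sigma> a)) as F) (s - length as)
        - fsc (of_bool (\<forall>a\<in>set as. \<sigma> a = a) * fact s / fact (s - length as)) (coef F s) \<in> W"
        by (intro foldr_gen_X_leading) (use False less.IH in \<open>auto simp: len set\<close>)
      then show ?thesis by (simp only: len)
    qed
    then have "(\<Sum>\<sigma> | \<sigma> permutes {1..N}. fsc (of_int (sign \<sigma>)) (?G \<sigma> - fsc (?c \<sigma>) (coef F s))) \<in> W"
      by (intro fv.subspace_sum[OF subspace] fv.subspace_scale[OF subspace]) auto
    moreover have "(\<Sum>\<sigma> | \<sigma> permutes {1..N}. fsc (of_int (sign \<sigma>)) (?G \<sigma> - fsc (?c \<sigma>) (coef F s)))
       = coef (row_det as (gen_X J \<xi> h) F) (s - N) - fsc (fact s / fact (s - N)) (coef F s)"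
    proof -
      have id_iff: "\<sigma> = id \<longleftrightarrow> (\<forall>a\<in>{1..N}. \<sigma> a = a)" if "\<sigma> permutes {1..N}" for \<sigma>
        using that permutes_not_in[OF that] by (auto simp: fun_eq_iff)
      have "(\<Sum>\<sigma> | \<sigma> permutes {1..N}. fsc (of_int (sign \<sigma>)) (fsc (?c \<sigma>) (coef F s)))
        = (\<Sum>\<sigma> | \<sigma> permutes {1..N}. if \<sigma> = id then fsc (fact s / fact (s - N)) (coef F s) else 0)"
        unfolding set
      proof (intro sum.cong refl, goal_cases)
        case (1 \<sigma>)
        show ?case
        proof (cases "\<sigma> = id")
          case True
          then show ?thesis by simp
        next
          case False
          then have "\<not> (\<forall>a\<in>{1..N}. \<sigma> a = a)" using 1 id_iff by blast
          then show ?thesis using False by (simp only: of_bool_eq if_False mult_zero_left div_0 fv.scale_zero_left fv.scale_zero_right)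
        qed
      qed
      also have "\<dots> = fsc (fact s / fact (s - N)) (coef F s)" by (simp add: finite_permutations)
      finally show ?thesis unfolding coef_row_det set fv.scale_right_diff_distrib sum_subtractf by simp
    qed
    ultimately have B: "coef (row_det as (gen_X J \<xi> h) F) (s - N) - fsc (fact s / fact (s - N)) (coef F s) \<in> W"
      by (simp only:)
    have "x - (x - y) = y" for x y :: "'k \<Rightarrow> complex" by (simp add: fun_eq_iff)
    then have "fsc (fact s / fact (s - N)) (coef F s) \<in> W"
      using fv.subspace_diff[OF subspace D[folded as_def, of "s - N"] B] by (simp only:)
    then have "fsc (fact (s - N) / fact s) (fsc (fact s / fact (s - N)) (coef F s)) \<in> W"
      by (rule fv.subspace_scale[OF subspace])
    then show ?thesis by simp
  qed (rule init)
qed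

text \<open>The map \<open>\<Psi>\<close> intertwines the generators only on \<open>W\<close>, which
  suffices because all coefficients that occur stay in \<open>W\<close>.\<close>

lemma row_det_intertwine:
  assumes lin: "flinear \<Psi>"
    and int: "\<And>j a b y. j \<in> J \<Longrightarrow> a \<in> {1..N} \<Longrightarrow> b \<in> {1..N} \<Longrightarrow> y \<in> W \<Longrightarrow> g j a b (\<Psi> y) = \<Psi> (h j a b y)"
    and F: "\<And>i. coef F i \<in> W"
  shows "row_det [1..<N+1] (gen_X J \<xi> g) (lift \<Psi> F) = lift \<Psi> (row_det [1..<N+1] (gen_X J \<xi> h) F)"
proof (rule coef_eqI)
  fix i
  have X: "gen_X J \<xi> g a b (lift \<Psi> G) = lift \<Psi> (gen_X J \<xi> h a b G)"
    if "a \<in> {1..N}" "b \<in> {1..N}" "\<And>i. coef G i \<in> W" for a b G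
  proof (rule coef_eqI)
    fix i
    have "\<Psi> (coef (gen_X J \<xi> h a b G) i) = fsc (of_bool (a = b) * of_nat (Suc i)) (\<Psi> (coef G (Suc i)))
       - (\<Sum>j\<in>J. \<Sum>l\<le>i. fsc (fps_nth (\<xi> j) (i - l)) (\<Psi> (h j b a (coef G l))))"
      unfolding coef_gen_X by (simp only: fp.linear_diff[OF lin] fp.linear_sum[OF lin] fp.linear_scale[OF lin])
    then show "coef (gen_X J \<xi> g a b (lift \<Psi> G)) i = coef (lift \<Psi> (gen_X J \<xi> h a b G)) i"
      unfolding coef_gen_X[of J \<xi> g] coef_lift using that int by simp
  qed
  have f: "foldr (\<lambda>a. gen_X J \<xi> g a (\<sigma> a)) as (lift \<Psi> F) = lift \<Psi> (foldr (\<lambda>a. gen_X J \<xi> h a (\<sigma> a)) as F)"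
    if "set as \<subseteq> {1..N}" "\<And>a. a \<in> {1..N} \<Longrightarrow> \<sigma> a \<in> {1..N}" for \<sigma> as
    using that(1)
  proof (induction as)
    case (Cons a as)
    then have "gen_X J \<xi> g a (\<sigma> a) (lift \<Psi> (foldr (\<lambda>a. gen_X J \<xi> h a (\<sigma> a)) as F))
      = lift \<Psi> (gen_X J \<xi> h a (\<sigma> a) (foldr (\<lambda>a. gen_X J \<xi> h a (\<sigma> a)) as F))"
      using that(2) F by (intro X foldr_gen_X_in) auto
    then show ?case using Cons by simp
  qed simp
  have "foldr (\<lambda>a. gen_X J \<xi> g a (\<sigma> a)) [1..<N+1] (lift \<Psi> F) = lift \<Psi> (foldr (\<lambda>a. gen_X J \<xi> h a (\<sigma> a)) [1..<N+1] F)"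
    if "\<sigma> permutes {1..N}" for \<sigma>
  proof (rule f)
    show "\<sigma> a \<in> {1..N}" if "a \<in> {1..N}" for a using \<open>\<sigma> permutes {1..N}\<close> that permutes_in_image by metis
  qed auto
  moreover have "set [1..<N+1] = {1..N}" by auto
  ultimately show "coef (row_det [1..<N+1] (gen_X J \<xi> g) (lift \<Psi> F)) i = coef (lift \<Psi> (row_det [1..<N+1] (gen_X J \<xi> h) F)) i"
    unfolding coef_lift coef_row_det fp.linear_sum[OF lin] fp.linear_scale[OF lin]
    by (intro sum.cong) auto
qed

end

subsection \<open>Tensor products of the models\<close>

lemma tscale_eq_fsc: "tscale = fsc"
  by (intro ext) (simp add: tscale_def fsc_def)

lemma flinear_factor_op: "flinear (factor_op n d j A)"
  by (rule flinearI)
     (simp_all add: factor_op_def fsc_def fun_eq_iff algebra_simps sum.distrib sum_distrib_left)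

definition product_tensor :: "nat \<Rightarrow> (nat \<Rightarrow> nat) \<Rightarrow> (nat \<Rightarrow> nat \<Rightarrow> complex) \<Rightarrow> tensor" where
  "product_tensor n d y k = (if k \<in> tensor_index n d then \<Prod>j\<in>{1..n}. y j (k j) else 0)"

lemma factor_op_product_tensor:
  assumes "j \<in> {1..n}"
  shows "factor_op n d j A (product_tensor n d y) = product_tensor n d (y(j := mat_op (d j) A (y j)))"
proof
  fix k
  show "factor_op n d j A (product_tensor n d y) k = product_tensor n d (y(j := mat_op (d j) A (y j))) k"
  proof (cases "k \<in> tensor_index n d")
    case True
    have upd: "k(j := c) \<in> tensor_index n d" if "c < d j" for c
      using True that assms by (auto simp: tensor_index_def PiE_def extensional_def)
    have kj: "k j < d j" using True assms by (auto simp: tensor_index_def)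
    let ?R = "\<Prod>i\<in>{1..n} - {j}. y i (k i)"
    have *: "product_tensor n d y (k(j := c)) = y j c * ?R" if "c < d j" for c
      using upd[OF that] assms by (simp add: product_tensor_def prod.remove[of _ j])
    have "factor_op n d j A (product_tensor n d y) k = (\<Sum>c<d j. A $$ (k j, c) * (y j c * ?R))"
      using True by (simp add: factor_op_def *)
    also have "\<dots> = mat_op (d j) A (y j) (k j) * ?R"
      using kj by (simp add: mat_op_def sum_distrib_right mult.assoc)
    also have "\<dots> = product_tensor n d (y(j := mat_op (d j) A (y j))) k"
      using True assms by (simp add: product_tensor_def prod.remove[of _ j])
    finally show ?thesis .
  next
    case False
    then show ?thesis by (simp add: factor_op_def product_tensor_def)
  qed
qed

lemma finite_tensor_index: "finite (tensor_index n d)"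
  by (simp add: tensor_index_def finite_PiE)

text \<open>The map \<open>\<psi> j\<close> is linear on all functions but compatible with the
  generators only on \<open>T j\<close>, and the image of \<open>T j\<close> contains the basis
  vectors of the given module.\<close>

locale tensor_model =
  fixes N n :: nat and d :: "nat \<Rightarrow> nat" and E :: "nat \<Rightarrow> nat \<Rightarrow> nat \<Rightarrow> complex mat"
    and P :: "nat \<Rightarrow> 'c set" and T :: "nat \<Rightarrow> (('c \<Rightarrow> nat) \<Rightarrow> complex) set"
    and \<psi> :: "nat \<Rightarrow> (('c \<Rightarrow> nat) \<Rightarrow> complex) \<Rightarrow> nat \<Rightarrow> complex"
  assumes finP: "\<And>j. j \<in> {1..n} \<Longrightarrow> finite (P j)"
    and lin: "\<And>j. j \<in> {1..n} \<Longrightarrow> flinear (\<psi> j)"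
    and T_stable: "\<And>j t a b. j \<in> {1..n} \<Longrightarrow> t \<in> T j \<Longrightarrow> a \<in> {1..N} \<Longrightarrow> b \<in> {1..N} \<Longrightarrow> color_gl (P j) a b t \<in> T j"
    and T_support: "\<And>j t \<kappa>. j \<in> {1..n} \<Longrightarrow> t \<in> T j \<Longrightarrow> \<kappa> \<notin> P j \<rightarrow>\<^sub>E {1..N} \<Longrightarrow> t \<kappa> = 0"
    and T_hom: "\<And>j t a b. j \<in> {1..n} \<Longrightarrow> t \<in> T j \<Longrightarrow> a \<in> {1..N} \<Longrightarrow> b \<in> {1..N} \<Longrightarrow>
        \<psi> j (color_gl (P j) a b t) = mat_op (d j) (E j a b) (\<psi> j t)"
    and T_onto: "\<And>j i. j \<in> {1..n} \<Longrightarrow> i < d j \<Longrightarrow> \<exists>t\<in>T j. \<psi> j t = (\<lambda>k. of_bool (k = i))"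
begin

definition Pos :: "(nat \<times> 'c) set" where "Pos = Sigma {1..n} P"

definition Idx :: "(nat \<times> 'c \<Rightarrow> nat) set" where "Idx = Pos \<rightarrow>\<^sub>E {1..N}"

definition pos_gl :: "nat \<Rightarrow> nat \<Rightarrow> nat \<Rightarrow> ((nat \<times> 'c \<Rightarrow> nat) \<Rightarrow> complex) \<Rightarrow> (nat \<times> 'c \<Rightarrow> nat) \<Rightarrow> complex" where
  "pos_gl j a b y \<kappa> = (\<Sum>p\<in>P j. of_bool (\<kappa> (j, p) = a) * y (\<kappa>((j, p) := b)))"

definition pure :: "(nat \<Rightarrow> ('c \<Rightarrow> nat) \<Rightarrow> complex) \<Rightarrow> (nat \<times> 'c \<Rightarrow> nat) \<Rightarrow> complex" where
  "pure t \<kappa> = (\<Prod>j\<in>{1..n}. t j (\<lambda>p. \<kappa> (j, p)))"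

definition pures :: "((nat \<times> 'c \<Rightarrow> nat) \<Rightarrow> complex) set" where
  "pures = {pure t | t. \<forall>j\<in>{1..n}. t j \<in> T j}"

text \<open>Tensors are compared only on \<open>Idx\<close>: the equation is available only there,
  and \<open>Psi\<close> reads nothing else. Leaving the other values free makes every function that
  vanishes on \<open>Idx\<close> a member.\<close>

definition Tsp :: "((nat \<times> 'c \<Rightarrow> nat) \<Rightarrow> complex) set" where
  "Tsp = {y. \<exists>y'\<in>fv.span pures. \<forall>\<kappa>\<in>Idx. y \<kappa> = y' \<kappa>}"

text \<open>The tensor product of the maps \<open>\<psi> j\<close>, written with their matrix
  entries: the argument of \<open>\<psi> j\<close> is the basis vector of the restriction of
  \<open>\<kappa>\<close> to factor \<open>j\<close>.\<close>

definition Psi :: "((nat \<times> 'c \<Rightarrow> nat) \<Rightarrow> complex) \<Rightarrow> tensor" where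
  "Psi y k = (if k \<in> tensor_index n d
     then \<Sum>\<kappa>\<in>Idx. (\<Prod>j\<in>{1..n}. \<psi> j (\<lambda>g. of_bool (g = (\<lambda>p. \<kappa> (j, p)))) (k j)) * y \<kappa> else 0)"

lemma finite_Pos: "finite Pos"
  using finP by (auto simp: Pos_def)

lemma Idx_image: "\<kappa> \<in> Idx \<Longrightarrow> \<kappa> ` Pos \<subseteq> {1..N}"
  by (auto simp: Idx_def)

lemma Idx_upd: "\<kappa> \<in> Idx \<Longrightarrow> p \<in> Pos \<Longrightarrow> b \<in> {1..N} \<Longrightarrow> \<kappa>(p := b) \<in> Idx"
  by (auto simp: Idx_def PiE_def extensional_def)

lemma flinear_Psi: "flinear Psi"
  by (rule flinearI) (simp_all add: Psi_def fsc_def fun_eq_iff algebra_simps sum.distrib sum_distrib_left)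

lemma flinear_pos_gl: "flinear (pos_gl j a b)"
  by (rule flinearI) (simp_all add: pos_gl_def fsc_def fun_eq_iff algebra_simps sum.distrib sum_distrib_left)

lemma Psi_cong: "(\<And>\<kappa>. \<kappa> \<in> Idx \<Longrightarrow> y \<kappa> = y' \<kappa>) \<Longrightarrow> Psi y = Psi y'"
  by (rule ext) (simp add: Psi_def cong: sum.cong)

text \<open>A colouring of \<open>Pos\<close> is a family of colourings of the sets
  \<open>P j\<close>; its value \<open>undefined\<close> outside \<open>Pos\<close> becomes the one
  required outside \<open>P j\<close>.\<close>

lemma sum_Idx_prod: "(\<Sum>\<kappa>\<in>Idx. \<Prod>j\<in>{1..n}. f j (\<lambda>p. \<kappa> (j, p))) = (\<Prod>j\<in>{1..n}. \<Sum>g\<in>P j \<rightarrow>\<^sub>E {1..N}. f j g)"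
  for f :: "nat \<Rightarrow> ('c \<Rightarrow> nat) \<Rightarrow> complex"
proof -
  have "(\<Prod>j\<in>{1..n}. \<Sum>g\<in>P j \<rightarrow>\<^sub>E {1..N}. f j g) = (\<Sum>g\<in>(\<Pi>\<^sub>E j\<in>{1..n}. P j \<rightarrow>\<^sub>E {1..N}). \<Prod>j\<in>{1..n}. f j (g j))"
    by (rule prod_sum_PiE) (auto intro!: finite_PiE finP)
  also have "\<dots> = (\<Sum>\<kappa>\<in>Idx. \<Prod>j\<in>{1..n}. f j (\<lambda>p. \<kappa> (j, p)))"
  proof (rule sum.reindex_bij_witness[of _ "\<lambda>\<kappa>. restrict (\<lambda>j p. \<kappa> (j, p)) {1..n}"
        "\<lambda>g. restrict (\<lambda>(j, p). g j p) Pos"], goal_cases)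
    case (1 g)
    show ?case
    proof
      fix j
      show "restrict (\<lambda>j p. restrict (\<lambda>(j, p). g j p) Pos (j, p)) {1..n} j = g j"
      proof (cases "j \<in> {1..n}")
        case True
        then have "g j \<in> P j \<rightarrow>\<^sub>E {1..N}" using 1 by auto
        then show ?thesis using True by (auto simp: Pos_def PiE_def extensional_def fun_eq_iff restrict_def)
      next
        case False
        then show ?thesis using 1 by (auto simp: PiE_def extensional_def restrict_def)
      qed
    qed
  next
    case (2 g)
    then show ?case by (auto simp: Idx_def Pos_def PiE_def Pi_def)
  next
    case (3 \<kappa>)
    then show ?case by (auto simp: Idx_def Pos_def PiE_def extensional_def fun_eq_iff restrict_def)
  next
    case (4 \<kappa>)
    then show ?case by (auto simp: Idx_def Pos_def PiE_def Pi_def extensional_def)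
  next
    case (5 g)
    have "(\<lambda>p. restrict (\<lambda>(j, p). g j p) Pos (j, p)) = g j" if "j \<in> {1..n}" for j
    proof -
      have "g j \<in> P j \<rightarrow>\<^sub>E {1..N}" using 5 that by auto
      then show ?thesis using that by (auto simp: Pos_def PiE_def extensional_def fun_eq_iff restrict_def)
    qed
    then show ?case by (intro prod.cong refl) simp
  qed
  finally show ?thesis ..
qed

lemma psi_expand:
  assumes j: "j \<in> {1..n}" and t: "t \<in> T j"
  shows "\<psi> j t i = (\<Sum>g\<in>P j \<rightarrow>\<^sub>E {1..N}. \<psi> j (\<lambda>h. of_bool (h = g)) i * t g)"
proof -
  have fin: "finite (P j \<rightarrow>\<^sub>E {1..N})" using finP[OF j] by (intro finite_PiE) auto
  have "t = (\<Sum>g\<in>P j \<rightarrow>\<^sub>E {1..N}. fsc (t g) (\<lambda>h. of_bool (h = g)))"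
  proof
    fix h
    have "(\<Sum>g\<in>P j \<rightarrow>\<^sub>E {1..N}. fsc (t g) (\<lambda>h. of_bool (h = g))) h = (\<Sum>g\<in>P j \<rightarrow>\<^sub>E {1..N}. if h = g then t g else 0)"
      unfolding sum_fun_apply fsc_def by (intro sum.cong refl) simp
    also have "\<dots> = (if h \<in> P j \<rightarrow>\<^sub>E {1..N} then t h else 0)" by (rule sum.delta'[OF fin])
    also have "\<dots> = t h" using T_support[OF j t] by auto
    finally show "t h = (\<Sum>g\<in>P j \<rightarrow>\<^sub>E {1..N}. fsc (t g) (\<lambda>h. of_bool (h = g))) h" ..
  qed
  then have "\<psi> j t = \<psi> j (\<Sum>g\<in>P j \<rightarrow>\<^sub>E {1..N}. fsc (t g) (\<lambda>h. of_bool (h = g)))" by (rule arg_cong)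
  also have "\<dots> = (\<Sum>g\<in>P j \<rightarrow>\<^sub>E {1..N}. fsc (t g) (\<psi> j (\<lambda>h. of_bool (h = g))))"
    by (simp only: fp.linear_sum[OF lin[OF j]] fp.linear_scale[OF lin[OF j]])
  finally show ?thesis by (simp add: sum_fun_apply fsc_def mult.commute)
qed

lemma Psi_pure:
  assumes t: "\<And>j. j \<in> {1..n} \<Longrightarrow> t j \<in> T j"
  shows "Psi (pure t) = product_tensor n d (\<lambda>j. \<psi> j (t j))"
proof
  fix k
  have "(\<Sum>\<kappa>\<in>Idx. (\<Prod>j\<in>{1..n}. \<psi> j (\<lambda>g. of_bool (g = (\<lambda>p. \<kappa> (j, p)))) (k j)) * pure t \<kappa>)
    = (\<Sum>\<kappa>\<in>Idx. \<Prod>j\<in>{1..n}. (\<lambda>j g'. \<psi> j (\<lambda>g. of_bool (g = g')) (k j) * t j g') j (\<lambda>p. \<kappa> (j, p)))"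
    by (simp only: pure_def prod.distrib)
  also have "\<dots> = (\<Prod>j\<in>{1..n}. \<Sum>g'\<in>P j \<rightarrow>\<^sub>E {1..N}. \<psi> j (\<lambda>g. of_bool (g = g')) (k j) * t j g')"
    by (rule sum_Idx_prod)
  also have "\<dots> = (\<Prod>j\<in>{1..n}. \<psi> j (t j) (k j))"
    by (intro prod.cong refl psi_expand[symmetric] t)
  finally show "Psi (pure t) k = product_tensor n d (\<lambda>j. \<psi> j (t j)) k"
    by (simp add: Psi_def product_tensor_def)
qed

lemma pos_gl_pure:
  assumes "j \<in> {1..n}"
  shows "pos_gl j a b (pure t) = pure (t(j := color_gl (P j) a b (t j)))"
proof
  fix \<kappa>
  let ?R = "\<Prod>i\<in>{1..n} - {j}. t i (\<lambda>q. \<kappa> (i, q))"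
  have *: "pure t (\<kappa>((j, p) := b)) = t j ((\<lambda>q. \<kappa> (j, q))(p := b)) * ?R" for p
  proof -
    have "(\<lambda>q. (\<kappa>((j, p) := b)) (j, q)) = (\<lambda>q. \<kappa> (j, q))(p := b)" by auto
    moreover have "(\<Prod>i\<in>{1..n} - {j}. t i (\<lambda>q. (\<kappa>((j, p) := b)) (i, q))) = ?R" by (intro prod.cong refl) simp
    ultimately show ?thesis unfolding pure_def using assms by (subst prod.remove[of _ j]) simp_all
  qed
  have "pos_gl j a b (pure t) \<kappa> = color_gl (P j) a b (t j) (\<lambda>q. \<kappa> (j, q)) * ?R"
    by (simp only: pos_gl_def * color_gl_def sum_distrib_right mult.assoc)
  also have "\<dots> = pure (t(j := color_gl (P j) a b (t j))) \<kappa>"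
    unfolding pure_def using assms by (subst prod.remove[of _ j "\<lambda>i. (t(j := color_gl (P j) a b (t j))) i (\<lambda>p. \<kappa> (i, p))"]) simp_all
  finally show "pos_gl j a b (pure t) \<kappa> = pure (t(j := color_gl (P j) a b (t j))) \<kappa>" .
qed

lemma pos_gl_span:
  assumes j: "j \<in> {1..n}" and ab: "a \<in> {1..N}" "b \<in> {1..N}" and y: "y \<in> fv.span pures"
  shows "pos_gl j a b y \<in> fv.span pures \<and> Psi (pos_gl j a b y) = factor_op n d j (E j a b) (Psi y)"
  using y
proof (induction rule: fv.span_induct_alt)
  case base
  show ?case
    by (simp only: fp.linear_0[OF flinear_pos_gl] fp.linear_0[OF flinear_Psi] fp.linear_0[OF flinear_factor_op] fv.span_zero simp_thms)
next
  case (step c x y)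
  then obtain t where t: "x = pure t" "\<And>i. i \<in> {1..n} \<Longrightarrow> t i \<in> T i" unfolding pures_def by blast
  let ?t = "t(j := color_gl (P j) a b (t j))"
  have t': "?t i \<in> T i" if "i \<in> {1..n}" for i using t(2)[OF that] T_stable[OF j t(2)[OF j] ab] by simp
  have x: "pos_gl j a b x = pure ?t" by (simp only: t(1) pos_gl_pure[OF j])
  then have 1: "pos_gl j a b x \<in> pures" using t' unfolding pures_def by blast
  have "Psi (pos_gl j a b x) = product_tensor n d (\<lambda>i. \<psi> i (?t i))" unfolding x by (rule Psi_pure[OF t'])
  also have "(\<lambda>i. \<psi> i (?t i)) = (\<lambda>i. \<psi> i (t i))(j := mat_op (d j) (E j a b) (\<psi> j (t j)))"
    using T_hom[OF j t(2)[OF j] ab] by (simp add: fun_eq_iff)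
  also have "product_tensor n d \<dots> = factor_op n d j (E j a b) (Psi x)"
  proof -
    have "Psi x = product_tensor n d (\<lambda>i. \<psi> i (t i))" unfolding t(1) by (rule Psi_pure[OF t(2)])
    then show ?thesis by (simp only: factor_op_product_tensor[OF j])
  qed
  finally have 2: "Psi (pos_gl j a b x) = factor_op n d j (E j a b) (Psi x)" .
  have "pos_gl j a b (fsc c x + y) = fsc c (pos_gl j a b x) + pos_gl j a b y"
    by (simp only: fp.linear_add[OF flinear_pos_gl] fp.linear_scale[OF flinear_pos_gl])
  moreover have "fsc c (pos_gl j a b x) + pos_gl j a b y \<in> fv.span pures"
    using step(2) 1 by (intro fv.span_add fv.span_scale) (auto intro: fv.span_base)
  moreover have "Psi (fsc c (pos_gl j a b x) + pos_gl j a b y) = factor_op n d j (E j a b) (Psi (fsc c x + y))"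
    unfolding fp.linear_add[OF flinear_Psi] fp.linear_scale[OF flinear_Psi] fp.linear_add[OF flinear_factor_op] fp.linear_scale[OF flinear_factor_op]
    using step(2) by (simp only: 2)
  ultimately show ?case by (simp only: simp_thms)
qed

lemma pos_gl_cong:
  assumes "j \<in> {1..n}" "b \<in> {1..N}" "\<And>\<kappa>. \<kappa> \<in> Idx \<Longrightarrow> y \<kappa> = y' \<kappa>" "\<kappa> \<in> Idx"
  shows "pos_gl j a b y \<kappa> = pos_gl j a b y' \<kappa>"
  unfolding pos_gl_def using assms by (intro sum.cong refl) (simp add: Idx_upd Pos_def)

lemma pos_gl_Tsp:
  assumes j: "j \<in> {1..n}" and ab: "a \<in> {1..N}" "b \<in> {1..N}" and y: "y \<in> Tsp"
  shows "pos_gl j a b y \<in> Tsp" "factor_op n d j (E j a b) (Psi y) = Psi (pos_gl j a b y)"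
proof -
  obtain y' where y': "y' \<in> fv.span pures" "\<And>\<kappa>. \<kappa> \<in> Idx \<Longrightarrow> y \<kappa> = y' \<kappa>" using y unfolding Tsp_def by blast
  note s = pos_gl_span[OF j ab y'(1)] and c = pos_gl_cong[OF j ab(2), of y y', OF y'(2)]
  show "pos_gl j a b y \<in> Tsp" unfolding Tsp_def using s c by blast
  show "factor_op n d j (E j a b) (Psi y) = Psi (pos_gl j a b y)"
    using s Psi_cong[of y y', OF y'(2)] Psi_cong[of "pos_gl j a b y" "pos_gl j a b y'", OF c] by simp
qed

lemma Tsp_if_eq_0: "(\<And>\<kappa>. \<kappa> \<in> Idx \<Longrightarrow> y \<kappa> = 0) \<Longrightarrow> y \<in> Tsp"
  unfolding Tsp_def using fv.span_zero[of pures] by (intro CollectI bexI[of _ 0]) auto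

lemma subspace_Tsp: "fv.subspace Tsp"
  unfolding fv.subspace_def
proof (intro conjI ballI allI)
  show "0 \<in> Tsp" by (rule Tsp_if_eq_0) simp
next
  fix x y assume "x \<in> Tsp" "y \<in> Tsp"
  then obtain x' y' where "x' \<in> fv.span pures" "y' \<in> fv.span pures" "\<forall>\<kappa>\<in>Idx. x \<kappa> = x' \<kappa>" "\<forall>\<kappa>\<in>Idx. y \<kappa> = y' \<kappa>"
    unfolding Tsp_def by blast
  then show "x + y \<in> Tsp" unfolding Tsp_def
    by (intro CollectI bexI[of _ "x' + y'"] fv.span_add) auto
next
  fix c x assume "x \<in> Tsp"
  then obtain x' where "x' \<in> fv.span pures" "\<forall>\<kappa>\<in>Idx. x \<kappa> = x' \<kappa>" unfolding Tsp_def by blast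
  then show "fsc c x \<in> Tsp" unfolding Tsp_def
    by (intro CollectI bexI[of _ "fsc c x'"] fv.span_scale) (auto simp: fsc_def)
qed

text \<open>Every basis tensor is the image of a pure tensor.\<close>

lemma Psi_onto:
  assumes "x \<in> tensor_space n d"
  shows "\<exists>y\<in>Tsp. Psi y = x"
proof -
  have "\<exists>t. t \<in> T j \<and> \<psi> j t = (\<lambda>l. of_bool (l = i))" if "j \<in> {1..n}" "i < d j" for j i
    using T_onto[OF that] by blast
  then obtain t where t: "\<And>j i. j \<in> {1..n} \<Longrightarrow> i < d j \<Longrightarrow> t j i \<in> T j \<and> \<psi> j (t j i) = (\<lambda>l. of_bool (l = i))"
    by metis
  let ?I = "tensor_index n d"
  let ?y = "\<Sum>k\<in>?I. fsc (x k) (pure (\<lambda>j. t j (k j)))"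
  have tk: "t j (k j) \<in> T j" "\<psi> j (t j (k j)) = (\<lambda>l. of_bool (l = k j))" if "k \<in> ?I" "j \<in> {1..n}" for k j
    using t[OF that(2), of "k j"] PiE_mem[of k "{1..n}" "\<lambda>j. {..<d j}" j] that by (auto simp: tensor_index_def)
  have "?y \<in> fv.span pures"
    by (intro fv.span_sum fv.span_scale fv.span_base) (use tk(1) in \<open>auto simp: pures_def\<close>)
  then have "?y \<in> Tsp" unfolding Tsp_def by blast
  moreover have "Psi ?y = x"
  proof
    fix l
    have pk: "Psi (pure (\<lambda>j. t j (k j))) l = of_bool (k = l \<and> l \<in> ?I)" if "k \<in> ?I" for k
    proof -
      have "Psi (pure (\<lambda>j. t j (k j))) = product_tensor n d (\<lambda>j. \<psi> j (t j (k j)))"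
        by (rule Psi_pure) (rule tk(1)[OF that])
      then have "Psi (pure (\<lambda>j. t j (k j))) l = (if l \<in> ?I then \<Prod>j\<in>{1..n}. of_bool (l j = k j) else 0)"
      proof -
        have "(\<Prod>j\<in>{1..n}. \<psi> j (t j (k j)) (l j)) = (\<Prod>j\<in>{1..n}. of_bool (l j = k j))"
          by (intro prod.cong refl) (simp only: tk(2)[OF that])
        then show ?thesis using \<open>Psi (pure (\<lambda>j. t j (k j))) = _\<close> by (simp only: product_tensor_def)
      qed
      also have "\<dots> = of_bool (k = l \<and> l \<in> ?I)"
      proof (cases "l \<in> ?I")
        case True
        have "k = l \<longleftrightarrow> (\<forall>j\<in>{1..n}. l j = k j)"
          using True that PiE_ext[of l "{1..n}" "\<lambda>j. {..<d j}" k] unfolding tensor_index_def by auto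
        then show ?thesis using True by (auto simp: prod_zero_iff)
      qed simp
      finally show ?thesis .
    qed
    have "Psi ?y l = (\<Sum>k\<in>?I. x k * Psi (pure (\<lambda>j. t j (k j))) l)"
    proof -
      have "Psi ?y = (\<Sum>k\<in>?I. fsc (x k) (Psi (pure (\<lambda>j. t j (k j)))))"
        by (simp only: fp.linear_sum[OF flinear_Psi] fp.linear_scale[OF flinear_Psi])
      then show ?thesis by (simp only: sum_fun_apply fsc_def)
    qed
    also have "\<dots> = (\<Sum>k\<in>?I. if k = l then x k else 0)"
      by (intro sum.cong refl) (auto simp: pk)
    also have "\<dots> = (if l \<in> ?I then x l else 0)" by (rule sum.delta[OF finite_tensor_index])
    also have "\<dots> = x l" using assms by (simp add: tensor_space_def)
    finally show "Psi ?y l = x l" .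
  qed
  ultimately show ?thesis by blast
qed

text \<open>All positions of factor \<open>j\<close> carry the same \<open>\<xi> j\<close>: on the
  product of the models, the operator with the given points is the positional operator with each
  point repeated \<open>card (P j)\<close> times.\<close>

lemma gen_X_pos_gl: "gen_X {1..n} \<xi> pos_gl = pos_X Pos (\<xi> \<circ> fst)"
proof (intro ext)
  fix a b F \<kappa>
  have l: "lift (pos_gl j b a) F \<kappa> = (\<Sum>p\<in>P j. of_bool (\<kappa> (j, p) = b) * F (\<kappa>((j, p) := a)))" for j
  proof (rule fps_ext)
    fix i
    have "fps_nth (of_bool c * G) i = of_bool c * fps_nth G i" for c and G :: "complex fps" by (cases c) simp_all
    then show "fps_nth (lift (pos_gl j b a) F \<kappa>) i = fps_nth (\<Sum>p\<in>P j. of_bool (\<kappa> (j, p) = b) * F (\<kappa>((j, p) := a))) i"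
      by (simp add: lift_def pos_gl_def coef_def fps_sum_nth)
  qed
  have "(\<Sum>j\<in>{1..n}. \<xi> j * lift (pos_gl j b a) F \<kappa>) = (\<Sum>j\<in>{1..n}. \<Sum>p\<in>P j. of_bool (\<kappa> (j, p) = b) * \<xi> j * F (\<kappa>((j, p) := a)))"
    by (simp only: l sum_distrib_left mult_ac)
  also have "\<dots> = (\<Sum>q\<in>Pos. of_bool (\<kappa> q = b) * (\<xi> \<circ> fst) q * F (\<kappa>(q := a)))"
    unfolding Pos_def by (subst sum.Sigma) (use finP in \<open>auto intro!: sum.cong\<close>)
  finally show "gen_X {1..n} \<xi> pos_gl a b F \<kappa> = pos_X Pos (\<xi> \<circ> fst) a b F \<kappa>"
    by (simp only: gen_X_def pos_X_def)
qed

abbreviation op_M :: "nat \<Rightarrow> nat \<Rightarrow> nat \<Rightarrow> tensor \<Rightarrow> tensor" where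
  "op_M j a b \<equiv> factor_op n d j (E j a b)"

lemma gaudin_Tsp: "gaudin_subspace N {1..n} pos_gl Tsp"
  by unfold_locales (use subspace_Tsp pos_gl_Tsp(1) in auto)

lemma gaudin_0: "gaudin_subspace N {1..n} op_M {0}"
  by unfold_locales (auto simp: fp.linear_0[OF flinear_factor_op])

lemma Psi_solution:
  assumes F: "\<And>i. coef F i \<in> Tsp" and D: "\<And>\<kappa>. \<kappa> \<in> Idx \<Longrightarrow> row_det [1..<N+1] (pos_X Pos (\<xi> \<circ> fst)) F \<kappa> = 0"
  shows "row_det [1..<N+1] (gen_X {1..n} \<xi> op_M) (lift Psi F) = (\<lambda>k. 0)"
proof -
  interpret G: gaudin_subspace N "{1..n}" \<xi> pos_gl Tsp by (rule gaudin_Tsp)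
  have "row_det [1..<N+1] (gen_X {1..n} \<xi> op_M) (lift Psi F) = lift Psi (row_det [1..<N+1] (gen_X {1..n} \<xi> pos_gl) F)"
    by (rule G.row_det_intertwine[OF flinear_Psi pos_gl_Tsp(2) F])
  also have "\<dots> = (\<lambda>k. 0)"
  proof (rule coef_eqI)
    fix i
    have "Psi (coef (row_det [1..<N+1] (gen_X {1..n} \<xi> pos_gl) F) i) = Psi 0"
      by (rule Psi_cong) (simp only: coef_def gen_X_pos_gl D zero_fun_apply fps_zero_nth)
    also have "\<dots> = 0" by (rule fp.linear_0[OF flinear_Psi])
    finally show "coef (lift Psi (row_det [1..<N+1] (gen_X {1..n} \<xi> pos_gl) F)) i = coef (\<lambda>k. 0) i"
      unfolding coef_lift by (simp add: coef_def fun_eq_iff)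
  qed
  finally show ?thesis .
qed

text \<open>The polynomial solution is built without regard to the submodule. Once its first
  \<open>N\<close> coefficients lie in \<open>Tsp\<close>, the recursion keeps all of them
  there.\<close>

lemma coef_in_Tsp:
  assumes init: "\<And>i. i < N \<Longrightarrow> coef F i \<in> Tsp" and D: "\<And>\<kappa>. \<kappa> \<in> Idx \<Longrightarrow> row_det [1..<N+1] (pos_X Pos (\<xi> \<circ> fst)) F \<kappa> = 0"
  shows "coef F i \<in> Tsp"
proof -
  interpret G: gaudin_subspace N "{1..n}" \<xi> pos_gl Tsp by (rule gaudin_Tsp)
  show ?thesis
  proof (rule G.coef_in_of_row_det[OF init])
    fix i
    show "coef (row_det [1..<N+1] (gen_X {1..n} \<xi> pos_gl) F) i \<in> Tsp"
      unfolding gen_X_pos_gl by (rule Tsp_if_eq_0) (simp only: coef_def D fps_zero_nth)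
  qed
qed

lemma sum_pos_gl_Tsp:
  assumes ab: "a \<in> {1..N}" "b \<in> {1..N}" and y: "y \<in> Tsp"
  shows "(\<Sum>j\<in>{1..n}. pos_gl j a b y) \<in> Tsp" "Psi (\<Sum>j\<in>{1..n}. pos_gl j a b y) = gl_action n d E a b (Psi y)"
proof -
  show "(\<Sum>j\<in>{1..n}. pos_gl j a b y) \<in> Tsp"
    by (intro fv.subspace_sum[OF subspace_Tsp] pos_gl_Tsp(1)[OF _ ab y])
  show "Psi (\<Sum>j\<in>{1..n}. pos_gl j a b y) = gl_action n d E a b (Psi y)"
    unfolding gl_action_def fp.linear_sum[OF flinear_Psi]
    by (intro sum.cong refl pos_gl_Tsp(2)[OF _ ab y, symmetric])
qed

lemma sum_pos_gl_eq: "(\<Sum>j\<in>{1..n}. pos_gl j a b y) = color_gl Pos a b y"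
  unfolding Pos_def fun_eq_iff sum_fun_apply pos_gl_def color_gl_def
  by (intro allI, subst sum.Sigma) (use finP in \<open>auto intro!: sum.cong\<close>)

text \<open>The data are lifted through \<open>Psi\<close>, the equation is solved on colourings,
  and the solution is mapped back. That an eigenvector equation for the data persists is proved by
  uniqueness, with the commutation with the diagonal action used before \<open>Psi\<close> is
  applied.\<close>

lemma module_solution:
  assumes N: "1 \<le> N" and z: "\<And>j. j \<in> {1..n} \<Longrightarrow> z j \<noteq> v" and x: "\<And>i. i < N \<Longrightarrow> x i \<in> tensor_space n d"
  obtains F where "row_det [1..<N+1] (gen_X {1..n} (rxi v z) op_M) F = (\<lambda>k. 0)"
    "\<And>i. i < N \<Longrightarrow> coef F i = x i" "\<And>l. N + card Pos \<le> l \<Longrightarrow> coef F l = 0"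
    "\<And>k l. k \<notin> tensor_index n d \<Longrightarrow> coef F l k = 0"
    "\<And>a b c l. a \<in> {1..N} \<Longrightarrow> b \<in> {1..N} \<Longrightarrow> (\<And>i. i < N \<Longrightarrow> gl_action n d E a b (x i) = tscale c (x i)) \<Longrightarrow>
        gl_action n d E a b (coef F l) = tscale c (coef F l)"
proof -
  obtain y where y: "\<And>i. i < N \<Longrightarrow> y i \<in> Tsp \<and> Psi (y i) = x i" using Psi_onto[OF x] by metis
  have zp: "(z \<circ> fst) p \<noteq> v" if "p \<in> Pos" for p using z[of "fst p"] that by (auto simp: Pos_def)
  have xi: "rxi v (z \<circ> fst) = rxi v z \<circ> fst" by (simp add: fun_eq_iff rxi_def)
  obtain F where F: "polynomial_solution N Pos v (z \<circ> fst) F" "\<And>\<kappa> i. i < N \<Longrightarrow> fps_nth (F \<kappa>) i = y i \<kappa>"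
    using polynomial_solution_exists[OF N finite_Pos, where zp = "z \<circ> fst" and v = v and x = y] zp by blast
  have D: "row_det [1..<N+1] (pos_X Pos (rxi v z \<circ> fst)) F \<kappa> = 0" if "\<kappa> ` Pos \<subseteq> {1..N}" for \<kappa>
    using F(1) that unfolding polynomial_solution_def xi by blast
  have init: "coef F i = y i" if "i < N" for i using F(2)[OF that] by (simp add: coef_def fun_eq_iff)
  have FT: "coef F i \<in> Tsp" for i
    by (rule coef_in_Tsp[where \<xi> = "rxi v z"]) (use init y D Idx_image in auto)
  show ?thesis
  proof (rule that[of "lift Psi F"])
    show "row_det [1..<N+1] (gen_X {1..n} (rxi v z) op_M) (lift Psi F) = (\<lambda>k. 0)"
      by (rule Psi_solution[OF FT D[OF Idx_image]])
    show "coef (lift Psi F) i = x i" if "i < N" for i using init y that by simp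
    show "coef (lift Psi F) l = 0" if "N + card Pos \<le> l" for l
    proof -
      have "coef F l = 0" using F(1) that by (simp add: polynomial_solution_def coef_def fun_eq_iff)
      then show ?thesis by (simp only: coef_lift fp.linear_0[OF flinear_Psi])
    qed
    show "coef (lift Psi F) l k = 0" if "k \<notin> tensor_index n d" for k l using that by (simp add: Psi_def)
  next
    fix a b c l assume ab: "a \<in> {1..N}" "b \<in> {1..N}" and gx: "\<And>i. i < N \<Longrightarrow> gl_action n d E a b (x i) = tscale c (x i)"
    \<comment> \<open>This solution need not vanish, since the lifted data satisfy the condition
      only modulo the kernel of \<open>Psi\<close>; its image has zero data and vanishes by
      uniqueness.\<close>
    define H where "H = (\<lambda>\<kappa>. (\<Sum>p\<in>Pos. of_bool (\<kappa> p = a) * F (\<kappa>(p := b))) + fps_const (- c) * F \<kappa>)"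
    have ob: "fps_nth (of_bool q * G) i = of_bool q * fps_nth G i" for q i and G :: "complex fps" by (cases q) simp_all
    have coefH: "coef H i = (\<Sum>j\<in>{1..n}. pos_gl j a b (coef F i)) + fsc (- c) (coef F i)" for i
      unfolding sum_pos_gl_eq
      by (rule ext) (simp add: H_def coef_def color_gl_def fsc_def fps_sum_nth ob)
    have HT: "coef H i \<in> Tsp" for i
      unfolding coefH by (intro fv.subspace_add[OF subspace_Tsp] fv.subspace_scale[OF subspace_Tsp] sum_pos_gl_Tsp(1)[OF ab] FT)
    have PsiH: "Psi (coef H i) = gl_action n d E a b (coef (lift Psi F) i) - tscale c (coef (lift Psi F) i)" for i
    proof -
      have "x + fsc (- c) w = x - fsc c w" for x w :: tensor by (simp add: fsc_def fun_eq_iff)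
      then show ?thesis
        unfolding coefH fp.linear_add[OF flinear_Psi] fp.linear_scale[OF flinear_Psi] sum_pos_gl_Tsp(2)[OF ab FT] coef_lift tscale_eq_fsc
        by (simp only:)
    qed
    have "row_det [1..<N+1] (pos_X Pos (rxi v z \<circ> fst)) H \<kappa> = 0" if \<kappa>: "\<kappa> \<in> Idx" for \<kappa>
    proof -
      have good: "\<kappa>(p := b) ` Pos \<subseteq> {1..N}" if "p \<in> Pos" for p using Idx_image[OF Idx_upd[OF \<kappa> that ab(2)]] .
      have "row_det [1..<N+1] (pos_X Pos (rxi v (z \<circ> fst))) (\<lambda>\<kappa>. \<Sum>p\<in>Pos. of_bool (\<kappa> p = a) * F (\<kappa>(p := b))) \<kappa>
          = (\<Sum>p\<in>Pos. of_bool (\<kappa> p = a) * row_det [1..<N+1] (pos_X Pos (rxi v (z \<circ> fst))) F (\<kappa>(p := b)))"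
        by (rule Dpos_gl_commute[where zp = "z \<circ> fst"]) (fact N finite_Pos Idx_image[OF \<kappa>] ab(2) | erule zp)+
      also have "\<dots> = 0" unfolding xi by (intro sum.neutral ballI) (simp only: D[OF good] mult_zero_right)
      finally have 1: "row_det [1..<N+1] (pos_X Pos (rxi v z \<circ> fst)) (\<lambda>\<kappa>. \<Sum>p\<in>Pos. of_bool (\<kappa> p = a) * F (\<kappa>(p := b))) \<kappa> = 0"
        unfolding xi .
      have 2: "row_det [1..<N+1] (pos_X Pos (rxi v z \<circ> fst)) (\<lambda>\<kappa>. fps_const (- c) * F \<kappa>) \<kappa> = 0"
      proof -
        have "row_det [1..<N+1] (pos_X Pos (rxi v z \<circ> fst)) (\<lambda>\<kappa>. \<Sum>s\<in>{()}. fps_const (- c) * F \<kappa>) \<kappa>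
           = (\<Sum>s\<in>{()}. fps_const (- c) * row_det [1..<N+1] (pos_X Pos (rxi v z \<circ> fst)) F \<kappa>)"
          by (rule row_det_pos_X_lincomb)
        then show ?thesis
          unfolding D[OF Idx_image[OF \<kappa>]] by (simp only: sum.insert finite.emptyI sum.empty empty_iff simp_thms add_0_right mult_zero_right)
      qed
      show ?thesis unfolding H_def row_det_pos_X_add 1 2 by (rule add_0_right)
    qed
    then have sol: "row_det [1..<N+1] (gen_X {1..n} (rxi v z) op_M) (lift Psi H) = (\<lambda>k. 0)"
      by (rule Psi_solution[OF HT])
    interpret G0: gaudin_subspace N "{1..n}" "rxi v z" op_M "{0}" by (rule gaudin_0)
    have "coef (lift Psi H) l \<in> {0}"
    proof (rule G0.coef_in_of_row_det)
      fix i assume i: "i < N"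
      have "coef (lift Psi F) i = x i" using init[OF i] y[OF i] by simp
      then show "coef (lift Psi H) i \<in> {0}"
        unfolding coef_lift[of Psi H] PsiH by (simp only: gx[OF i] diff_self singleton_iff)
    next
      fix i
      show "coef (row_det [1..<N+1] (gen_X {1..n} (rxi v z) op_M) (lift Psi H)) i \<in> {0}"
        unfolding sol by (simp add: coef_def fun_eq_iff)
    qed
    then show "gl_action n d E a b (coef (lift Psi F) l) = tscale c (coef (lift Psi F) l)"
      unfolding coef_lift[of Psi H] PsiH by (simp only: singleton_iff right_minus_eq)
  qed
qed

end

lemma X_op_apply:
  "X_op n d E z a b f u k = (if a = b then deriv (\<lambda>w. f w k) u else 0)
     - (\<Sum>j\<in>{1..n}. 1 / (u - z j) * factor_op n d j (E j b a) (f u) k)"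
  by (simp add: X_op_def sum_fun_apply tscale_def)

lemma univ_diff_op_apply:
  "univ_diff_op N n d E z f u k
     = (\<Sum>\<sigma> | \<sigma> permutes {1..N}. of_int (sign \<sigma>) * foldr (\<lambda>a. X_op n d E z a (\<sigma> a)) [1..<N+1] f u k)"
  by (simp only: univ_diff_op_def sum_fun_apply tscale_def)

lemma factor_op_apply:
  "factor_op n d j A x k = (if k \<in> tensor_index n d then \<Sum>c<d j. A $$ (k j, c) * x (k(j := c)) else 0)"
  by (simp add: factor_op_def)

subsection \<open>Regularity and locality\<close>

definition hol_tensor :: "(complex \<Rightarrow> tensor) \<Rightarrow> complex set \<Rightarrow> bool" where
  "hol_tensor f S \<longleftrightarrow> (\<forall>k. (\<lambda>u. f u k) holomorphic_on S)"

lemma hol_factor_op: "hol_tensor f S \<Longrightarrow> (\<lambda>u. factor_op n d j A (f u) k) holomorphic_on S"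
  unfolding factor_op_apply hol_tensor_def by (cases "k \<in> tensor_index n d") (auto intro!: holomorphic_intros)

lemma hol_X_op:
  assumes "open S" "\<And>j. j \<in> {1..n} \<Longrightarrow> z j \<notin> S" "hol_tensor f S"
  shows "hol_tensor (X_op n d E z a b f) S"
  unfolding hol_tensor_def X_op_apply
proof (intro allI holomorphic_on_diff holomorphic_on_sum holomorphic_on_mult hol_factor_op[OF assms(3)], goal_cases)
  case (1 k)
  then show ?case using assms by (cases "a = b") (auto simp: hol_tensor_def intro!: holomorphic_deriv)
next
  case (2 k j)
  then show ?case using assms(2)[of j] by (intro holomorphic_intros) auto
qed

lemma hol_univ_diff_op:
  assumes "open S" "\<And>j. j \<in> {1..n} \<Longrightarrow> z j \<notin> S" "hol_tensor f S"
  shows "(\<lambda>u. univ_diff_op N n d E z f u k) holomorphic_on S"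
proof -
  have "hol_tensor (foldr (\<lambda>a. X_op n d E z a (\<sigma> a)) as f) S" for as \<sigma>
  proof (induction as)
    case (Cons a as)
    then show ?case using hol_X_op[where z = z, OF assms(1,2)] by simp
  qed (simp add: assms(3))
  then show ?thesis unfolding univ_diff_op_apply hol_tensor_def by (intro holomorphic_intros) blast
qed

lemma X_op_local:
  assumes "open S" "\<And>u. u \<in> S \<Longrightarrow> f u = g u" "u \<in> S"
  shows "X_op n d E z a b f u = X_op n d E z a b g u"
proof
  fix k
  have "eventually (\<lambda>w. w \<in> S) (nhds u)" using assms by (intro eventually_nhds_in_open)
  then have "eventually (\<lambda>w. f w k = g w k) (nhds u)"
    by (rule eventually_mono) (simp add: assms(2))
  then have "deriv (\<lambda>w. f w k) u = deriv (\<lambda>w. g w k) u" by (intro deriv_cong_ev refl)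
  then show "X_op n d E z a b f u k = X_op n d E z a b g u k"
    unfolding X_op_apply assms(2)[OF assms(3)] by simp
qed

text \<open>The operator sees only the germ of a function, which allows \<open>restrict0\<close> to
  be dropped at points of \<open>U\<close>.\<close>

lemma univ_diff_op_local:
  assumes "open S" "\<And>u. u \<in> S \<Longrightarrow> f u = g u" "u \<in> S"
  shows "univ_diff_op N n d E z f u = univ_diff_op N n d E z g u"
proof -
  have "foldr (\<lambda>a. X_op n d E z a (\<sigma> a)) as f u = foldr (\<lambda>a. X_op n d E z a (\<sigma> a)) as g u" if "u \<in> S" for u as \<sigma>
    using that
  proof (induction as arbitrary: u)
    case (Cons a as)
    then show ?case using X_op_local[OF assms(1) Cons.IH] by simp
  qed (simp add: assms(2))
  then show ?thesis unfolding univ_diff_op_def by (simp add: assms(3))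
qed

subsection \<open>Expansion at a regular point\<close>

definition tensor_fps :: "complex \<Rightarrow> (complex \<Rightarrow> tensor) \<Rightarrow> ((nat \<Rightarrow> nat) \<Rightarrow> complex fps) \<Rightarrow> bool" where
  "tensor_fps v f F \<longleftrightarrow> (\<forall>k. (\<lambda>t. f (v + t) k) has_fps_expansion F k)"

lemma has_fps_expansion_sum:
  fixes f :: "'i \<Rightarrow> complex \<Rightarrow> complex"
  shows "(\<And>i. i \<in> I \<Longrightarrow> f i has_fps_expansion F i) \<Longrightarrow> (\<lambda>x. \<Sum>i\<in>I. f i x) has_fps_expansion (\<Sum>i\<in>I. F i)"
  by (induction I rule: infinite_finite_induct) (auto intro!: has_fps_expansion_add)

lemma deriv_shift:
  fixes f :: "complex \<Rightarrow> complex"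
  shows "deriv (\<lambda>t. f (v + t)) t = deriv f (v + t)"
  unfolding deriv_def using DERIV_shift[of f _ t v] by (simp add: add.commute)

lemma tensor_fps_factor_op:
  assumes "tensor_fps v f F"
  shows "(\<lambda>t. factor_op n d j A (f (v + t)) k) has_fps_expansion lift (factor_op n d j A) F k"
proof (cases "k \<in> tensor_index n d")
  case True
  have "lift (factor_op n d j A) F k = (\<Sum>c<d j. fps_const (A $$ (k j, c)) * F (k(j := c)))"
    using True by (intro fps_ext) (simp add: lift_def factor_op_apply coef_def fps_sum_nth)
  moreover have "(\<lambda>t. \<Sum>c<d j. A $$ (k j, c) * f (v + t) (k(j := c))) has_fps_expansion
     (\<Sum>c<d j. fps_const (A $$ (k j, c)) * F (k(j := c)))"
    using assms by (intro has_fps_expansion_sum has_fps_expansion_cmult_left) (simp add: tensor_fps_def)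
  ultimately show ?thesis using True by (simp add: factor_op_apply)
next
  case False
  have "lift (factor_op n d j A) F k = 0"
    using False by (intro fps_ext) (simp add: lift_def factor_op_apply)
  then show ?thesis using False by (simp add: factor_op_apply)
qed

lemma tensor_fps_X_op:
  assumes z: "\<And>j. j \<in> {1..n} \<Longrightarrow> z j \<noteq> v" and f: "tensor_fps v f F"
  shows "tensor_fps v (X_op n d E z a b f) (gen_X {1..n} (rxi v z) (\<lambda>j a b. factor_op n d j (E j a b)) a b F)"
  unfolding tensor_fps_def
proof
  fix k
  have 1: "(\<lambda>t. if a = b then deriv (\<lambda>w. f w k) (v + t) else 0) has_fps_expansion of_bool (a = b) * fps_deriv (F k)"
  proof (cases "a = b")
    case True
    have "(\<lambda>t. deriv (\<lambda>w. f w k) (v + t)) has_fps_expansion fps_deriv (F k)"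
      unfolding deriv_shift[symmetric] by (rule has_fps_expansion_deriv) (use f in \<open>simp add: tensor_fps_def\<close>)
    then show ?thesis using True by simp
  qed simp
  have 2: "(\<lambda>t. 1 / (v + t - z j)) has_fps_expansion rxi v z j" if "j \<in> {1..n}" for j
  proof -
    have "(\<lambda>t. inverse (t + (v - z j))) has_fps_expansion inverse (fps_X + fps_const (v - z j))"
      by (intro has_fps_expansion_inverse has_fps_expansion_add has_fps_expansion_fps_X has_fps_expansion_const)
         (use z[OF that] in auto)
    then show ?thesis unfolding rxi_def by (simp add: inverse_eq_divide algebra_simps)
  qed
  show "(\<lambda>t. X_op n d E z a b f (v + t) k) has_fps_expansion gen_X {1..n} (rxi v z) (\<lambda>j a b. factor_op n d j (E j a b)) a b F k"
    unfolding X_op_apply gen_X_def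
    by (intro has_fps_expansion_diff has_fps_expansion_sum has_fps_expansion_mult 1 2 tensor_fps_factor_op f)
qed

lemma tensor_fps_univ_diff_op:
  assumes z: "\<And>j. j \<in> {1..n} \<Longrightarrow> z j \<noteq> v" and f: "tensor_fps v f F"
  shows "tensor_fps v (univ_diff_op N n d E z f)
    (row_det [1..<N+1] (gen_X {1..n} (rxi v z) (\<lambda>j a b. factor_op n d j (E j a b))) F)"
proof -
  let ?X = "gen_X {1..n} (rxi v z) (\<lambda>j a b. factor_op n d j (E j a b))"
  have "tensor_fps v (foldr (\<lambda>a. X_op n d E z a (\<sigma> a)) as f) (foldr (\<lambda>a. ?X a (\<sigma> a)) as F)" for as \<sigma>
  proof (induction as)
    case (Cons a as)
    then show ?case using tensor_fps_X_op[where z = z, OF z] by simp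
  qed (simp add: f)
  then have *: "(\<lambda>t. foldr (\<lambda>a. X_op n d E z a (\<sigma> a)) as f (v + t) k) has_fps_expansion foldr (\<lambda>a. ?X a (\<sigma> a)) as F k" for as \<sigma> k
    unfolding tensor_fps_def by blast
  have set: "set [1..<N+1] = {1..N}" by auto
  show ?thesis
    unfolding tensor_fps_def univ_diff_op_apply row_det_def set fps_of_int[symmetric]
    by (intro allI has_fps_expansion_sum has_fps_expansion_cmult_left *)
qed

lemma tensor_fps_exists:
  assumes "open S" "v \<in> S" "hol_tensor f S"
  obtains F where "tensor_fps v f F"
proof -
  have "(\<lambda>u. f u k) analytic_on {v}" for k
    using assms analytic_on_open[OF assms(1)] analytic_on_subset[of _ S "{v}"] by (auto simp: hol_tensor_def)
  then have "(\<lambda>t. f (v + t) k) has_fps_expansion fps_expansion (\<lambda>u. f u k) v" for k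
    by (rule analytic_at_imp_has_fps_expansion)
  then show ?thesis by (intro that[of "\<lambda>k. fps_expansion (\<lambda>u. f u k) v"]) (simp add: tensor_fps_def)
qed

lemma fps_expansion_0_imp_eq_0:
  fixes h :: "complex \<Rightarrow> complex"
  assumes S: "open S" "connected S" "v \<in> S" and h: "h holomorphic_on S" "(\<lambda>t. h (v + t)) has_fps_expansion 0" and u: "u \<in> S"
  shows "h u = 0"
proof -
  have "eventually (\<lambda>t. h (v + t) = 0) (nhds 0)" using h(2) by (simp add: has_fps_expansion_def)
  then obtain e where e: "e > 0" "\<And>t. norm t < e \<Longrightarrow> h (v + t) = 0"
    by (auto simp: eventually_nhds_metric dist_norm)
  obtain e' where e': "e' > 0" "ball v e' \<subseteq> S" using S openE by blast
  let ?B = "ball v (min e e')"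
  have hB: "h w = 0" if "w \<in> ?B" for w
    using e(2)[of "w - v"] that by (simp add: dist_norm norm_minus_commute)
  show ?thesis
  proof (rule analytic_continuation_open[of ?B S h "\<lambda>_. 0" u])
    show "?B \<noteq> {}" using e(1) e'(1) by simp
    show "?B \<subseteq> S" using e'(2) by auto
  qed (use S h(1) u hB in auto)
qed

lemma has_fps_expansion_0_of_eq_0:
  fixes h :: "complex \<Rightarrow> complex"
  assumes "open S" "v \<in> S" "\<And>u. u \<in> S \<Longrightarrow> h u = 0" "(\<lambda>t. h (v + t)) has_fps_expansion F"
  shows "F = 0"
proof -
  have "eventually (\<lambda>t. t \<in> (\<lambda>t. v + t) -` S) (nhds 0)"
    using assms(1,2) by (intro eventually_nhds_in_open open_vimage) (auto intro: continuous_intros)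
  then have "eventually (\<lambda>t. h (v + t) = 0) (nhds 0)"
    by (rule eventually_mono) (use assms(3) in auto)
  then have "(\<lambda>t. h (v + t)) has_fps_expansion 0"
    by (simp add: has_fps_expansion_def)
  then show ?thesis using assms(4) fps_expansion_unique_complex by blast
qed

subsection \<open>Expansion at infinity\<close>

text \<open>\<open>f u = u\<^sup>r g (1 / u)\<close> for \<open>\<bar>u\<bar> > 1 / \<delta>\<close>, with \<open>g\<close> holomorphic near \<open>0\<close>.\<close>

definition inf_exp :: "real \<Rightarrow> (complex \<Rightarrow> tensor) \<Rightarrow> int \<Rightarrow> (complex \<Rightarrow> tensor) \<Rightarrow> bool" where
  "inf_exp \<delta> f r g \<longleftrightarrow> hol_tensor g (ball 0 \<delta>) \<and> (\<forall>u k. norm (inverse u) < \<delta> \<longrightarrow> u \<noteq> 0 \<longrightarrow> f u k = u powi r * g (inverse u) k)"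

lemma factor_op_scale: "factor_op n d j A (\<lambda>k. c * x k) k = c * factor_op n d j A x k"
  by (simp add: factor_op_apply sum_distrib_left mult.left_commute)

text \<open>In the variable \<open>s = 1 / u\<close>, deriving \<open>u powi r * g s\<close> gives
  \<open>u powi (r - 1)\<close> times \<open>r * g s - s * deriv g s\<close>, and
  \<open>1 / (u - z)\<close> is \<open>s / (1 - z * s)\<close>. Both lower the exponent by one and
  stay holomorphic at \<open>s = 0\<close>, where only \<open>r * g 0\<close> and the diagonal
  action survive.\<close>

lemma inf_exp_X_op:
  assumes \<delta>: "\<delta> > 0" "\<And>j. j \<in> {1..n} \<Longrightarrow> norm (z j) * \<delta> < 1" and f: "inf_exp \<delta> f r g"
  obtains g' where "inf_exp \<delta> (X_op n d E z a b f) (r - 1) g'"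
    "g' 0 = (if a = b then tscale (of_int r) (g 0) else 0) - gl_action n d E b a (g 0)"
proof -
  have holg: "(\<lambda>s. g s k) holomorphic_on ball 0 \<delta>" for k using f by (simp add: inf_exp_def hol_tensor_def)
  have fu: "f u k = u powi r * g (inverse u) k" if "norm (inverse u) < \<delta>" "u \<noteq> 0" for u k
    using f that by (simp add: inf_exp_def)
  define g' where "g' = (\<lambda>s k. (if a = b then of_int r * g s k - s * deriv (\<lambda>s. g s k) s else 0)
     - (\<Sum>j\<in>{1..n}. 1 / (1 - z j * s) * factor_op n d j (E j b a) (g s) k))"
  have nz: "1 - z j * s \<noteq> 0" if "j \<in> {1..n}" "norm s < \<delta>" for j s
  proof
    assume "1 - z j * s = 0"
    then have "norm (z j * s) = 1" by simp
    moreover have "norm (z j) * norm s \<le> norm (z j) * \<delta>" using that by (intro mult_left_mono) auto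
    ultimately show False using \<delta>(2)[OF that(1)] by (simp add: norm_mult)
  qed
  have "hol_tensor g' (ball 0 \<delta>)"
    unfolding hol_tensor_def g'_def
  proof (intro allI holomorphic_on_diff holomorphic_on_sum holomorphic_on_mult hol_factor_op, goal_cases)
    case (1 k)
    then show ?case using holg by (cases "a = b") (auto intro!: holomorphic_intros holomorphic_deriv)
  next
    case (2 k j)
    then show ?case using nz by (intro holomorphic_intros) auto
  next
    case (3 k j)
    then show ?case using holg by (simp add: hol_tensor_def)
  qed
  moreover have "X_op n d E z a b f u k = u powi (r - 1) * g' (inverse u) k" if u: "norm (inverse u) < \<delta>" "u \<noteq> 0" for u k
  proof -
    \<comment> \<open>Since \<open>inverse 0 = 0\<close>, the point 0 satisfies the norm condition
      and has to be removed.\<close>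
    let ?S = "{u :: complex. norm (inverse u) < \<delta>} \<inter> - {0}"
    have "?S = - cball 0 (inverse \<delta>)"
    proof -
      have "norm (inverse u) < \<delta> \<and> u \<noteq> 0 \<longleftrightarrow> inverse \<delta> < norm u" for u :: complex
      proof (cases "u = 0")
        case True
        then show ?thesis using \<delta>(1) by simp
      next
        case False
        then have "norm u > 0" by simp
        then show ?thesis using False \<delta>(1) unfolding norm_inverse by (simp add: field_simps)
      qed
      then have "?S = {u. inverse \<delta> < norm u}" by blast
      also have "\<dots> = - cball 0 (inverse \<delta>)" by (auto simp: not_le)
      finally show ?thesis .
    qed
    then have S: "open ?S" by (simp only: open_Compl closed_cball)
    have "((\<lambda>w. w powi r * g (inverse w) k) has_field_derivative
        (of_int r * u powi (r - 1) * g (inverse u) k + u powi r * (deriv (\<lambda>s. g s k) (inverse u) * (- (inverse u)\<^sup>2)))) (at u)"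
    proof -
      have dg: "((\<lambda>s. g s k) has_field_derivative deriv (\<lambda>s. g s k) (inverse u)) (at (inverse u))"
        using holg u(1) by (intro holomorphic_derivI[of _ "ball 0 \<delta>"]) auto
      have di: "(inverse has_field_derivative - (inverse u)\<^sup>2) (at u)"
        using DERIV_inverse[OF u(2)] by (simp add: power2_eq_square numeral_2_eq_2)
      have pg: "((\<lambda>w. g (inverse w) k) has_field_derivative deriv (\<lambda>s. g s k) (inverse u) * (- (inverse u)\<^sup>2)) (at u)"
        using DERIV_chain2[OF dg di] .
      have pp: "((\<lambda>w. w powi r) has_field_derivative of_int r * u powi (r - 1)) (at u)"
        using u(2) by (auto intro!: derivative_eq_intros)
      show ?thesis using DERIV_mult[OF pp pg] by (simp only: mult.commute add.commute)
    qed
    then have "deriv (\<lambda>w. w powi r * g (inverse w) k) u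
        = of_int r * u powi (r - 1) * g (inverse u) k + u powi r * (deriv (\<lambda>s. g s k) (inverse u) * (- (inverse u)\<^sup>2))"
      by (rule DERIV_imp_deriv)
    also have "u powi r = u powi (r - 1) * u" using u(2) by (simp add: power_int_diff)
    also have "of_int r * u powi (r - 1) * g (inverse u) k + u powi (r - 1) * u * (deriv (\<lambda>s. g s k) (inverse u) * (- (inverse u)\<^sup>2))
       = u powi (r - 1) * (of_int r * g (inverse u) k - inverse u * deriv (\<lambda>s. g s k) (inverse u))"
      using u(2) by (simp add: power2_eq_square field_simps)
    finally have d0: "deriv (\<lambda>w. w powi r * g (inverse w) k) u
        = u powi (r - 1) * (of_int r * g (inverse u) k - inverse u * deriv (\<lambda>s. g s k) (inverse u))" .
    have "eventually (\<lambda>w. w \<in> ?S) (nhds u)" using S u by (intro eventually_nhds_in_open) auto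
    then have "eventually (\<lambda>w. f w k = w powi r * g (inverse w) k) (nhds u)"
      by (rule eventually_mono) (simp add: fu)
    then have "deriv (\<lambda>w. f w k) u = deriv (\<lambda>w. w powi r * g (inverse w) k) u" by (intro deriv_cong_ev refl)
    then have d: "deriv (\<lambda>w. f w k) u = u powi (r - 1) * (of_int r * g (inverse u) k - inverse u * deriv (\<lambda>s. g s k) (inverse u))"
      by (simp only: d0)
    have e: "1 / (u - z j) * factor_op n d j (E j b a) (f u) k
        = u powi (r - 1) * (1 / (1 - z j * inverse u) * factor_op n d j (E j b a) (g (inverse u)) k)" if "j \<in> {1..n}" for j
    proof -
      have "f u = (\<lambda>k. u powi r * g (inverse u) k)" using fu[OF u] by (intro ext)
      then have "factor_op n d j (E j b a) (f u) k = u powi r * factor_op n d j (E j b a) (g (inverse u)) k"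
        by (simp only: factor_op_scale)
      moreover have "1 / (u - z j) * u powi r = u powi (r - 1) * (1 / (1 - z j * inverse u))"
      proof -
        have "u - z j = u * (1 - z j * inverse u)" using u(2) by (simp add: field_simps)
        then show ?thesis using u(2) by (simp add: power_int_diff field_simps)
      qed
      ultimately show ?thesis by (metis mult.assoc)
    qed
    have "(\<Sum>j\<in>{1..n}. 1 / (u - z j) * factor_op n d j (E j b a) (f u) k)
       = u powi (r - 1) * (\<Sum>j\<in>{1..n}. 1 / (1 - z j * inverse u) * factor_op n d j (E j b a) (g (inverse u)) k)"
      unfolding sum_distrib_left by (intro sum.cong refl e)
    then show ?thesis unfolding X_op_apply g'_def d by (simp only: right_diff_distrib split: if_split) simp
  qed
  ultimately have "inf_exp \<delta> (X_op n d E z a b f) (r - 1) g'" by (simp add: inf_exp_def)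
  moreover have "g' 0 = (if a = b then tscale (of_int r) (g 0) else 0) - gl_action n d E b a (g 0)"
    by (rule ext) (simp add: g'_def gl_action_def sum_fun_apply tscale_def)
  ultimately show ?thesis by (rule that)
qed

lemma flinear_gl_action: "flinear (gl_action n d E a b)"
proof -
  have "gl_action n d E a b = (\<lambda>x. \<Sum>j\<in>{1..n}. factor_op n d j (E j a b) x)" by (rule ext) (simp add: gl_action_def)
  then show ?thesis
    by (intro flinearI)
       (simp_all only: fp.linear_add[OF flinear_factor_op] fp.linear_scale[OF flinear_factor_op] sum.distrib fv.scale_sum_right)
qed

lemma subspace_Sing: "fv.subspace (Sing N n d E m)"
  unfolding fv.subspace_def
proof (intro conjI ballI allI)
  note lin = fp.linear_add[OF flinear_gl_action] fp.linear_scale[OF flinear_gl_action] fp.linear_0[OF flinear_gl_action]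
  show "0 \<in> Sing N n d E m"
    by (simp add: Sing_def weight_space_def tensor_space_def tscale_eq_fsc lin)
  fix x y assume "x \<in> Sing N n d E m" "y \<in> Sing N n d E m"
  then show "x + y \<in> Sing N n d E m"
    by (simp add: Sing_def weight_space_def tensor_space_def tscale_eq_fsc lin fv.scale_right_distrib)
next
  note lin = fp.linear_add[OF flinear_gl_action] fp.linear_scale[OF flinear_gl_action] fp.linear_0[OF flinear_gl_action]
  fix c x assume x: "x \<in> Sing N n d E m"
  then have "\<And>a. a \<in> {1..N} \<Longrightarrow> gl_action n d E a a (fsc c x) = fsc (m a) (fsc c x)"
    unfolding Sing_def weight_space_def tscale_eq_fsc lin by (simp add: mult.commute)
  moreover have "\<And>a b. a \<in> {1..N} \<Longrightarrow> b \<in> {1..N} \<Longrightarrow> a < b \<Longrightarrow> gl_action n d E a b (fsc c x) = 0"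
    using x unfolding Sing_def lin by simp
  moreover have "fsc c x \<in> tensor_space n d" using x by (simp add: Sing_def weight_space_def tensor_space_def fsc_def)
  ultimately show "fsc c x \<in> Sing N n d E m"
    unfolding Sing_def weight_space_def tscale_eq_fsc by blast
qed

subsection \<open>The indicial equation at infinity\<close>

text \<open>The leading coefficient at infinity of the iterated operators. The exponent has dropped
  by \<open>length as\<close> before row \<open>a\<close> is applied, and seen from infinity all
  points coincide, which leaves the diagonal action.\<close>

fun lead :: "nat \<Rightarrow> (nat \<Rightarrow> nat) \<Rightarrow> (nat \<Rightarrow> nat \<Rightarrow> nat \<Rightarrow> complex mat) \<Rightarrow> (nat \<Rightarrow> nat) \<Rightarrow> nat list \<Rightarrow> int \<Rightarrow> tensor \<Rightarrow> tensor" where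
  "lead n d E \<sigma> [] r x = x"
| "lead n d E \<sigma> (a # as) r x = (if a = \<sigma> a then tscale (of_int (r - int (length as))) (lead n d E \<sigma> as r x) else 0)
     - gl_action n d E (\<sigma> a) a (lead n d E \<sigma> as r x)"

lemma inf_exp_foldr:
  assumes "\<delta> > 0" "\<And>j. j \<in> {1..n} \<Longrightarrow> norm (z j) * \<delta> < 1" "inf_exp \<delta> f r g"
  shows "\<exists>g'. inf_exp \<delta> (foldr (\<lambda>a. X_op n d E z a (\<sigma> a)) as f) (r - int (length as)) g' \<and> g' 0 = lead n d E \<sigma> as r (g 0)"
proof (induction as)
  case Nil
  then show ?case using assms(3) by auto
next
  case (Cons a as)
  then obtain g1 where g1: "inf_exp \<delta> (foldr (\<lambda>a. X_op n d E z a (\<sigma> a)) as f) (r - int (length as)) g1" "g1 0 = lead n d E \<sigma> as r (g 0)"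
    by blast
  obtain g2 where "inf_exp \<delta> (X_op n d E z a (\<sigma> a) (foldr (\<lambda>a. X_op n d E z a (\<sigma> a)) as f)) (r - int (length as) - 1) g2"
    "g2 0 = (if a = \<sigma> a then tscale (of_int (r - int (length as))) (g1 0) else 0) - gl_action n d E (\<sigma> a) a (g1 0)"
    by (rule inf_exp_X_op[OF assms(1,2) g1(1)])
  moreover have "r - int (length as) - 1 = r - int (length (a # as))" by simp
  ultimately show ?case unfolding g1(2) foldr.simps o_apply lead.simps by metis
qed

text \<open>Rows are applied from the last one up. At the last row \<open>a\<close> with
  \<open>\<sigma> a \<noteq> a\<close> all larger values are taken by fixed rows, so
  \<open>\<sigma> a < a\<close> and the generator is a raising one, which kills the singular vector.
  Only fixed rows survive, with factors given by the weight.\<close>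

lemma lead_Sing:
  assumes x: "x \<in> Sing N n d E m" and \<sigma>: "\<sigma> permutes {1..N}" and a: "1 \<le> a" "a \<le> Suc N"
  shows "lead n d E \<sigma> [a..<N+1] r x
    = (if \<forall>b\<in>{a..N}. \<sigma> b = b then fsc (\<Prod>b\<in>{a..N}. of_int r - of_nat (N - b) - m b) x else 0)"
  using a(2,1)
proof (induction rule: inc_induct)
  case base
  have "fsc 1 x = x" by (simp add: fsc_def)
  then show ?case by simp
next
  case (step a)
  let ?y = "lead n d E \<sigma> [Suc a..<N+1] r x"
  have aN: "a \<in> {1..N}" using step by auto
  have IH: "?y = (if \<forall>b\<in>{Suc a..N}. \<sigma> b = b then fsc (\<Prod>b\<in>{Suc a..N}. of_int r - of_nat (N - b) - m b) x else 0)"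
    by (rule step.IH) simp
  have up: "[a..<N+1] = a # [Suc a..<N+1]" using step by (intro upt_conv_Cons) simp
  have set: "{a..N} = insert a {Suc a..N}" using step by auto
  have len: "length [Suc a..<N+1] = N - a" using aN by (simp only: length_upt)
  have eq: "lead n d E \<sigma> [a..<N+1] r x = (if a = \<sigma> a then fsc (of_int (r - int (N - a))) ?y else 0) - gl_action n d E (\<sigma> a) a ?y"
    unfolding up lead.simps tscale_eq_fsc len ..
  show ?case
  proof (cases "\<forall>b\<in>{Suc a..N}. \<sigma> b = b")
    case False
    then have "?y = 0" unfolding IH by (simp only: if_False)
    then have "lead n d E \<sigma> [a..<N+1] r x = 0" unfolding eq by (simp add: fp.linear_0[OF flinear_gl_action])
    moreover have "\<not> (\<forall>b\<in>{a..N}. \<sigma> b = b)" using False set by auto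
    ultimately show ?thesis by (simp only: if_False)
  next
    case True
    define c where "c = (\<Prod>b\<in>{Suc a..N}. of_int r - of_nat (N - b) - m b)"
    have y: "?y = fsc c x" unfolding IH c_def by (rule if_P[OF True])
    have gl: "gl_action n d E (\<sigma> a) a ?y = fsc c (gl_action n d E (\<sigma> a) a x)"
      unfolding y by (rule fp.linear_scale[OF flinear_gl_action])
    show ?thesis
    proof (cases "\<sigma> a = a")
      case True
      have "gl_action n d E a a x = fsc (m a) x" using x aN unfolding Sing_def weight_space_def tscale_eq_fsc by blast
      then have "lead n d E \<sigma> [a..<N+1] r x = fsc (of_int (r - int (N - a))) (fsc c x) - fsc c (fsc (m a) x)"
        unfolding eq gl unfolding y True \<open>gl_action n d E a a x = fsc (m a) x\<close> by (simp only: if_True simp_thms)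
      also have "\<dots> = fsc ((of_int r - of_nat (N - a) - m a) * c) x"
        by (simp add: fsc_def fun_eq_iff algebra_simps)
      also have "(of_int r - of_nat (N - a) - m a) * c = (\<Prod>b\<in>{a..N}. of_int r - of_nat (N - b) - m b)"
        unfolding c_def set by (subst prod.insert) auto
      finally show ?thesis using True \<open>\<forall>b\<in>{Suc a..N}. \<sigma> b = b\<close> set by simp
    next
      case False
      have "\<sigma> a \<in> {1..N}" using \<sigma> aN permutes_in_image by metis
      moreover have "\<sigma> a \<notin> {Suc a..N}"
      proof
        assume b: "\<sigma> a \<in> {Suc a..N}"
        then have "\<sigma> (\<sigma> a) = \<sigma> a" using True by blast
        then have "\<sigma> a = a" using permutes_inj[OF \<sigma>] by (simp add: inj_eq)
        then show False using False by simp
      qed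
      ultimately have "\<sigma> a < a" using False by auto
      then have "gl_action n d E (\<sigma> a) a x = 0" using x aN \<open>\<sigma> a \<in> {1..N}\<close> unfolding Sing_def by blast
      then have "lead n d E \<sigma> [a..<N+1] r x = 0" unfolding eq gl using False by simp
      moreover have "\<not> (\<forall>b\<in>{a..N}. \<sigma> b = b)" using False set by auto
      ultimately show ?thesis by (simp only: if_False)
    qed
  qed
qed

text \<open>At infinity only the identity permutation contributes, with the product of the factors
  \<open>r - (N - b) - m b\<close>. The power of \<open>u\<close> is divided off at finite points,
  and continuity at \<open>s = 0\<close> makes the product vanish.\<close>

lemma indicial_equation:
  assumes \<delta>: "\<delta> > 0" "\<And>j. j \<in> {1..n} \<Longrightarrow> norm (z j) * \<delta> < 1" and f: "inf_exp \<delta> f (int r) g"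
    and D: "\<And>u. norm (inverse u) < \<delta> \<Longrightarrow> u \<noteq> 0 \<Longrightarrow> univ_diff_op N n d E z f u = 0"
    and x: "g 0 \<in> Sing N n d E m" "g 0 \<noteq> 0" and N: "1 \<le> N"
  shows "\<exists>i\<in>{1..N}. of_nat r = m i + of_nat N - of_nat i"
proof -
  have "\<exists>g'. inf_exp \<delta> (foldr (\<lambda>a. X_op n d E z a (\<sigma> a)) [1..<N+1] f) (int r - int N) g'
      \<and> g' 0 = lead n d E \<sigma> [1..<N+1] (int r) (g 0)" for \<sigma>
    using inf_exp_foldr[where z = z and as = "[1..<N+1]", OF \<delta> f] by (simp del: upt_Suc)
  then obtain G where G: "\<And>\<sigma>. inf_exp \<delta> (foldr (\<lambda>a. X_op n d E z a (\<sigma> a)) [1..<N+1] f) (int r - int N) (G \<sigma>)"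
      "\<And>\<sigma>. G \<sigma> 0 = lead n d E \<sigma> [1..<N+1] (int r) (g 0)" by metis
  obtain k where k: "g 0 k \<noteq> 0" using x(2) by (auto simp: fun_eq_iff)
  define h where "h = (\<lambda>s. \<Sum>\<sigma> | \<sigma> permutes {1..N}. of_int (sign \<sigma>) * G \<sigma> s k)"
  have "h holomorphic_on ball 0 \<delta>"
    using G(1) unfolding h_def inf_exp_def hol_tensor_def by (intro holomorphic_intros) blast
  then have "isCont h 0"
    using \<delta>(1) by (intro continuous_on_interior[OF holomorphic_on_imp_continuous_on]) auto
  moreover have "eventually (\<lambda>s. h s = 0) (at 0)"
  proof -
    have "eventually (\<lambda>s. s \<in> ball 0 \<delta> - {0}) (at (0 :: complex))"
      using \<delta>(1) by (intro eventually_at_in_open) auto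
    then show ?thesis
    proof (rule eventually_mono)
      fix s :: complex assume s: "s \<in> ball 0 \<delta> - {0}"
      let ?u = "inverse s"
      have u: "norm (inverse ?u) < \<delta>" "?u \<noteq> 0" using s by auto
      have "foldr (\<lambda>a. X_op n d E z a (\<sigma> a)) [1..<N+1] f ?u k = ?u powi (int r - int N) * G \<sigma> s k" for \<sigma>
        using G(1)[of \<sigma>] u unfolding inf_exp_def by auto
      then have "univ_diff_op N n d E z f ?u k = ?u powi (int r - int N) * h s"
        unfolding univ_diff_op_apply h_def sum_distrib_left by (simp only: mult.left_commute)
      then show "h s = 0" using D[OF u] u(2) by simp
    qed
  qed
  ultimately have h0: "h 0 = 0"
    using tendsto_unique[of "at (0::complex)" h "h 0" 0] by (simp add: isCont_def tendsto_eventually)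
  have "G \<sigma> 0 = (if \<sigma> = id then fsc (\<Prod>b\<in>{1..N}. of_nat r - of_nat (N - b) - m b) (g 0) else 0)" if "\<sigma> permutes {1..N}" for \<sigma>
  proof -
    have "(\<forall>b\<in>{1..N}. \<sigma> b = b) \<longleftrightarrow> \<sigma> = id" using that permutes_not_in[OF that] by (auto simp: fun_eq_iff)
    then show ?thesis unfolding G(2) using lead_Sing[OF x(1) that, of 1 "int r"] by simp
  qed
  then have "h 0 = (\<Sum>\<sigma> | \<sigma> permutes {1..N}. if \<sigma> = id then (\<Prod>b\<in>{1..N}. of_nat r - of_nat (N - b) - m b) * g 0 k else 0)"
    unfolding h_def by (intro sum.cong refl) (auto simp: fsc_def)
  also have "\<dots> = (\<Prod>b\<in>{1..N}. of_nat r - of_nat (N - b) - m b) * g 0 k"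
    by (simp add: finite_permutations)
  finally have "(\<Prod>b\<in>{1..N}. of_nat r - of_nat (N - b) - m b) = 0" using h0 k by simp
  then obtain b where "b \<in> {1..N}" "of_nat r - of_nat (N - b) - m b = 0" by auto
  then show ?thesis by (intro bexI[of _ b]) (auto simp: of_nat_diff algebra_simps)
qed

subsection \<open>Polynomial functions with values in tensors\<close>

definition tpoly :: "nat \<Rightarrow> (nat \<Rightarrow> tensor) \<Rightarrow> complex \<Rightarrow> tensor" where
  "tpoly r w u = (\<Sum>l<r. fsc (u ^ l) (w l))"

lemma tpoly_apply: "tpoly r w u k = (\<Sum>l<r. u ^ l * w l k)"
  by (simp add: tpoly_def sum_fun_apply fsc_def)

lemma hol_tpoly: "hol_tensor (tpoly r w) S"
  unfolding hol_tensor_def tpoly_apply by (intro allI holomorphic_intros)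

lemma tensor_poly_eq_tpoly: "tensor_poly r (\<lambda>k. w (r - k)) = tpoly (Suc r) w"
  unfolding tensor_poly_def tpoly_def tscale_eq_fsc lessThan_Suc_atMost
  by (rule ext, rule sum.reindex_bij_witness[of _ "\<lambda>k. r - k" "\<lambda>k. r - k"]) auto

lemma tpoly_shrink: "r \<le> s \<Longrightarrow> (\<And>l. r \<le> l \<Longrightarrow> w l = 0) \<Longrightarrow> tpoly s w = tpoly r w"
  unfolding tpoly_def by (rule ext, rule sum.mono_neutral_right) auto

lemma inf_exp_tpoly:
  "inf_exp \<delta> (tpoly (Suc r) w) (int r) (\<lambda>s. \<Sum>l\<le>r. fsc (s ^ (r - l)) (w l))"
  unfolding inf_exp_def
proof (intro conjI allI impI)
  show "hol_tensor (\<lambda>s. \<Sum>l\<le>r. fsc (s ^ (r - l)) (w l)) (ball 0 \<delta>)"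
    unfolding hol_tensor_def sum_fun_apply fsc_def by (intro allI holomorphic_intros)
next
  fix u :: complex and k assume "u \<noteq> 0"
  have pw: "u ^ l * x = u powi int r * (inverse u ^ (r - l) * x)" if "l \<le> r" for l x
    using \<open>u \<noteq> 0\<close> that by (simp add: power_diff field_simps)
  show "tpoly (Suc r) w u k = u powi int r * (\<Sum>l\<le>r. fsc (inverse u ^ (r - l)) (w l)) k"
    unfolding tpoly_apply sum_fun_apply fsc_def lessThan_Suc_atMost sum_distrib_left
    by (rule sum.cong[OF refl], rule pw) simp
qed

lemma tpoly_degree:
  assumes N: "1 \<le> N" and w: "\<And>l. w l \<in> Sing N n d E m" "w r \<noteq> 0"
    and D: "\<And>u. u \<in> - z ` {1..n} \<Longrightarrow> univ_diff_op N n d E z (tpoly (Suc r) w) u = 0"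
  shows "\<exists>i\<in>{1..N}. of_nat r = m i + of_nat N - of_nat i"
proof -
  \<comment> \<open>Larger than every \<open>norm (z j)\<close>, and positive even if there are no
    points.\<close>
  define M where "M = 1 + (\<Sum>j\<in>{1..n}. norm (z j))"
  have M: "M > 0" unfolding M_def by (intro add_pos_nonneg sum_nonneg) auto
  have zM: "norm (z j) < M" if "j \<in> {1..n}" for j
    using member_le_sum[of j "{1..n}" "\<lambda>j. norm (z j)"] that by (simp add: M_def)
  let ?g = "\<lambda>s. \<Sum>l\<le>r. fsc (s ^ (r - l)) (w l)"
  have g0: "?g 0 = w r"
  proof -
    have "?g 0 = (\<Sum>l\<in>{r}. fsc (0 ^ (r - l)) (w l))"
      by (rule sum.mono_neutral_right) auto
    then show ?thesis by simp
  qed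
  show ?thesis
  proof (rule indicial_equation[where \<delta> = "inverse M" and z = z and f = "tpoly (Suc r) w" and g = ?g])
    show "inverse M > 0" using M by simp
    show "norm (z j) * inverse M < 1" if "j \<in> {1..n}" for j using zM[OF that] M by (simp add: field_simps)
    show "inf_exp (inverse M) (tpoly (Suc r) w) (int r) ?g" by (rule inf_exp_tpoly)
    show "?g 0 \<in> Sing N n d E m" unfolding g0 by (rule w)
    show "?g 0 \<noteq> 0" unfolding g0 by (rule w)
    show "1 \<le> N" by (rule N)
    fix u :: complex assume u: "norm (inverse u) < inverse M" "u \<noteq> 0"
    then have "M < norm u" using M by (simp add: norm_inverse)
    then have "z j \<noteq> u" if "j \<in> {1..n}" for j using zM[OF that] by (metis less_asym)
    then have "u \<in> - z ` {1..n}" by blast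
    then show "univ_diff_op N n d E z (tpoly (Suc r) w) u = 0" by (rule D)
  qed
qed

lemma tpoly_recenter:
  assumes W: "fv.subspace W" "\<And>l. c l \<in> W" and c0: "\<And>l. B \<le> l \<Longrightarrow> c l = 0"
  obtains w where "\<And>l. w l \<in> W" "\<And>l. B \<le> l \<Longrightarrow> w l = 0" "\<And>u. tpoly B w u = (\<Sum>l<B. fsc ((u - v) ^ l) (c l))"
proof -
  let ?p = "\<lambda>l. [:- v, 1:] ^ l"
  define w where "w = (\<lambda>i. if i < B then \<Sum>l<B. fsc (Polynomial.coeff (?p l) i) (c l) else 0)"
  have "w i \<in> W" for i unfolding w_def
    using fv.subspace_0[OF W(1)] by (auto intro!: fv.subspace_sum[OF W(1)] fv.subspace_scale[OF W(1)] W(2))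
  moreover have "tpoly B w u = (\<Sum>l<B. fsc ((u - v) ^ l) (c l))" for u
  proof
    fix k
    have pw: "(u - v) ^ l = (\<Sum>i<B. u ^ i * Polynomial.coeff (?p l) i)" if "l < B" for l
    proof -
      have "Polynomial.degree (?p l) \<le> l" using degree_power_le[of "[:- v, 1:]" l] by simp
      then have "(\<Sum>i<B. u ^ i * Polynomial.coeff (?p l) i) = (\<Sum>i\<le>Polynomial.degree (?p l). u ^ i * Polynomial.coeff (?p l) i)"
        using that by (intro sum.mono_neutral_right) (auto simp: coeff_eq_0)
      also have "\<dots> = poly (?p l) u" by (simp add: poly_altdef mult.commute)
      finally show ?thesis by simp
    qed
    have "tpoly B w u k = (\<Sum>i<B. \<Sum>l<B. u ^ i * Polynomial.coeff (?p l) i * c l k)"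
      unfolding tpoly_apply w_def by (intro sum.cong refl) (simp add: sum_fun_apply fsc_def sum_distrib_left mult.assoc)
    also have "\<dots> = (\<Sum>l<B. (\<Sum>i<B. u ^ i * Polynomial.coeff (?p l) i) * c l k)"
      unfolding sum_distrib_right by (rule sum.swap)
    also have "\<dots> = (\<Sum>l<B. (u - v) ^ l * c l k)" by (intro sum.cong refl) (simp only: pw lessThan_iff)
    finally show "tpoly B w u k = (\<Sum>l<B. fsc ((u - v) ^ l) (c l)) k" by (simp add: sum_fun_apply fsc_def)
  qed
  moreover have "w l = 0" if "B \<le> l" for l using that by (simp add: w_def)
  ultimately show ?thesis by (intro that) blast+
qed

subsection \<open>Linearity on holomorphic functions\<close>

text \<open>The additivity of \<open>deriv\<close> requires both functions to be differentiable at
  the point, hence the holomorphy.\<close>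

lemma X_op_lincomb:
  assumes "open S" "hol_tensor f S" "hol_tensor g S" "u \<in> S"
  shows "X_op n d E z a b (\<lambda>u. fsc c (f u) + g u) u = fsc c (X_op n d E z a b f u) + X_op n d E z a b g u"
proof
  fix k
  have "(\<lambda>u. f u k) field_differentiable at u" "(\<lambda>u. g u k) field_differentiable at u"
    using assms holomorphic_on_imp_differentiable_at unfolding hol_tensor_def by blast+
  then have "deriv (\<lambda>w. c * f w k + g w k) u = c * deriv (\<lambda>w. f w k) u + deriv (\<lambda>w. g w k) u"
    by (subst deriv_add) (auto intro!: derivative_intros field_differentiable_mult)
  then have d: "deriv (\<lambda>w. (fsc c (f w) + g w) k) u = c * deriv (\<lambda>w. f w k) u + deriv (\<lambda>w. g w k) u"
    unfolding plus_fun_apply fsc_def .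
  have e: "factor_op n d j A (fsc c (f u) + g u) k = c * factor_op n d j A (f u) k + factor_op n d j A (g u) k" for j A
    unfolding fp.linear_add[OF flinear_factor_op] fp.linear_scale[OF flinear_factor_op] by (simp add: fsc_def)
  have s: "(\<Sum>j\<in>{1..n}. 1 / (u - z j) * (c * factor_op n d j (E j b a) (f u) k + factor_op n d j (E j b a) (g u) k))
    = c * (\<Sum>j\<in>{1..n}. 1 / (u - z j) * factor_op n d j (E j b a) (f u) k) + (\<Sum>j\<in>{1..n}. 1 / (u - z j) * factor_op n d j (E j b a) (g u) k)"
    by (simp only: distrib_left sum.distrib sum_distrib_left mult.left_commute)
  have split: "(if a = b then c * p + q else 0) - (c * A + B) = c * ((if a = b then p else 0) - A) + ((if a = b then q else 0) - B)" for p q A B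
    by (simp add: algebra_simps)
  show "X_op n d E z a b (\<lambda>u. fsc c (f u) + g u) u k = (fsc c (X_op n d E z a b f u) + X_op n d E z a b g u) k"
    unfolding plus_fun_apply fsc_def[of _ "X_op n d E z a b f u"] X_op_apply d[unfolded plus_fun_apply] e[unfolded plus_fun_apply] s
    by (rule split)
qed

lemma univ_diff_op_lincomb:
  assumes S: "open S" "\<And>j. j \<in> {1..n} \<Longrightarrow> z j \<notin> S" and "hol_tensor f S" "hol_tensor g S" "u \<in> S"
  shows "univ_diff_op N n d E z (\<lambda>u. fsc c (f u) + g u) u = fsc c (univ_diff_op N n d E z f u) + univ_diff_op N n d E z g u"
proof -
  let ?F = "\<lambda>\<sigma> as. foldr (\<lambda>a. X_op n d E z a (\<sigma> a)) as"
  have hol: "hol_tensor (?F \<sigma> as f) S" if "hol_tensor f S" for \<sigma> as f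
  proof (induction as)
    case (Cons a as)
    then show ?case using hol_X_op[where z = z, OF S] by simp
  qed (simp add: that)
  have lin: "?F \<sigma> as (\<lambda>u. fsc c (f u) + g u) u = fsc c (?F \<sigma> as f u) + ?F \<sigma> as g u" if "u \<in> S" for \<sigma> as u
    using that
  proof (induction as arbitrary: u)
    case (Cons a as)
    have "X_op n d E z a (\<sigma> a) (?F \<sigma> as (\<lambda>u. fsc c (f u) + g u)) u = X_op n d E z a (\<sigma> a) (\<lambda>u. fsc c (?F \<sigma> as f u) + ?F \<sigma> as g u) u"
      by (rule X_op_local[OF S(1) Cons.IH Cons.prems])
    also have "\<dots> = fsc c (X_op n d E z a (\<sigma> a) (?F \<sigma> as f) u) + X_op n d E z a (\<sigma> a) (?F \<sigma> as g) u"
      by (rule X_op_lincomb[OF S(1) hol[OF assms(3)] hol[OF assms(4)] Cons.prems])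
    finally show ?case unfolding foldr.simps o_apply .
  qed (simp only: foldr.simps id_apply)
  show ?thesis
  proof
    fix k
    have "?F \<sigma> as (\<lambda>u. fsc c (f u) + g u) u k = c * ?F \<sigma> as f u k + ?F \<sigma> as g u k" for \<sigma> as
      using fun_cong[OF lin[OF assms(5), of \<sigma> as], of k] unfolding plus_fun_apply[of _ _ k] fsc_def[of _ "?F \<sigma> as f u"] .
    then have "univ_diff_op N n d E z (\<lambda>u. fsc c (f u) + g u) u k
      = (\<Sum>\<sigma> | \<sigma> permutes {1..N}. of_int (sign \<sigma>) * (c * ?F \<sigma> [1..<N+1] f u k + ?F \<sigma> [1..<N+1] g u k))"
      unfolding univ_diff_op_apply by (intro sum.cong refl arg_cong2[where f = "(*)"])
    also have "\<dots> = (\<Sum>\<sigma> | \<sigma> permutes {1..N}. c * (of_int (sign \<sigma>) * ?F \<sigma> [1..<N+1] f u k) + of_int (sign \<sigma>) * ?F \<sigma> [1..<N+1] g u k)"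
      by (rule sum.cong[OF refl]) (rule distrib_left[THEN trans], rule arg_cong2[where f = "(+)", OF mult.left_commute refl])
    also have "\<dots> = c * univ_diff_op N n d E z f u k + univ_diff_op N n d E z g u k"
      unfolding univ_diff_op_apply sum.distrib sum_distrib_left ..
    finally show "univ_diff_op N n d E z (\<lambda>u. fsc c (f u) + g u) u k = (fsc c (univ_diff_op N n d E z f u) + univ_diff_op N n d E z g u) k"
      unfolding plus_fun_apply[of _ _ k] fsc_def[of _ "univ_diff_op N n d E z f u"] .
  qed
qed

subsection \<open>Linear combinations of expansions\<close>

lemma fscale_eq: "fscale c f = (\<lambda>u. fsc c (f u))"
  by (simp add: fscale_def tscale_eq_fsc)

lemma sum_fun_apply2: "(\<Sum>a\<in>A. f a) u k = (\<Sum>a\<in>A. f a u k)" for f :: "'a \<Rightarrow> complex \<Rightarrow> tensor"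
  by (induction A rule: infinite_finite_induct) auto

lemma tensor_fps_unique: "tensor_fps v f F \<Longrightarrow> tensor_fps v f G \<Longrightarrow> F = G"
  unfolding tensor_fps_def using fps_expansion_unique_complex by blast

lemma tensor_fps_sum:
  assumes "\<And>a. a \<in> A \<Longrightarrow> tensor_fps v (f a) (F a)"
  shows "tensor_fps v (\<Sum>a\<in>A. fscale (c a) (f a)) (\<lambda>k. \<Sum>a\<in>A. fps_const (c a) * F a k)"
  unfolding tensor_fps_def sum_fun_apply2 fscale_eq fsc_def
  using assms unfolding tensor_fps_def
  by (intro allI has_fps_expansion_sum has_fps_expansion_cmult_left) blast

lemma tensor_fps_cong:
  assumes "open S" "v \<in> S" "\<And>u. u \<in> S \<Longrightarrow> f u = g u" "tensor_fps v f F"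
  shows "tensor_fps v g F"
proof -
  have "eventually (\<lambda>t. t \<in> (\<lambda>t. v + t) -` S) (nhds 0)"
    using assms(1,2) by (intro eventually_nhds_in_open open_vimage) (auto intro: continuous_intros)
  then have "eventually (\<lambda>t. f (v + t) k = g (v + t) k) (nhds 0)" for k
    by (rule eventually_mono) (use assms(3) in auto)
  then have "((\<lambda>t. f (v + t) k) has_fps_expansion F k) = ((\<lambda>t. g (v + t) k) has_fps_expansion F k)" for k
    by (intro has_fps_expansion_cong refl)
  then show ?thesis using assms(4) unfolding tensor_fps_def by blast
qed

lemma tensor_fps_centered:
  assumes "\<And>l. B \<le> l \<Longrightarrow> coef F l = 0"
  shows "tensor_fps v (\<lambda>u. \<Sum>l<B. fsc ((u - v) ^ l) (coef F l)) F"
  unfolding tensor_fps_def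
proof
  fix k
  have "F k = (\<Sum>l<B. fps_X ^ l * fps_const (coef F l k))"
  proof (rule fps_ext)
    fix i
    have "fps_nth (\<Sum>l<B. fps_X ^ l * fps_const (coef F l k)) i = (\<Sum>l<B. if l = i then coef F i k else 0)"
      unfolding fps_sum_nth by (rule sum.cong) (auto simp: fps_X_power_mult_nth)
    also have "\<dots> = coef F i k" using assms[of i] by (cases "i < B") auto
    finally show "fps_nth (F k) i = fps_nth (\<Sum>l<B. fps_X ^ l * fps_const (coef F l k)) i" by (simp add: coef_def)
  qed
  moreover have "(\<lambda>t. (\<Sum>l<B. t ^ l * coef F l k)) has_fps_expansion (\<Sum>l<B. fps_X ^ l * fps_const (coef F l k))"
    by (intro has_fps_expansion_sum has_fps_expansion_mult has_fps_expansion_power has_fps_expansion_fps_X has_fps_expansion_const)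
  ultimately show "(\<lambda>t. (\<Sum>l<B. fsc ((v + t - v) ^ l) (coef F l)) k) has_fps_expansion F k"
    by (simp add: sum_fun_apply fsc_def)
qed

lemma fps_const_mult_nth: "fps_nth (fps_const c * G) l = c * fps_nth G l" for c :: complex
  by simp

lemma gl_action_coef:
  assumes S: "open S" "v \<in> S" "\<And>u. u \<in> S \<Longrightarrow> gl_action n d E a b (f u) = fsc c (f u)" and f: "tensor_fps v f F"
  shows "gl_action n d E a b (coef F l) = fsc c (coef F l)"
proof
  fix k
  have "(\<lambda>t. gl_action n d E a b (f (v + t)) k - c * f (v + t) k) has_fps_expansion
      (\<Sum>j\<in>{1..n}. lift (factor_op n d j (E j a b)) F k) - fps_const c * F k"
    unfolding gl_action_def sum_fun_apply
    by (intro has_fps_expansion_diff has_fps_expansion_sum has_fps_expansion_cmult_left tensor_fps_factor_op f)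
       (use f in \<open>simp add: tensor_fps_def\<close>)
  then have "(\<Sum>j\<in>{1..n}. lift (factor_op n d j (E j a b)) F k) - fps_const c * F k = 0"
    by (rule has_fps_expansion_0_of_eq_0[where h = "\<lambda>u. gl_action n d E a b (f u) k - c * f u k", OF S(1,2), rotated])
       (simp add: S(3) fsc_def)
  then have "fps_nth ((\<Sum>j\<in>{1..n}. lift (factor_op n d j (E j a b)) F k) - fps_const c * F k) l = 0" by simp
  then show "gl_action n d E a b (coef F l) k = fsc c (coef F l) k"
    by (simp add: gl_action_def sum_fun_apply fsc_def lift_def fps_sum_nth coef_def)
qed

text \<open>\<open>Sing\<close> is cut out by linear equations with constant coefficients, and these
  pass to Taylor coefficients.\<close>

lemma coef_in_Sing:
  assumes S: "open S" "v \<in> S" "\<And>u. u \<in> S \<Longrightarrow> f u \<in> Sing N n d E m" and f: "tensor_fps v f F"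
  shows "coef F l \<in> Sing N n d E m"
proof -
  have "F k = 0" if "k \<notin> tensor_index n d" for k
  proof (rule has_fps_expansion_0_of_eq_0[OF S(1,2)])
    show "(\<lambda>t. f (v + t) k) has_fps_expansion F k" using f by (simp add: tensor_fps_def)
    show "f u k = 0" if "u \<in> S" for u
      using S(3)[OF that] \<open>k \<notin> tensor_index n d\<close> by (simp add: Sing_def weight_space_def tensor_space_def)
  qed
  then have "coef F l \<in> tensor_space n d" by (simp add: tensor_space_def coef_def)
  moreover have "gl_action n d E a a (coef F l) = fsc (m a) (coef F l)" if "a \<in> {1..N}" for a
    using S(3) that by (intro gl_action_coef[OF S(1,2) _ f]) (auto simp: Sing_def weight_space_def tscale_eq_fsc)
  moreover have "gl_action n d E a b (coef F l) = 0" if "a \<in> {1..N}" "b \<in> {1..N}" "a < b" for a b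
  proof -
    have "gl_action n d E a b (coef F l) = fsc 0 (coef F l)"
    proof (rule gl_action_coef[OF S(1,2) _ f])
      fix u assume "u \<in> S"
      then have "gl_action n d E a b (f u) = 0" using S(3) that unfolding Sing_def by blast
      then show "gl_action n d E a b (f u) = fsc 0 (f u)" by simp
    qed
    then show ?thesis by simp
  qed
  ultimately show ?thesis unfolding Sing_def weight_space_def tscale_eq_fsc by blast
qed

lemma tpoly_lincomb: "tpoly r (\<lambda>l. fsc c (w l) + w' l) u = fsc c (tpoly r w u) + tpoly r w' u"
  by (simp add: fun_eq_iff tpoly_apply fsc_def distrib_left sum.distrib sum_distrib_left mult.left_commute)

lemma restrict0_tpoly_lincomb:
  "restrict0 U (tpoly r (\<lambda>l. fsc c (w l) + w' l)) = fscale c (restrict0 U (tpoly r w)) + restrict0 U (tpoly r w')"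
  unfolding restrict0_def fscale_eq by (rule ext) (simp add: tpoly_lincomb[unfolded])

subsection \<open>The kernel\<close>

lemma (in tensor_model) sing_solution:
  assumes N: "1 \<le> N" and z: "\<And>j. j \<in> {1..n} \<Longrightarrow> z j \<noteq> v" and x: "\<And>i. i < N \<Longrightarrow> x i \<in> Sing N n d E m"
  shows "\<exists>F. row_det [1..<N+1] (gen_X {1..n} (rxi v z) op_M) F = (\<lambda>k. 0)
    \<and> (\<forall>i<N. coef F i = x i) \<and> (\<forall>l\<ge>N + card Pos. coef F l = 0) \<and> (\<forall>l. coef F l \<in> Sing N n d E m)"
proof -
  have xT: "x i \<in> tensor_space n d" if "i < N" for i using x[OF that] by (simp add: Sing_def weight_space_def)
  obtain F where F: "row_det [1..<N+1] (gen_X {1..n} (rxi v z) op_M) F = (\<lambda>k. 0)"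
    "\<And>i. i < N \<Longrightarrow> coef F i = x i" "\<And>l. N + card Pos \<le> l \<Longrightarrow> coef F l = 0"
    "\<And>k l. k \<notin> tensor_index n d \<Longrightarrow> coef F l k = 0"
    "\<And>a b c l. a \<in> {1..N} \<Longrightarrow> b \<in> {1..N} \<Longrightarrow> (\<And>i. i < N \<Longrightarrow> gl_action n d E a b (x i) = tscale c (x i)) \<Longrightarrow>
        gl_action n d E a b (coef F l) = tscale c (coef F l)"
    by (rule module_solution[OF N z xT]) blast+
  have FS: "coef F l \<in> Sing N n d E m" for l
  proof -
    have "gl_action n d E a a (coef F l) = tscale (m a) (coef F l)" if "a \<in> {1..N}" for a
      using that by (intro F(5)) (use x in \<open>auto simp: Sing_def weight_space_def\<close>)
    moreover have "gl_action n d E a b (coef F l) = 0" if "a \<in> {1..N}" "b \<in> {1..N}" "a < b" for a b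
    proof -
      have "gl_action n d E a b (coef F l) = tscale 0 (coef F l)"
      proof (rule F(5)[OF that(1,2)])
        fix i assume "i < N"
        then have "gl_action n d E a b (x i) = 0" using x that unfolding Sing_def by blast
        then show "gl_action n d E a b (x i) = tscale 0 (x i)" unfolding tscale_eq_fsc by simp
      qed
      then show ?thesis unfolding tscale_eq_fsc by simp
    qed
    moreover have "coef F l \<in> tensor_space n d" using F(4) by (simp add: tensor_space_def)
    ultimately show ?thesis unfolding Sing_def weight_space_def by blast
  qed
  show ?thesis by (intro exI[of _ F] conjI allI impI F(1-3) FS)
qed

text \<open>All that is needed of the models is \<open>series\<close>: polynomial solutions of
  degree less than \<open>B\<close> with arbitrary singular Cauchy data at any regular point. The
  rest is complex analysis and a count of dimensions.\<close>

locale sing_kernel =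
  fixes N n :: nat and d :: "nat \<Rightarrow> nat" and E :: "nat \<Rightarrow> nat \<Rightarrow> nat \<Rightarrow> complex mat"
    and z m :: "nat \<Rightarrow> complex" and U :: "complex set" and B :: nat
  assumes N: "1 \<le> N" and U: "open U" "connected U" "U \<noteq> {}" and zU: "\<And>j. j \<in> {1..n} \<Longrightarrow> z j \<notin> U"
    and series: "\<And>v x. (\<And>j. j \<in> {1..n} \<Longrightarrow> z j \<noteq> v) \<Longrightarrow> (\<And>i. i < N \<Longrightarrow> x i \<in> Sing N n d E m) \<Longrightarrow>
      \<exists>F. row_det [1..<N+1] (gen_X {1..n} (rxi v z) (\<lambda>j a b. factor_op n d j (E j a b))) F = (\<lambda>k. 0)
        \<and> (\<forall>i<N. coef F i = x i) \<and> (\<forall>l\<ge>B. coef F l = 0) \<and> (\<forall>l. coef F l \<in> Sing N n d E m)"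
begin

abbreviation "W \<equiv> Sing N n d E m"
abbreviation "K \<equiv> Sing_kernel N n d E z m U"
abbreviation "D \<equiv> univ_diff_op N n d E z"
abbreviation "S \<equiv> - z ` {1..n}"
abbreviation "DF v \<equiv> row_det [1..<N+1] (gen_X {1..n} (rxi v z) (\<lambda>j a b. factor_op n d j (E j a b)))"

lemma S: "open S" "connected S" "U \<subseteq> S"
proof -
  show "open S" by (intro open_Compl finite_imp_closed) simp
  have "connected (UNIV - z ` {1..n})" by (intro connected_open_delete_finite) auto
  then show "connected S" by (simp add: Compl_eq_Diff_UNIV)
  show "U \<subseteq> S" using zU by blast
qed

lemma KD: "f \<in> K \<Longrightarrow> u \<in> U \<Longrightarrow> D f u = 0"
  unfolding Sing_kernel_def by blast

lemma K_hol: "f \<in> K \<Longrightarrow> hol_tensor f U"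
  unfolding Sing_kernel_def hol_tensor_def by blast

lemma K_lincomb: "f \<in> K \<Longrightarrow> g \<in> K \<Longrightarrow> fscale c f + g \<in> K"
proof -
  assume f: "f \<in> K" and g: "g \<in> K"
  have eq: "fscale c f + g = (\<lambda>u. fsc c (f u) + g u)" by (simp add: fscale_eq plus_fun_def)
  show ?thesis
    unfolding eq Sing_kernel_def
  proof (intro CollectI conjI allI ballI impI)
    fix u assume "u \<notin> U"
    then have "f u = 0" "g u = 0" using f g unfolding Sing_kernel_def by blast+
    then show "fsc c (f u) + g u = 0" by simp
  next
    fix u assume u: "u \<in> U"
    show "fsc c (f u) + g u \<in> W"
      by (intro fv.subspace_add[OF subspace_Sing] fv.subspace_scale[OF subspace_Sing]) (use f g u in \<open>auto simp: Sing_kernel_def\<close>)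
    show "D (\<lambda>u. fsc c (f u) + g u) u = 0"
    proof -
      have "D (\<lambda>u. fsc c (f u) + g u) u = fsc c (D f u) + D g u"
        by (rule univ_diff_op_lincomb[OF U(1) zU K_hol[OF f] K_hol[OF g] u])
      then show ?thesis unfolding KD[OF f u] KD[OF g u] by simp
    qed
  next
    fix k
    show "(\<lambda>u. (fsc c (f u) + g u) k) holomorphic_on U"
      using K_hol[OF f] K_hol[OF g] unfolding hol_tensor_def fsc_def plus_fun_apply by (intro holomorphic_intros) blast+
  qed
qed

lemma zero_in_K: "0 \<in> K"
proof -
  have h: "hol_tensor (\<lambda>u. 0) U" by (simp add: hol_tensor_def)
  have "D (\<lambda>u. 0) u = 0" if "u \<in> U" for u
  proof -
    \<comment> \<open>With the coefficient -1 the two terms on the right cancel.\<close>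
    have "D (\<lambda>u. fsc (- 1) 0 + 0) u = fsc (- 1) (D (\<lambda>u. 0) u) + D (\<lambda>u. 0) u"
      by (rule univ_diff_op_lincomb[OF U(1) zU h h that])
    then show ?thesis by simp
  qed
  moreover have "0 = (\<lambda>u::complex. 0::tensor)" by (simp add: zero_fun_def)
  ultimately show ?thesis
    using h fv.subspace_0[OF subspace_Sing, of N n d E m] unfolding Sing_kernel_def hol_tensor_def by fastforce
qed

lemma subspace_K: "tensor_fun.subspace K"
proof -
  have "f + g \<in> K" if "f \<in> K" "g \<in> K" for f g
    using K_lincomb[OF that, of 1] by simp
  moreover have "fscale c f \<in> K" if "f \<in> K" for c f
    using K_lincomb[OF that zero_in_K, of c] by (simp only: add_0_right)
  ultimately show ?thesis unfolding tensor_fun.subspace_def using zero_in_K by blast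
qed

text \<open>The equation is continued from \<open>U\<close> to all regular points because the
  indicial equation is read off near infinity, where \<open>U\<close> need not reach.\<close>

lemma D_tpoly_0:
  assumes K: "restrict0 U (tpoly r w) \<in> K" and u: "u \<in> S"
  shows "D (tpoly r w) u = 0"
proof
  fix k
  have "D (tpoly r w) v k = 0" if "v \<in> U" for v
  proof -
    have "D (tpoly r w) v = D (restrict0 U (tpoly r w)) v"
      by (rule univ_diff_op_local[OF U(1) _ that]) (simp add: restrict0_def)
    then show ?thesis using KD[OF K that] by simp
  qed
  moreover have "(\<lambda>u. D (tpoly r w) u k) holomorphic_on S"
    by (rule hol_univ_diff_op[OF S(1) _ hol_tpoly]) auto
  ultimately show "D (tpoly r w) u k = 0 k"
    using analytic_continuation_open[of U S "\<lambda>u. D (tpoly r w) u k" "\<lambda>_. 0" u] S U u by simp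
qed

lemma tpoly_in_K:
  assumes w: "\<And>l. w l \<in> W" and D: "\<And>u. u \<in> U \<Longrightarrow> D (tpoly r w) u = 0"
  shows "restrict0 U (tpoly r w) \<in> K"
  unfolding Sing_kernel_def
proof (intro CollectI conjI allI ballI impI)
  fix u assume u: "u \<in> U"
  have "tpoly r w u \<in> W"
    unfolding tpoly_def by (intro fv.subspace_sum[OF subspace_Sing] fv.subspace_scale[OF subspace_Sing] w)
  then show "restrict0 U (tpoly r w) u \<in> W" using u by (simp add: restrict0_def)
  have "D (restrict0 U (tpoly r w)) u = D (tpoly r w) u"
    by (rule univ_diff_op_local[OF U(1) _ u]) (simp add: restrict0_def)
  then show "D (restrict0 U (tpoly r w)) u = 0" using D[OF u] by simp
next
  fix k
  show "(\<lambda>u. restrict0 U (tpoly r w) u k) holomorphic_on U"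
    by (rule holomorphic_transform[of "\<lambda>u. tpoly r w u k"])
       (use hol_tpoly[of r w U] in \<open>auto simp: hol_tensor_def restrict0_def\<close>)
qed (simp add: restrict0_def)

text \<open>A formal solution of bounded degree is a polynomial function. The equation holds to all
  orders at \<open>v\<close>, hence on all of \<open>U\<close> by the identity theorem on the
  connected set of regular points.\<close>

lemma series_tpoly:
  assumes v: "v \<in> S" and F: "DF v F = (\<lambda>k. 0)" "\<forall>l\<ge>B. coef F l = 0" "\<forall>l. coef F l \<in> W"
  shows "\<exists>w. (\<forall>l. w l \<in> W) \<and> (\<forall>l\<ge>B. w l = 0) \<and> tensor_fps v (tpoly B w) F \<and> restrict0 U (tpoly B w) \<in> K"
proof -
  obtain w where w: "\<And>l. w l \<in> W" "\<And>l. B \<le> l \<Longrightarrow> w l = 0"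
    "\<And>u. tpoly B w u = (\<Sum>l<B. fsc ((u - v) ^ l) (coef F l))"
    by (rule tpoly_recenter[of W "coef F" B v, OF subspace_Sing]) (use F(2,3) in auto)
  have eq: "tpoly B w = (\<lambda>u. \<Sum>l<B. fsc ((u - v) ^ l) (coef F l))" by (rule ext) (rule w(3))
  have fps: "tensor_fps v (tpoly B w) F" unfolding eq by (rule tensor_fps_centered) (use F(2) in blast)
  have "tensor_fps v (D (tpoly B w)) (DF v F)"
    by (rule tensor_fps_univ_diff_op[OF _ fps]) (use v in auto)
  then have 0: "(\<lambda>t. D (tpoly B w) (v + t) k) has_fps_expansion 0" for k
    unfolding F(1) tensor_fps_def by blast
  have "D (tpoly B w) u = 0" if "u \<in> U" for u
  proof
    fix k
    have "(\<lambda>u. D (tpoly B w) u k) holomorphic_on S"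
      by (rule hol_univ_diff_op[OF S(1) _ hol_tpoly]) auto
    then have "D (tpoly B w) u k = 0"
      using fps_expansion_0_imp_eq_0[OF S(1,2) v _ 0] S(3) that by blast
    then show "D (tpoly B w) u k = 0 k" by simp
  qed
  then have "restrict0 U (tpoly B w) \<in> K" by (rule tpoly_in_K[OF w(1)])
  then show ?thesis using w(1,2) fps by blast
qed

text \<open>A solution on \<open>U\<close> and the polynomial solution with the same first
  \<open>N\<close> coefficients at one point have the same expansion there, hence agree on the
  connected set \<open>U\<close>.\<close>

lemma K_tpoly:
  assumes f: "f \<in> K"
  shows "\<exists>w. (\<forall>l. w l \<in> W) \<and> (\<forall>l\<ge>B. w l = 0) \<and> f = restrict0 U (tpoly B w)"
proof -
  obtain v where v: "v \<in> U" using U(3) by blast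
  then have vS: "v \<in> S" using S(3) by blast
  have zv: "z j \<noteq> v" if "j \<in> {1..n}" for j using zU[OF that] v by blast
  obtain G where G: "tensor_fps v f G" using tensor_fps_exists[OF U(1) v K_hol[OF f]] by blast
  have GW: "coef G l \<in> W" for l
    by (rule coef_in_Sing[OF U(1) v _ G]) (use f in \<open>auto simp: Sing_kernel_def\<close>)
  obtain F where F: "DF v F = (\<lambda>k. 0)" "\<forall>i<N. coef F i = coef G i" "\<forall>l\<ge>B. coef F l = 0" "\<forall>l. coef F l \<in> W"
    using series[of v "coef G", OF zv GW] by blast
  have G0: "DF v G = (\<lambda>k. 0)"
  proof
    fix k
    have "(\<lambda>t. D f (v + t) k) has_fps_expansion DF v G k"
      using tensor_fps_univ_diff_op[where z = z, OF zv G] unfolding tensor_fps_def by blast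
    then show "DF v G k = 0"
      by (rule has_fps_expansion_0_of_eq_0[where h = "\<lambda>u. D f u k", OF U(1) v, rotated]) (simp add: KD[OF f])
  qed
  \<comment> \<open>For the zero subspace, invariance is uniqueness.\<close>
  interpret G: gaudin_subspace N "{1..n}" "rxi v z" "\<lambda>j a b. factor_op n d j (E j a b)" "{0}"
    by unfold_locales (auto simp: fp.linear_0[OF flinear_factor_op])
  have "DF v (\<lambda>k. G k - F k) = (\<lambda>k. DF v G k - DF v F k)"
    by (rule row_det_gen_X_diff) (rule flinear_factor_op)
  also have "\<dots> = (\<lambda>k. 0)" unfolding F(1) G0 by simp
  finally have DH: "DF v (\<lambda>k. G k - F k) = (\<lambda>k. 0)" .
  have "coef (\<lambda>k. G k - F k) l \<in> {0}" for l
  proof (rule G.coef_in_of_row_det)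
    show "coef (\<lambda>k. G k - F k) i \<in> {0}" if "i < N" for i using F(2) that unfolding coef_diff by simp
    show "coef (DF v (\<lambda>k. G k - F k)) i \<in> {0}" for i unfolding DH by (simp add: coef_def zero_fun_def)
  qed
  then have "coef G l = coef F l" for l unfolding coef_diff by simp
  then have "G = F" by (rule coef_eqI)
  obtain w where w: "\<forall>l. w l \<in> W" "\<forall>l\<ge>B. w l = 0" "tensor_fps v (tpoly B w) F"
    using series_tpoly[OF vS F(1,3,4)] by blast
  have "f u = restrict0 U (tpoly B w) u" for u
  proof (cases "u \<in> U")
    case True
    have "f u k = tpoly B w u k" for k
    proof -
      have "(\<lambda>t. f (v + t) k - tpoly B w (v + t) k) has_fps_expansion F k - F k"
        using G w(3) unfolding \<open>G = F\<close> tensor_fps_def by (intro has_fps_expansion_diff) blast+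
      then have "(\<lambda>t. f (v + t) k - tpoly B w (v + t) k) has_fps_expansion 0" by simp
      moreover have "(\<lambda>u. f u k - tpoly B w u k) holomorphic_on U"
        using K_hol[OF f] hol_tpoly[of B w U] unfolding hol_tensor_def by (intro holomorphic_intros) blast+
      ultimately have "f u k - tpoly B w u k = 0"
        using fps_expansion_0_imp_eq_0[OF U(1,2) v _ _ True, of "\<lambda>u. f u k - tpoly B w u k"] by blast
      then show ?thesis by simp
    qed
    then show ?thesis using True by (simp add: restrict0_def fun_eq_iff)
  next
    case False
    then show ?thesis using f by (simp add: Sing_kernel_def restrict0_def)
  qed
  then have "f = restrict0 U (tpoly B w)" by (rule ext)
  then show ?thesis using w(1,2) by blast
qed

lemma cauchy_data:
  assumes v: "v \<in> U" and x: "\<And>i. i < N \<Longrightarrow> x i \<in> W"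
  shows "\<exists>f F. f \<in> K \<and> tensor_fps v f F \<and> (\<forall>i<N. coef F i = x i)"
proof -
  have zv: "z j \<noteq> v" if "j \<in> {1..n}" for j using zU[OF that] v by blast
  obtain F where F: "DF v F = (\<lambda>k. 0)" "\<forall>i<N. coef F i = x i" "\<forall>l\<ge>B. coef F l = 0" "\<forall>l. coef F l \<in> W"
    using series[of v x, OF zv x] by blast
  have vS: "v \<in> S" using S(3) v by blast
  obtain w where w: "tensor_fps v (tpoly B w) F" "restrict0 U (tpoly B w) \<in> K"
    using series_tpoly[OF vS F(1,3,4)] by blast
  have "tensor_fps v (restrict0 U (tpoly B w)) F"
    by (rule tensor_fps_cong[OF U(1) v _ w(1)]) (simp add: restrict0_def)
  then show ?thesis using w(2) F(2) by blast
qed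

section \<open>Degrees and leading coefficients\<close>

definition R :: "nat set" where
  "R = {r. \<exists>i\<in>{1..N}. of_nat r = m i + of_nat N - of_nat i}"

text \<open>The coefficient \<open>w r\<close> may be zero, so the polynomials have degree at most
  \<open>r\<close>; this makes the set a subspace whenever \<open>Y\<close> is one.\<close>

definition lead_space :: "(complex \<Rightarrow> tensor) set \<Rightarrow> nat \<Rightarrow> tensor set" where
  "lead_space Y r = {w r | w. (\<forall>l. w l \<in> W) \<and> (\<forall>l>r. w l = 0) \<and> restrict0 U (tpoly (Suc r) w) \<in> Y}"

lemma lead_spaceI:
  "(\<And>l. w l \<in> W) \<Longrightarrow> (\<And>l. r < l \<Longrightarrow> w l = 0) \<Longrightarrow> restrict0 U (tpoly (Suc r) w) \<in> Y \<Longrightarrow> w r \<in> lead_space Y r"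
  unfolding lead_space_def by blast

lemma lead_spaceD:
  "x \<in> lead_space Y r \<Longrightarrow> \<exists>w. (\<forall>l. w l \<in> W) \<and> (\<forall>l>r. w l = 0) \<and> restrict0 U (tpoly (Suc r) w) \<in> Y \<and> w r = x"
  unfolding lead_space_def by blast

lemma subspace_lead_space:
  assumes Y: "tensor_fun.subspace Y"
  shows "fv.subspace (lead_space Y r)"
proof -
  have "tpoly (Suc r) (\<lambda>l. 0) = (\<lambda>u. 0)" by (rule ext) (simp add: tpoly_def)
  then have "restrict0 U (tpoly (Suc r) (\<lambda>l. 0)) = 0" by (simp add: restrict0_def fun_eq_iff)
  then have 0: "0 \<in> lead_space Y r"
    using lead_spaceI[of "\<lambda>l. 0" r Y] fv.subspace_0[OF subspace_Sing, of N n d E m] tensor_fun.subspace_0[OF Y] by simp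
  have L: "fsc c x + y \<in> lead_space Y r" if x: "x \<in> lead_space Y r" and y: "y \<in> lead_space Y r" for c x y
  proof -
    obtain w where w: "\<forall>l. w l \<in> W" "\<forall>l>r. w l = 0" "restrict0 U (tpoly (Suc r) w) \<in> Y" "w r = x"
      using lead_spaceD[OF x] by blast
    obtain w' where w': "\<forall>l. w' l \<in> W" "\<forall>l>r. w' l = 0" "restrict0 U (tpoly (Suc r) w') \<in> Y" "w' r = y"
      using lead_spaceD[OF y] by blast
    have "(\<lambda>l. fsc c (w l) + w' l) r \<in> lead_space Y r"
    proof (rule lead_spaceI)
      show "restrict0 U (tpoly (Suc r) (\<lambda>l. fsc c (w l) + w' l)) \<in> Y"
        unfolding restrict0_tpoly_lincomb
        by (intro tensor_fun.subspace_add[OF Y] tensor_fun.subspace_scale[OF Y] w(3) w'(3))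
      show "fsc c (w l) + w' l \<in> W" for l
        by (intro fv.subspace_add[OF subspace_Sing] fv.subspace_scale[OF subspace_Sing] w(1)[rule_format] w'(1)[rule_format])
      show "fsc c (w l) + w' l = 0" if "r < l" for l using w(2) w'(2) that by simp
    qed
    then show ?thesis using w(4) w'(4) by simp
  qed
  have "x + y \<in> lead_space Y r" if "x \<in> lead_space Y r" "y \<in> lead_space Y r" for x y
    using L[OF that, of 1] by simp
  moreover have "fsc c x \<in> lead_space Y r" if "x \<in> lead_space Y r" for c x
    using L[OF that 0, of c] by (simp only: add_0_right)
  ultimately show ?thesis using 0 unfolding fv.subspace_def by blast
qed

lemma tpoly_degree_R:
  assumes "\<And>l. w l \<in> W" "restrict0 U (tpoly (Suc r) w) \<in> K" "w r \<noteq> 0"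
  shows "r \<in> R"
  unfolding R_def using tpoly_degree[OF N, of w n d E m r z] D_tpoly_0[OF assms(2)] assms(1,3) by blast

lemma K_cases:
  assumes f: "f \<in> K" "f \<noteq> 0"
  shows "\<exists>r w. r \<in> R \<and> (\<forall>l. w l \<in> W) \<and> w r \<noteq> 0 \<and> f = restrict0 U (tpoly (Suc r) w)"
proof -
  obtain w where w: "\<forall>l. w l \<in> W" "\<forall>l\<ge>B. w l = 0" "f = restrict0 U (tpoly B w)"
    using K_tpoly[OF f(1)] by blast
  have "\<exists>l. w l \<noteq> 0"
  proof (rule ccontr)
    assume "\<not> (\<exists>l. w l \<noteq> 0)"
    then have "f u = 0" for u unfolding w(3) restrict0_def tpoly_def by simp
    then show False using f(2) by (simp add: fun_eq_iff)
  qed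
  then have ne: "{l. w l \<noteq> 0} \<noteq> {}" by blast
  have fin: "finite {l. w l \<noteq> 0}"
    by (rule finite_subset[of _ "{..<B}"]) (use w(2) in \<open>auto simp: not_le[symmetric]\<close>)
  define r where "r = Max {l. w l \<noteq> 0}"
  have r: "w r \<noteq> 0" using Max_in[OF fin ne] unfolding r_def by blast
  have l0: "w l = 0" if "r < l" for l using Max_ge[OF fin, of l] that unfolding r_def by (meson CollectI leD)
  have "r < B" using w(2) r not_le by blast
  then have "tpoly B w = tpoly (Suc r) w" by (intro tpoly_shrink l0) auto
  then have f': "f = restrict0 U (tpoly (Suc r) w)" using w(3) by simp
  then have "r \<in> R" using tpoly_degree_R[of w r] w(1) r f(1) by blast
  then show ?thesis using w(1) r f' by blast
qed

text \<open>An index determines the degree, so any choice of an index for each degree is injective.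
  This bounds the number of degrees by \<open>N\<close>.\<close>

lemma R_index:
  "\<exists>\<iota>. inj_on \<iota> R \<and> \<iota> ` R \<subseteq> {1..N} \<and> (\<forall>r\<in>R. of_nat r = m (\<iota> r) + of_nat N - of_nat (\<iota> r))"
proof -
  have "\<forall>r\<in>R. \<exists>i. i \<in> {1..N} \<and> of_nat r = m i + of_nat N - of_nat i" unfolding R_def by blast
  then obtain \<iota> where \<iota>: "\<And>r. r \<in> R \<Longrightarrow> \<iota> r \<in> {1..N}" "\<And>r. r \<in> R \<Longrightarrow> of_nat r = m (\<iota> r) + of_nat N - of_nat (\<iota> r)"
    by metis
  have "inj_on \<iota> R"
  proof
    fix r s assume "r \<in> R" "s \<in> R" "\<iota> r = \<iota> s"
    then have "(of_nat r :: complex) = of_nat s" using \<iota>(2) by simp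
    then show "r = s" by simp
  qed
  then show ?thesis using \<iota> by blast
qed

lemma finite_R: "finite R" and card_R: "card R \<le> N"
proof -
  obtain \<iota> where \<iota>: "inj_on \<iota> R" "\<iota> ` R \<subseteq> {1..N}" using R_index by blast
  then show "finite R" using finite_imageD finite_subset by blast
  show "card R \<le> N" using card_inj_on_le[OF \<iota>] by simp
qed

text \<open>An element of the span with the same top coefficient is subtracted, which lowers the
  degree bound; a nonzero top coefficient occurs only at degrees in \<open>R\<close>.\<close>

lemma K_subset_span:
  assumes X: "X \<subseteq> K" and L: "\<And>r. r \<in> R \<Longrightarrow> lead_space K r \<subseteq> lead_space (tensor_fun.span X) r"
  shows "K \<subseteq> tensor_fun.span X"
proof
  fix f assume "f \<in> K"
  then obtain w where w: "\<forall>l. w l \<in> W" "\<forall>l\<ge>B. w l = 0" "f = restrict0 U (tpoly B w)"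
    using K_tpoly by blast
  have span: "restrict0 U (tpoly q w) \<in> tensor_fun.span X"
    if "\<And>l. w l \<in> W" "\<And>l. q \<le> l \<Longrightarrow> w l = 0" "restrict0 U (tpoly q w) \<in> K" for q w
    using that
  proof (induction q arbitrary: w)
    case 0
    have "restrict0 U (tpoly 0 w) = 0" by (simp add: restrict0_def tpoly_def fun_eq_iff)
    then show ?case using tensor_fun.span_zero[of X] by (simp only:)
  next
    case (Suc r)
    show ?case
    proof (cases "w r = 0")
      case True
      then have l0: "w l = 0" if "r \<le> l" for l
        using Suc.prems(2)[of l] that by (cases "l = r") auto
      then have "tpoly (Suc r) w = tpoly r w" by (intro tpoly_shrink) auto
      then show ?thesis using Suc.IH[of w] Suc.prems(1,3) l0 by simp
    next
      case False
      have "r \<in> R" using tpoly_degree_R[of w r] Suc.prems(1,3) False by blast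
      moreover have "w r \<in> lead_space K r" using Suc.prems by (intro lead_spaceI) auto
      ultimately have "w r \<in> lead_space (tensor_fun.span X) r" using L by blast
      then obtain w' where w': "\<forall>l. w' l \<in> W" "\<forall>l>r. w' l = 0"
        "restrict0 U (tpoly (Suc r) w') \<in> tensor_fun.span X" "w' r = w r"
        using lead_spaceD by blast
      have w'K: "restrict0 U (tpoly (Suc r) w') \<in> K"
        using w'(3) tensor_fun.span_minimal[OF X subspace_K] by blast
      define y where "y = (\<lambda>l. fsc (- 1) (w' l) + w l)"
      have yW: "y l \<in> W" for l
        unfolding y_def by (intro fv.subspace_add[OF subspace_Sing] fv.subspace_scale[OF subspace_Sing] w'(1)[rule_format] Suc.prems(1))
      have y0: "y l = 0" if "r \<le> l" for l
        using w'(2)[rule_format, of l] w'(4) Suc.prems(2)[of l] that unfolding y_def by (cases "l = r") auto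
      have ry: "restrict0 U (tpoly (Suc r) y) = fscale (- 1) (restrict0 U (tpoly (Suc r) w')) + restrict0 U (tpoly (Suc r) w)"
        unfolding y_def by (rule restrict0_tpoly_lincomb)
      have sh: "tpoly (Suc r) y = tpoly r y" by (intro tpoly_shrink y0) auto
      have "restrict0 U (tpoly (Suc r) y) \<in> K"
        unfolding ry by (rule K_lincomb[OF w'K Suc.prems(3)])
      then have "restrict0 U (tpoly (Suc r) y) \<in> tensor_fun.span X"
        using Suc.IH[of y] yW y0 unfolding sh by blast
      then have "restrict0 U (tpoly (Suc r) w') + restrict0 U (tpoly (Suc r) y) \<in> tensor_fun.span X"
        using w'(3) tensor_fun.span_add by blast
      then show ?thesis unfolding ry by simp
    qed
  qed
  show "f \<in> tensor_fun.span X"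
    unfolding w(3) by (rule span) (use w \<open>f \<in> K\<close> in auto)
qed

section \<open>Dimension of the kernel\<close>

lemma finite_independent_W:
  assumes "A \<subseteq> W" "fv.independent A"
  shows "finite A"
proof -
  let ?e = "\<lambda>k. (\<lambda>k'. of_bool (k' = k)) :: tensor"
  have "W \<subseteq> fv.span (?e ` tensor_index n d)"
  proof
    fix x assume "x \<in> W"
    then have x: "x k = 0" if "k \<notin> tensor_index n d" for k
      using that by (simp add: Sing_def weight_space_def tensor_space_def)
    have "x = (\<Sum>k\<in>tensor_index n d. fsc (x k) (?e k))"
    proof
      fix k'
      have "(\<Sum>k\<in>tensor_index n d. fsc (x k) (?e k)) k' = (\<Sum>k\<in>tensor_index n d. if k' = k then x k else 0)"
        unfolding sum_fun_apply fsc_def by (rule sum.cong) auto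
      also have "\<dots> = x k'" using x[of k'] by (simp add: finite_tensor_index)
      finally show "x k' = (\<Sum>k\<in>tensor_index n d. fsc (x k) (?e k)) k'" ..
    qed
    also have "\<dots> \<in> fv.span (?e ` tensor_index n d)"
      by (intro fv.span_sum fv.span_scale fv.span_base) auto
    finally show "x \<in> fv.span (?e ` tensor_index n d)" .
  qed
  then show ?thesis
    using fv.independent_span_bound[OF finite_imageI[OF finite_tensor_index] assms(2)] assms(1) by blast
qed

text \<open>The data consist of a vector of \<open>A\<close> at one order below \<open>N\<close> and
  zero at the others. A linear relation among the solutions is then read off at each order as a
  relation in \<open>A\<close>.\<close>

lemma independent_family:
  assumes A: "A \<subseteq> W" "fv.independent A"
  obtains X where "X \<subseteq> K" "tensor_fun.independent X" "card X = N * card A"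
proof -
  have finA: "finite A" by (rule finite_independent_W[OF A])
  obtain v where v: "v \<in> U" using U(3) by blast
  have "\<exists>f F. f \<in> K \<and> tensor_fps v f F \<and> (\<forall>j<N. coef F j = (if j = fst p then snd p else 0))"
    if "p \<in> {..<N} \<times> A" for p
  proof (rule cauchy_data[OF v])
    fix j
    show "(if j = fst p then snd p else 0) \<in> W"
      using that A(1) fv.subspace_0[OF subspace_Sing, of N n d E m] by auto
  qed
  then obtain f F where f: "\<And>p. p \<in> {..<N} \<times> A \<Longrightarrow> f p \<in> K" "\<And>p. p \<in> {..<N} \<times> A \<Longrightarrow> tensor_fps v (f p) (F p)"
    and F: "\<And>p j. p \<in> {..<N} \<times> A \<Longrightarrow> j < N \<Longrightarrow> coef (F p) j = (if j = fst p then snd p else 0)"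
    by metis
  let ?I = "{..<N} \<times> A"
  have A0: "0 \<notin> A" using A(2) fv.dependent_zero by blast
  have inj: "inj_on f ?I"
  proof
    fix p q assume p: "p \<in> ?I" and q: "q \<in> ?I" and eq: "f p = f q"
    have "F p = F q" using f(2)[OF p] f(2)[OF q] unfolding eq by (rule tensor_fps_unique)
    then have c: "(if fst p = fst q then snd q else 0) = snd p"
      using F[OF p, of "fst p"] F[OF q, of "fst p"] p by auto
    then have "fst p = fst q" using p A0 by (cases "fst p = fst q") auto
    then show "p = q" using c by (simp add: prod_eq_iff)
  qed
  have "tensor_fun.independent (f ` ?I)"
  proof (rule tensor_fun.independent_if_scalars_zero)
    show "finite (f ` ?I)" using finA by simp
    fix c g assume 0: "(\<Sum>g\<in>f ` ?I. fscale (c g) g) = 0" and g: "g \<in> f ` ?I"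
    have s0: "(\<Sum>p\<in>?I. fscale (c (f p)) (f p)) = 0" using 0 by (simp add: sum.reindex[OF inj])
    have "tensor_fps v (\<Sum>p\<in>?I. fscale (c (f p)) (f p)) (\<lambda>k. \<Sum>p\<in>?I. fps_const (c (f p)) * F p k)"
      by (rule tensor_fps_sum[OF f(2)])
    then have "tensor_fps v 0 (\<lambda>k. \<Sum>p\<in>?I. fps_const (c (f p)) * F p k)" by (simp only: s0)
    moreover have "tensor_fps v 0 (\<lambda>k. 0)" by (simp add: tensor_fps_def)
    ultimately have e: "(\<lambda>k. \<Sum>p\<in>?I. fps_const (c (f p)) * F p k) = (\<lambda>k. 0)"
      by (rule tensor_fps_unique)
    obtain j b where jb: "j < N" "b \<in> A" "g = f (j, b)" using g by auto
    have "(\<Sum>a\<in>A. fsc (c (f (j, a))) a) = 0"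
    proof
      fix k
      have "fps_nth (\<Sum>p\<in>?I. fps_const (c (f p)) * F p k) j = 0" using fun_cong[OF e, of k] by simp
      then have "(\<Sum>p\<in>?I. c (f p) * coef (F p) j k) = 0" by (simp only: fps_sum_nth fps_const_mult_nth coef_def)
      moreover have "(\<Sum>p\<in>?I. c (f p) * coef (F p) j k) = (\<Sum>p\<in>?I. if fst p = j then c (f p) * snd p k else 0)"
        by (rule sum.cong[OF refl]) (use F jb(1) in auto)
      moreover have "\<dots> = (\<Sum>i<N. \<Sum>a\<in>A. if i = j then c (f (i, a)) * a k else 0)"
        by (subst sum.cartesian_product) (auto intro: sum.cong)
      moreover have "\<dots> = (\<Sum>i<N. if i = j then \<Sum>a\<in>A. c (f (i, a)) * a k else 0)"
        by (rule sum.cong) auto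
      moreover have "\<dots> = (\<Sum>a\<in>A. c (f (j, a)) * a k)" using jb(1) by simp
      ultimately show "(\<Sum>a\<in>A. fsc (c (f (j, a))) a) k = 0 k" by (simp add: sum_fun_apply fsc_def)
    qed
    then show "c g = 0"
      unfolding jb(3) using fv.independentD[OF A(2) finA subset_refl, of "\<lambda>a. c (f (j, a))" b] jb(2) by blast
  qed
  moreover have "card (f ` ?I) = N * card A" by (simp add: card_image[OF inj] card_cartesian_product)
  moreover have "f ` ?I \<subseteq> K" using f(1) by blast
  ultimately show ?thesis using that by blast
qed

lemma lead_space_subset_W: "lead_space Y r \<subseteq> W"
  unfolding lead_space_def by blast

text \<open>
  Leading coefficients embed the kernel into \<open>\<Oplus>\<^bsub>r \<in> R\<^esub> W\<close>, where \<open>R\<close> has at most \<open>N\<close> elements; since the kernel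
  has dimension \<open>N dim W\<close>, everything must occur.
\<close>

lemma card_R_eq_and_lead_space:
  assumes W0: "W \<noteq> {0}"
  shows "card R = N" "\<And>r. r \<in> R \<Longrightarrow> W \<subseteq> lead_space K r"
proof -
  obtain A where A: "A \<subseteq> W" "fv.independent A" "W \<subseteq> fv.span A" using fv.maximal_independent_subset by blast
  have finA: "finite A" by (rule finite_independent_W[OF A(1,2)])
  have "A \<noteq> {}" using A(3) W0 fv.subspace_0[OF subspace_Sing, of N n d E m] by auto
  then have s1: "1 \<le> card A" using finA by (simp add: Suc_leI card_gt_0_iff)
  have "\<exists>B. B \<subseteq> lead_space K r \<and> fv.independent B \<and> lead_space K r \<subseteq> fv.span B" for r
    using fv.maximal_independent_subset by metis
  then obtain B where B: "\<And>r. B r \<subseteq> lead_space K r" "\<And>r. fv.independent (B r)" "\<And>r. lead_space K r \<subseteq> fv.span (B r)"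
    by metis
  have BW: "B r \<subseteq> W" for r using B(1) lead_space_subset_W by blast
  have finB: "finite (B r)" for r by (rule finite_independent_W[OF BW B(2)])
  have cardB: "card (B r) \<le> card A" for r
    using fv.independent_span_bound[OF finA B(2)] BW A(3) by blast
  \<comment> \<open>One solution is fixed for each basis vector of each
    \<open>lead_space K r\<close>; together they will span the kernel.\<close>
  define \<omega> where "\<omega> r b = (SOME w. (\<forall>l. w l \<in> W) \<and> (\<forall>l>r. w l = 0) \<and> restrict0 U (tpoly (Suc r) w) \<in> K \<and> w r = b)" for r b
  have \<omega>: "(\<forall>l. \<omega> r b l \<in> W) \<and> (\<forall>l>r. \<omega> r b l = 0) \<and> restrict0 U (tpoly (Suc r) (\<omega> r b)) \<in> K \<and> \<omega> r b r = b"
    if b: "b \<in> B r" for r b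
    unfolding \<omega>_def using B(1) b by (intro someI_ex[OF lead_spaceD]) blast
  define \<phi> where "\<phi> r b = restrict0 U (tpoly (Suc r) (\<omega> r b))" for r b
  define X where "X = (\<Union>r\<in>R. \<phi> r ` B r)"
  have XK: "X \<subseteq> K" unfolding X_def \<phi>_def using \<omega> by blast
  have finX: "finite X" unfolding X_def using finite_R finB by blast
  have "card X \<le> (\<Sum>r\<in>R. card (\<phi> r ` B r))" unfolding X_def by (rule card_UN_le[OF finite_R])
  also have "\<dots> \<le> (\<Sum>r\<in>R. card (B r))" by (intro sum_mono card_image_le finB)
  finally have cardX: "card X \<le> (\<Sum>r\<in>R. card (B r))" .
  have "lead_space K r \<subseteq> lead_space (tensor_fun.span X) r" if r: "r \<in> R" for r
  proof -
    have "B r \<subseteq> lead_space (tensor_fun.span X) r"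
    proof
      fix b assume b: "b \<in> B r"
      have "\<phi> r b \<in> X" unfolding X_def using r b by blast
      then have "restrict0 U (tpoly (Suc r) (\<omega> r b)) \<in> tensor_fun.span X"
        unfolding \<phi>_def by (rule tensor_fun.span_base)
      then have "\<omega> r b r \<in> lead_space (tensor_fun.span X) r"
        using \<omega>[OF b] by (intro lead_spaceI[of "\<omega> r b" r]) simp_all
      then show "b \<in> lead_space (tensor_fun.span X) r" using \<omega>[OF b] by simp
    qed
    then have "fv.span (B r) \<subseteq> lead_space (tensor_fun.span X) r"
      by (rule fv.span_minimal[OF _ subspace_lead_space[OF tensor_fun.subspace_span]])
    then show ?thesis using B(3) by blast
  qed
  then have Kspan: "K \<subseteq> tensor_fun.span X" by (rule K_subset_span[OF XK])
  obtain Y where Y: "Y \<subseteq> K" "tensor_fun.independent Y" "card Y = N * card A"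
    using independent_family[OF A(1,2)] by blast
  \<comment> \<open>The chain \<open>N * card A = card Y \<le> card X \<le> (\<Sum>r\<in>R. card (B
    r)) \<le> card R * card A \<le> N * card A\<close> forces equality throughout.\<close>
  have "card Y \<le> card X" using tensor_fun.independent_span_bound[OF finX Y(2)] Y(1) Kspan by blast
  then have le: "N * card A \<le> (\<Sum>r\<in>R. card (B r))" using Y(3) cardX by simp
  have ub: "(\<Sum>r\<in>R. card (B r)) \<le> card R * card A" using sum_bounded_above[of R "\<lambda>r. card (B r)" "card A"] cardB by simp
  have "N * card A \<le> card R * card A" using le ub by (rule order_trans)
  then show RN: "card R = N" using card_R s1 by (simp add: mult_le_cancel2)
  have cB: "card (B r) = card A" if "r \<in> R" for r
  proof (rule ccontr)
    assume "card (B r) \<noteq> card A"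
    then have "card (B r) < card A" using cardB[of r] by simp
    then have "(\<Sum>r\<in>R. card (B r)) < (\<Sum>r\<in>R. card A)"
      using cardB that by (intro sum_strict_mono_ex1[OF finite_R]) auto
    then show False using le RN by simp
  qed
  show "W \<subseteq> lead_space K r" if r: "r \<in> R" for r
  proof
    fix x assume x: "x \<in> W"
    \<comment> \<open>Otherwise \<open>x\<close> would enlarge \<open>B r\<close> to an independent
      subset of the span of \<open>A\<close> with more than \<open>card A\<close> elements.\<close>
    have "x \<in> fv.span (B r)"
    proof (rule ccontr)
      assume nx: "x \<notin> fv.span (B r)"
      then have "fv.independent (insert x (B r))" using fv.independent_insertI B(2) by blast
      moreover have "insert x (B r) \<subseteq> fv.span A" using x BW A(3) by blast
      ultimately have "card (insert x (B r)) \<le> card A" using fv.independent_span_bound[OF finA] by blast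
      moreover have "x \<notin> B r" using nx fv.span_base by blast
      ultimately show False using cB[OF r] finB by simp
    qed
    then show "x \<in> lead_space K r"
      using fv.span_minimal[OF B(1) subspace_lead_space[OF subspace_K]] by blast
  qed
qed

section \<open>Solutions with prescribed leading term\<close>

lemma kernel_polysI:
  assumes "of_nat r = m i + of_nat N - of_nat i" "\<And>l. w l \<in> W" "restrict0 U (tpoly (Suc r) w) \<in> K"
  shows "restrict0 U (tpoly (Suc r) w) \<in> kernel_polys N n d E z m U i (w r)"
  unfolding kernel_polys_def tensor_poly_eq_tpoly[symmetric]
  by (intro CollectI exI[of _ r] exI[of _ "\<lambda>k. w (r - k)"])
     (use assms in \<open>simp add: tensor_poly_eq_tpoly\<close>)

text \<open>As there are exactly \<open>N\<close> degrees, the injective choice of indices reaches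
  every \<open>i\<close>. This also shows that \<open>m i + of_nat N - of_nat i\<close> is a natural
  number.\<close>

lemma kernel_polys_nonempty:
  assumes i: "i \<in> {1..N}" and v0: "v0 \<in> W - {0}"
  shows "kernel_polys N n d E z m U i v0 \<noteq> {}"
proof -
  have W0: "W \<noteq> {0}" using v0 by blast
  obtain \<iota> where \<iota>: "inj_on \<iota> R" "\<iota> ` R \<subseteq> {1..N}" "\<forall>r\<in>R. of_nat r = m (\<iota> r) + of_nat N - of_nat (\<iota> r)"
    using R_index by blast
  have "\<iota> ` R = {1..N}"
    using \<iota> card_R_eq_and_lead_space(1)[OF W0] by (intro card_subset_eq) (auto simp: card_image)
  then obtain r where r: "r \<in> R" "i = \<iota> r" using i by blast
  have "v0 \<in> lead_space K r" using card_R_eq_and_lead_space(2)[OF W0 r(1)] v0 by blast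
  then obtain w where w: "\<forall>l. w l \<in> W" "restrict0 U (tpoly (Suc r) w) \<in> K" "w r = v0"
    using lead_spaceD by blast
  have "of_nat r = m i + of_nat N - of_nat i" using \<iota>(3) r by simp
  then have "restrict0 U (tpoly (Suc r) w) \<in> kernel_polys N n d E z m U i (w r)"
    by (rule kernel_polysI[where w = w, OF _ w(1)[rule_format] w(2)])
  then show ?thesis unfolding w(3) by (rule ex_in_conv[THEN iffD1, OF exI])
qed

text \<open>Every nonzero solution is by itself such a polynomial: its leading coefficient is
  singular and nonzero, and its degree lies in \<open>R\<close>.\<close>

lemma span_kernel_polys:
  "tensor_fun.span (\<Union>i\<in>{1..N}. \<Union>v0\<in>W - {0}. kernel_polys N n d E z m U i v0) = K"
proof
  show "tensor_fun.span (\<Union>i\<in>{1..N}. \<Union>v0\<in>W - {0}. kernel_polys N n d E z m U i v0) \<subseteq> K"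
  proof (rule tensor_fun.span_minimal[OF _ subspace_K])
    show "(\<Union>i\<in>{1..N}. \<Union>v0\<in>W - {0}. kernel_polys N n d E z m U i v0) \<subseteq> K"
      unfolding kernel_polys_def by blast
  qed
  show "K \<subseteq> tensor_fun.span (\<Union>i\<in>{1..N}. \<Union>v0\<in>W - {0}. kernel_polys N n d E z m U i v0)"
  proof
    fix f assume f: "f \<in> K"
    show "f \<in> tensor_fun.span (\<Union>i\<in>{1..N}. \<Union>v0\<in>W - {0}. kernel_polys N n d E z m U i v0)"
    proof (cases "f = 0")
      case True
      then show ?thesis using tensor_fun.span_zero by (simp only:)
    next
      case False
      then obtain r w where w: "r \<in> R" "\<forall>l. w l \<in> W" "w r \<noteq> 0" "f = restrict0 U (tpoly (Suc r) w)"
        using K_cases[OF f] by blast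
      then obtain i where i: "i \<in> {1..N}" "of_nat r = m i + of_nat N - of_nat i" unfolding R_def by blast
      have "f \<in> kernel_polys N n d E z m U i (w r)"
        unfolding w(4) by (rule kernel_polysI[where w = w, OF i(2) w(2)[rule_format] f[unfolded w(4)]])
      moreover have "w r \<in> W - {0}" using w(2,3) by simp
      ultimately have "f \<in> (\<Union>i\<in>{1..N}. \<Union>v0\<in>W - {0}. kernel_polys N n d E z m U i v0)"
        using i(1) by (intro UN_I)
      then show ?thesis by (rule tensor_fun.span_base)
    qed
  qed
qed

end

theorem theorem12p3:
  fixes N n :: nat
    and \<Lambda> :: "nat \<Rightarrow> nat \<Rightarrow> complex"
    and d :: "nat \<Rightarrow> nat"
    and E :: "nat \<Rightarrow> nat \<Rightarrow> nat \<Rightarrow> complex mat"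
    and z m :: "nat \<Rightarrow> complex"
    and U :: "complex set"
  assumes "1 \<le> N"
    and "\<And>s. s \<in> {1..n} \<Longrightarrow> integral_dominant N (\<Lambda> s)"
    and "\<And>s. s \<in> {1..n} \<Longrightarrow> \<Lambda> s N = 0"
    and "\<And>s. s \<in> {1..n} \<Longrightarrow> is_M N (\<Lambda> s) (d s) (E s)"
    and "Sing N n d E m \<noteq> {0}"
    and "open U" "connected U" "simply_connected U" "U \<noteq> {}"
    and "\<And>j. j \<in> {1..n} \<Longrightarrow> z j \<notin> U"
  shows "(\<forall>i\<in>{1..N}. \<forall>v0\<in>Sing N n d E m - {0}. kernel_polys N n d E z m U i v0 \<noteq> {}) \<and>
    tensor_fun.span (\<Union>i\<in>{1..N}. \<Union>v0\<in>Sing N n d E m - {0}. kernel_polys N n d E z m U i v0)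
      = Sing_kernel N n d E z m U"
proof -
  \<comment> \<open>The conclusions of \<open>factor_model\<close> are bundled into one predicate,
    so that positions, submodule and map can be chosen for all factors at once.\<close>
  define model where "model j P T \<psi> \<longleftrightarrow> finite P \<and> flinear \<psi>
      \<and> (\<forall>t a b. t \<in> T \<longrightarrow> a \<in> {1..N} \<longrightarrow> b \<in> {1..N} \<longrightarrow> color_gl P a b t \<in> T)
      \<and> (\<forall>t \<kappa>. t \<in> T \<longrightarrow> \<kappa> \<notin> P \<rightarrow>\<^sub>E {1..N} \<longrightarrow> t \<kappa> = 0)
      \<and> (\<forall>t a b. t \<in> T \<longrightarrow> a \<in> {1..N} \<longrightarrow> b \<in> {1..N} \<longrightarrow> \<psi> (color_gl P a b t) = mat_op (d j) (E j a b) (\<psi> t))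
      \<and> (\<forall>i. i < d j \<longrightarrow> (\<exists>t\<in>T. \<psi> t = (\<lambda>k. of_bool (k = i))))"
    for j and P :: "(nat \<times> nat) set" and T \<psi>
  have "\<forall>j\<in>{1..n}. \<exists>P T \<psi>. model j P T \<psi>"
  proof
    fix j assume j: "j \<in> {1..n}"
    show "\<exists>P T \<psi>. model j P T \<psi>"
      unfolding model_def by (rule factor_model[OF assms(1) assms(2-4)[OF j]]) blast
  qed
  then obtain P T \<psi> where model: "\<And>j. j \<in> {1..n} \<Longrightarrow> model j (P j) (T j) (\<psi> j)"
    by metis
  note m = model[unfolded model_def]
  interpret M: tensor_model N n d E P T \<psi>
  proof (rule tensor_model.intro, goal_cases)
    case (1 j)
    show ?case by (rule m[OF 1, THEN conjunct1])
  next
    case (2 j)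
    show ?case by (rule m[OF 2, THEN conjunct2, THEN conjunct1])
  next
    case (3 j t a b)
    show ?case by (rule m[OF 3(1), THEN conjunct2, THEN conjunct2, THEN conjunct1, rule_format, OF 3(2-)])
  next
    case (4 j t \<kappa>)
    show ?case by (rule m[OF 4(1), THEN conjunct2, THEN conjunct2, THEN conjunct2, THEN conjunct1, rule_format, OF 4(2-)])
  next
    case (5 j t a b)
    show ?case by (rule m[OF 5(1), THEN conjunct2, THEN conjunct2, THEN conjunct2, THEN conjunct2, THEN conjunct1, rule_format, OF 5(2-)])
  next
    case (6 j i)
    show ?case by (rule m[OF 6(1), THEN conjunct2, THEN conjunct2, THEN conjunct2, THEN conjunct2, THEN conjunct2, rule_format, OF 6(2)])
  qed
  \<comment> \<open>The degree bound counts the positions of all factors together.\<close>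
  interpret sing_kernel N n d E z m U "N + card M.Pos"
  proof
    fix v x assume z: "\<And>j. j \<in> {1..n} \<Longrightarrow> z j \<noteq> v" and x: "\<And>i. i < N \<Longrightarrow> x i \<in> Sing N n d E m"
    show "\<exists>F. row_det [1..<N+1] (gen_X {1..n} (rxi v z) (\<lambda>j a b. factor_op n d j (E j a b))) F = (\<lambda>k. 0)
        \<and> (\<forall>i<N. coef F i = x i) \<and> (\<forall>l\<ge>N + card M.Pos. coef F l = 0) \<and> (\<forall>l. coef F l \<in> Sing N n d E m)"
      by (rule M.sing_solution[OF assms(1) z x])
  qed (fact assms)+
  show ?thesis by (intro conjI ballI kernel_polys_nonempty span_kernel_polys)
qed

end
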